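(* Let $m_e=(m_e(p))_{p\ge 0}$ be a sequence of moments, associated with a pair of kernel functions $e,E$, and let $\tilde{\mathbb{M}}$ be a strongly regular sequence with associated function $\tilde M$. Let $(\mathbb{E},\|\cdot\|_{\mathbb{E}})$ be a complex Banach space, let $d\in\mathbb{R}$, $\theta>0$, $r>0$, and let $\varphi\in\mathcal{O}^{\tilde{\mathbb{M}}}(\hat S_d(\theta;r),\mathbb{E})$. Then there exists $0<\tilde r<r$ such that for all $0<\theta_1<\theta$ the following statements hold (in particular $\partial_{m_e,z}^n\varphi$, defined near $0$ through the Taylor expansion, extends analytically to $\hat S_d(\theta_1;\tilde r)$): (1) For all $z\in\hat S_d(\theta_1;\tilde r)$ and all $n\in\mathbb{N}_0$, $$\partial_{m_e,z}^{n}\varphi(z)=\frac{1}{2\pi i}\oint_{\Gamma_z}\varphi(w)\int_0^{\infty(\tau)}\xi^n E(z\xi)\,\frac{e(w\xi)}{w\xi}\,d\xi\,dw,$$ where, for each $w$ on the path, the inner integral is taken along the ray from $0$ to $\infty$ in a suitable direction $\tau=\tau(w)\in\left(-\arg(w)-\frac{\omega(m_e)\pi}{2},\,-\arg(w)+\frac{\omega(m_e)\pi}{2}\right)$ depending on $w$, and $\Gamma_z$ is a closed path in $\hat S_d(\theta;r)\setminus\{0\}$, depending on $z$, which is a deformation of the positively oriented circle $\{|w|=r_1\}$, for any choice of $0<r_1<r$. (2) There exist constants $C_1,C_2,C_3>0$ such that $$\left\|\partial_{m_e,z}^{n}\varphi(z)\right\|_{\mathbb{E}}\le C_1C_2^n\,m_e(n)\exp\left(\tilde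 M(C_3|z|)\right)$$ for all $n\in\mathbb{N}_0$ and all $z\in\hat S_d(\theta_1;\tilde r)$.
   Context: Sectors. $S_d(\theta)=\{z\in\mathcal{R}:|\arg(z)-d|<\theta/2\}$ is the open infinite sector on the Riemann surface $\mathcal{R}$ of the logarithm with bisecting direction $d\in\mathbb{R}$ and opening $\theta>0$; $\hat S_d(\theta;r)=S_d(\theta)\cup D(0,r)$. $\mathbb{N}_0=\{0,1,2,\dots\}$. Strongly regular sequences. A sequence $\mathbb{M}=(M_p)_{p\ge0}$ of positive reals with $M_0=1$ is strongly regular if: (lc) $M_p^2\le M_{p-1}M_{p+1}$ for all $p\ge1$; (mg) there is $A_1>0$ with $M_{p+q}\le A_1^{p+q}M_pM_q$ for all $p,q\ge0$; (snq) there is $A_2>0$ with $\sum_{q\ge p}\frac{M_q}{(q+1)M_{q+1}}\le A_2\frac{M_p}{M_{p+1}}$ for all $p\ge0$. Its associated function is $M(t)=\sup_{p\ge0}\log(t^p/M_p)$ for $t>0$, $M(0)=0$ (for $\tilde{\mathbb{M}}$ it is denoted $\tilde M$). Put $\rho(M)=\limsup_{t\to\infty}\max\{0,\log M(t)/\log t\}$, a positive real number, and $\omega(\mathbb{M})=1/\rho(M)$. Growth spaces. $\mathcal{O}^{\mathbb{M}}(\hat S_d(\theta;r),\mathbb{E})$ is the set of holomorphic $f:\hat S_d(\theta;r)\to\mathbb{E}$ such that for every $0<\theta'<\theta$ and $0<r'<r$ there exist $\tilde c,\tilde k>0$ with $\|f(z)\|_{\mathbb{E}}\le\tilde c\exp(M(|z|/\tilde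 k))$ for all $z\in\hat S_d(\theta';r')$. Kernel functions and moments. Let $\mathbb{M}$ be a strongly regular sequence with $\omega(\mathbb{M})<2$. Functions $e,E$ are kernel functions for $\mathbb{M}$-summability if: (1) $e$ is holomorphic on $S_0(\omega(\mathbb{M})\pi)$; there is $t_0>0$ such that every $z_0\in S_0(\omega(\mathbb{M})\pi)$ has a neighborhood $U\subseteq S_0(\omega(\mathbb{M})\pi)$ with $\int_0^{t_0}\sup_{z\in U}|e(t/z)|\frac{dt}{t}<\infty$; for every $\epsilon>0$ there are $c,k>0$ with $|e(z)|\le c\exp(-M(|z|/k))$ for $z\in S_0(\omega(\mathbb{M})\pi-\epsilon)$; and $e(x)\in\mathbb{R}$ for $x>0$. (2) $E$ is entire, $|E(z)|\le\tilde c\exp(M(|z|/\tilde k))$ on $\mathbb{C}$ for some $\tilde c,\tilde k>0$; and there is $\beta>0$ such that for all $0<\tilde\theta<2\pi-\omega(\mathbb{M})\pi$ and $M_E>0$ there is $\tilde c_2>0$ with $|E(z)|\le\tilde c_2|z|^{-\beta}$ for $z\in S_\pi(\tilde\theta)\setminus D(0,M_E)$. (3) The moment function $m_e(z)=\int_0^\infty t^{z-1}e(t)\,dt$ is continuous on $\{\mathrm{Re}(z)\ge0\}$ and holomorphic on $\{\mathrm{Re}(z)>0\}$, and $E(z)=\sum_{p\ge0}z^p/m_e(p)$ for $z\in\mathbb{C}$. A sequence of moments is a sequence $m_e=(m_e(p))_{p\ge0}$ arising from such a pair of kernels for some strongly regular $\mathbb{M}$. It is a known fact that $m_e$ is then itself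 strongly regular and equivalent to $\mathbb{M}$ (i.e. $B_1^pM_p\le m_e(p)\le B_2^pM_p$ for all $p$ and some $B_1,B_2>0$), so $\omega(m_e)=\omega(\mathbb{M})$. Moment differentiation. $\partial_{m_e,z}:\mathbb{E}[[z]]\to\mathbb{E}[[z]]$ is the linear operator $\partial_{m_e,z}\left(\sum_{p\ge0}\frac{u_p}{m_e(p)}z^p\right)=\sum_{p\ge0}\frac{u_{p+1}}{m_e(p)}z^p$; it acts on functions holomorphic near the origin via their Taylor expansion at $0$. *)

theory Defs
  imports "HOL-Analysis.Analysis"
begin

class complex_banach = banach +
  fixes scaleC :: "complex \<Rightarrow> 'a \<Rightarrow> 'a" (infixr \<open>*\<^sub>C\<close> 75)
  assumes scaleC_add_right: "a *\<^sub>C (x + y) = a *\<^sub>C x + a *\<^sub>C y"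
    and scaleC_add_left: "(a + b) *\<^sub>C x = a *\<^sub>C x + b *\<^sub>C x"
    and scaleC_scaleC: "a *\<^sub>C (b *\<^sub>C x) = (a * b) *\<^sub>C x"
    and scaleC_one: "1 *\<^sub>C x = x"
    and scaleR_scaleC: "t *\<^sub>R x = complex_of_real t *\<^sub>C x"
    and norm_scaleC: "norm (a *\<^sub>C x) = cmod a * norm x"

instantiation complex :: complex_banach
begin

definition scaleC_complex :: "complex \<Rightarrow> complex \<Rightarrow> complex" where
  "scaleC_complex a x = a * x"

instance
  by standard (simp_all add: scaleC_complex_def algebra_simps norm_mult scaleR_conv_of_real)

end

text \<open>The library's notion of holomorphy is restricted to complex-valued functions.\<close>

definition vec_holomorphic_on :: "(complex \<Rightarrow> 'e::complex_banach) \<Rightarrow> complex set \<Rightarrow> bool" where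
  "vec_holomorphic_on f S \<longleftrightarrow>
     (\<forall>x\<in>S. \<exists>D. (f has_derivative (\<lambda>h. h *\<^sub>C D)) (at x within S))"

text \<open>
  The Riemann surface of the logarithm is identified with the complex plane by the logarithm:
  \<open>\<zeta>\<close> stands for the point with modulus \<open>exp (Re \<zeta>)\<close> and argument \<open>Im \<zeta>\<close>, and \<open>exp\<close> is the
  projection to the punctured plane. The set \<open>log_sector d \<theta>\<close> is the sector with bisecting
  direction \<open>d\<close> and opening \<open>\<theta>\<close> in this coordinate. Its projection \<open>plane_sector d \<theta>\<close> is only
  used for openings below \<open>2 * pi\<close>, where the projection is injective.
\<close>

definition log_sector :: "real \<Rightarrow> real \<Rightarrow> complex set" where
  "log_sector d \<theta> = {\<zeta>. \<bar>Im \<zeta> - d\<bar> < \<theta> / 2}"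

definition plane_sector :: "real \<Rightarrow> real \<Rightarrow> complex set" where
  "plane_sector d \<theta> = exp ` log_sector d \<theta>"

text \<open>
  A point of the union of a sector and a disc about the origin is either a point of the disc or
  a point of the sector (given by its logarithm). The opening may exceed \<open>2 * pi\<close>, so the union
  cannot be taken inside the plane. A point of the sector of modulus below \<open>r\<close> is the same point
  as its projection to the disc of radius \<open>r\<close>: it has two names, and functions and open sets are
  required to respect this identification.
\<close>

datatype hat_point = Disc complex | Sect complex

primrec proj :: "hat_point \<Rightarrow> complex" where
  "proj (Disc z) = z"
| "proj (Sect \<zeta>) = exp \<zeta>"

primrec args :: "hat_point \<Rightarrow> real set" where
  "args (Disc z) = {\<alpha>. z = of_real (cmod z) * cis \<alpha>}"
| "args (Sect \<zeta>) = {Im \<zeta>}"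

definition hat_sector :: "real \<Rightarrow> real \<Rightarrow> real \<Rightarrow> hat_point set" where
  "hat_sector d \<theta> r = Disc ` ball 0 r \<union> Sect ` log_sector d \<theta>"

definition hat_open :: "real \<Rightarrow> real \<Rightarrow> real \<Rightarrow> hat_point set \<Rightarrow> bool" where
  "hat_open d \<theta> r U \<longleftrightarrow>
     U \<subseteq> hat_sector d \<theta> r \<and> open (Disc -` U) \<and> open (Sect -` U) \<and>
     (\<forall>\<zeta>\<in>log_sector d \<theta>. cmod (exp \<zeta>) < r \<longrightarrow> (Sect \<zeta> \<in> U \<longleftrightarrow> Disc (exp \<zeta>) \<in> U))"

definition hat_topology :: "real \<Rightarrow> real \<Rightarrow> real \<Rightarrow> hat_point topology" where
  "hat_topology d \<theta> r = topology (hat_open d \<theta> r)"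

lemma istopology_hat_open: "istopology (hat_open d \<theta> r)"
  unfolding istopology_def
proof (intro conjI allI impI)
  fix S T assume "hat_open d \<theta> r S" "hat_open d \<theta> r T"
  then show "hat_open d \<theta> r (S \<inter> T)"
    unfolding hat_open_def vimage_Int by blast
next
  fix K assume "\<forall>U\<in>K. hat_open d \<theta> r U"
  then show "hat_open d \<theta> r (\<Union>K)"
    unfolding hat_open_def vimage_Union by blast
qed

lemma openin_hat_topology: "openin (hat_topology d \<theta> r) U \<longleftrightarrow> hat_open d \<theta> r U"
  by (simp add: hat_topology_def istopology_hat_open topology_inverse')

text \<open>
  On the sector, holomorphy is expressed in the logarithmic coordinate; \<open>exp\<close> is locally
  biholomorphic.
\<close>

definition hat_holomorphic ::
    "real \<Rightarrow> real \<Rightarrow> real \<Rightarrow> (hat_point \<Rightarrow> 'e::complex_banach) \<Rightarrow> bool" where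
  "hat_holomorphic d \<theta> r f \<longleftrightarrow>
     vec_holomorphic_on (\<lambda>z. f (Disc z)) (ball 0 r) \<and>
     vec_holomorphic_on (\<lambda>\<zeta>. f (Sect \<zeta>)) (log_sector d \<theta>) \<and>
     (\<forall>\<zeta>\<in>log_sector d \<theta>. cmod (exp \<zeta>) < r \<longrightarrow> f (Sect \<zeta>) = f (Disc (exp \<zeta>)))"

definition strongly_regular :: "(nat \<Rightarrow> real) \<Rightarrow> bool" where
  "strongly_regular M \<longleftrightarrow>
     (\<forall>p. 0 < M p) \<and> M 0 = 1 \<and>
     (\<forall>p\<ge>1. (M p)\<^sup>2 \<le> M (p - 1) * M (p + 1)) \<and>
     (\<exists>A>0. \<forall>p q. M (p + q) \<le> A ^ (p + q) * M p * M q) \<and>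
     (\<exists>A>0. \<forall>p. summable (\<lambda>j. M (p + j) / (real (p + j + 1) * M (p + j + 1))) \<and>
        (\<Sum>j. M (p + j) / (real (p + j + 1) * M (p + j + 1))) \<le> A * (M p / M (p + 1)))"

text \<open>
  For a strongly regular sequence (and for any sequence equivalent to one) the supremum below is
  finite for every \<open>t\<close>.
\<close>

definition assoc_fun :: "(nat \<Rightarrow> real) \<Rightarrow> real \<Rightarrow> real" where
  "assoc_fun M t = (if t = 0 then 0 else (SUP p. ln (t ^ p / M p)))"

definition growth_order :: "(nat \<Rightarrow> real) \<Rightarrow> real" where
  "growth_order M =
     real_of_ereal (Limsup at_top (\<lambda>t. ereal (max 0 (ln (assoc_fun M t) / ln t))))"

definition omega :: "(nat \<Rightarrow> real) \<Rightarrow> real" where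
  "omega M = 1 / growth_order M"

definition growth_space ::
    "(nat \<Rightarrow> real) \<Rightarrow> real \<Rightarrow> real \<Rightarrow> real \<Rightarrow> (hat_point \<Rightarrow> 'e::complex_banach) set" where
  "growth_space M d \<theta> r =
     {f. hat_holomorphic d \<theta> r f \<and>
         (\<forall>\<theta>' r'. 0 < \<theta>' \<and> \<theta>' < \<theta> \<and> 0 < r' \<and> r' < r \<longrightarrow>
            (\<exists>c>0. \<exists>k>0. \<forall>z\<in>hat_sector d \<theta>' r'.
               norm (f z) \<le> c * exp (assoc_fun M (cmod (proj z) / k))))}"

definition moment_fun :: "(complex \<Rightarrow> complex) \<Rightarrow> complex \<Rightarrow> complex" where
  "moment_fun e z =
     (LINT t:{0<..}|lborel. complex_of_real t powr (z - 1) * e (complex_of_real t))"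

definition kernel_e :: "(nat \<Rightarrow> real) \<Rightarrow> (complex \<Rightarrow> complex) \<Rightarrow> bool" where
  "kernel_e M e \<longleftrightarrow>
     e holomorphic_on plane_sector 0 (omega M * pi) \<and>
     (\<exists>t0>0. \<forall>z0\<in>plane_sector 0 (omega M * pi).
        \<exists>U. open U \<and> z0 \<in> U \<and> U \<subseteq> plane_sector 0 (omega M * pi) \<and>
          (\<integral>\<^sup>+t\<in>{0<..<t0}. (SUP z\<in>U. ennreal (cmod (e (complex_of_real t / z)))) / ennreal t
             \<partial>lborel) < \<infinity>) \<and>
     (\<forall>\<epsilon>>0. \<exists>c>0. \<exists>k>0. \<forall>z\<in>plane_sector 0 (omega M * pi - \<epsilon>).
        cmod (e z) \<le> c * exp (- assoc_fun M (cmod z / k))) \<and>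
     (\<forall>x>0. e (complex_of_real x) \<in> \<real>)"

definition kernel_E :: "(nat \<Rightarrow> real) \<Rightarrow> (complex \<Rightarrow> complex) \<Rightarrow> bool" where
  "kernel_E M E \<longleftrightarrow>
     E holomorphic_on UNIV \<and>
     (\<exists>c>0. \<exists>k>0. \<forall>z. cmod (E z) \<le> c * exp (assoc_fun M (cmod z / k))) \<and>
     (\<exists>\<beta>>0. \<forall>\<theta> R. 0 < \<theta> \<and> \<theta> < 2 * pi - omega M * pi \<and> 0 < R \<longrightarrow>
        (\<exists>c>0. \<forall>z\<in>plane_sector pi \<theta> - ball 0 R. cmod (E z) \<le> c * cmod z powr (- \<beta>)))"

definition kernel_functions ::
    "(nat \<Rightarrow> real) \<Rightarrow> (complex \<Rightarrow> complex) \<Rightarrow> (complex \<Rightarrow> complex) \<Rightarrow> bool" where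
  "kernel_functions M e E \<longleftrightarrow>
     kernel_e M e \<and> kernel_E M E \<and>
     continuous_on {z. 0 \<le> Re z} (moment_fun e) \<and>
     moment_fun e holomorphic_on {z. 0 < Re z} \<and>
     (\<forall>z. (\<lambda>p. z ^ p / moment_fun e (of_nat p)) sums E z)"

text \<open>
  The moments are real because \<open>e\<close> is real on the positive axis. Positivity is part of the
  convention that a moment sequence is again strongly regular, but it does not follow from the
  conditions on the kernels alone: they are invariant under replacing \<open>(e, E)\<close> by \<open>(- e, - E)\<close>.
  Of strong regularity, only positivity is imposed here.
\<close>

definition moment_sequence ::
    "(nat \<Rightarrow> real) \<Rightarrow> (complex \<Rightarrow> complex) \<Rightarrow> (complex \<Rightarrow> complex) \<Rightarrow> bool" where
  "moment_sequence m e E \<longleftrightarrow>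
     (\<exists>M. strongly_regular M \<and> omega M < 2 \<and> kernel_functions M e E) \<and>
     (\<forall>p. complex_of_real (m p) = moment_fun e (of_nat p) \<and> 0 < m p)"

text \<open>
  A series with coefficients \<open>f\<^sub>p = u\<^sub>p / m p\<close> is sent to the one with coefficients
  \<open>u\<^sub>p\<^sub>+\<^sub>1 / m p\<close>, where \<open>u\<^sub>p\<^sub>+\<^sub>1 = m (p + 1) f\<^sub>p\<^sub>+\<^sub>1\<close>.
\<close>

definition moment_diff :: "(nat \<Rightarrow> real) \<Rightarrow> 'e::complex_banach fps \<Rightarrow> 'e fps" where
  "moment_diff m F = Abs_fps (\<lambda>p. (m (Suc p) *\<^sub>R fps_nth F (Suc p)) /\<^sub>R m p)"

definition has_taylor_at_0 :: "(complex \<Rightarrow> 'e::complex_banach) \<Rightarrow> 'e fps \<Rightarrow> bool" where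
  "has_taylor_at_0 f F \<longleftrightarrow>
     (\<exists>\<epsilon>>0. \<forall>z\<in>ball 0 \<epsilon>. (\<lambda>p. z ^ p *\<^sub>C fps_nth F p) sums f z)"

definition is_moment_derivative ::
    "(nat \<Rightarrow> real) \<Rightarrow> nat \<Rightarrow> (hat_point \<Rightarrow> 'e::complex_banach) \<Rightarrow> (hat_point \<Rightarrow> 'e) \<Rightarrow> bool" where
  "is_moment_derivative m n \<phi> \<psi> \<longleftrightarrow>
     (\<exists>F. has_taylor_at_0 (\<lambda>z. \<phi> (Disc z)) F \<and>
          has_taylor_at_0 (\<lambda>z. \<psi> (Disc z)) ((moment_diff m ^^ n) F))"

definition ray_integrable :: "real \<Rightarrow> (complex \<Rightarrow> complex) \<Rightarrow> bool" where
  "ray_integrable \<tau> f \<longleftrightarrow>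
     set_integrable lborel {0<..} (\<lambda>s. f (complex_of_real s * cis \<tau>) * cis \<tau>)"

definition ray_integral :: "real \<Rightarrow> (complex \<Rightarrow> complex) \<Rightarrow> complex" where
  "ray_integral \<tau> f =
     (LINT s:{0<..}|lborel. f (complex_of_real s * cis \<tau>) * cis \<tau>)"

definition kernel_integrand ::
    "(complex \<Rightarrow> complex) \<Rightarrow> (complex \<Rightarrow> complex) \<Rightarrow> nat \<Rightarrow> complex \<Rightarrow> complex \<Rightarrow> complex \<Rightarrow> complex" where
  "kernel_integrand e E n z w \<xi> = \<xi> ^ n * E (z * \<xi>) * (e (w * \<xi>) / (w * \<xi>))"

definition has_hat_contour_integral ::
    "(hat_point \<Rightarrow> 'e::complex_banach) \<Rightarrow> 'e \<Rightarrow> (real \<Rightarrow> hat_point) \<Rightarrow> bool" where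
  "has_hat_contour_integral f I \<gamma> \<longleftrightarrow>
     ((\<lambda>t. vector_derivative (proj \<circ> \<gamma>) (at t within {0..1}) *\<^sub>C f (\<gamma> t)) has_integral I) {0..1}"

text \<open>
  Free homotopy of closed paths in the punctured space, with the positively oriented circle of
  radius \<open>\<rho>\<close> as initial path.
\<close>

definition deformation_of_circle ::
    "real \<Rightarrow> real \<Rightarrow> real \<Rightarrow> real \<Rightarrow> (real \<Rightarrow> hat_point) \<Rightarrow> bool" where
  "deformation_of_circle d \<theta> r \<rho> \<gamma> \<longleftrightarrow>
     homotopic_with (\<lambda>p. p 1 = p 0) (top_of_set {0..1})
       (subtopology (hat_topology d \<theta> r) (- {Disc 0}))
       (\<lambda>t. Disc (complex_of_real \<rho> * cis (2 * pi * t))) \<gamma>"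

end

theory Submission
  imports Defs "HOL-Complex_Analysis.Complex_Analysis"
begin

text \<open>
  Scaling and rotating \<open>\<xi>\<close> turns the inner integral into \<open>G\<^sub>n (z / w) / w\<^bsup>n+1\<^esup>\<close>, where
  \<open>G\<^sub>n u = (\<Sum>p. m (n + p) / m p * u\<^bsup>p\<^esup>)\<close> near \<open>0\<close>. For \<open>u\<close> off the positive axis a ray can be chosen
  on which \<open>e\<close> decays and \<open>E\<close> is bounded, because the opening \<open>\<omega> \<pi>\<close> of the sector of \<open>e\<close> and the
  opening \<open>2 \<pi> - \<omega> \<pi>\<close> of the sector of \<open>E\<close> add up to \<open>2 \<pi>\<close>; so \<open>G\<^sub>n\<close> continues holomorphically to
  the plane slit along \<open>[c, \<infinity>)\<close>, with a bound \<open>C B\<^bsup>n\<^esup> m n\<close> away from the slit. Cauchy's formula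
  on a small circle shows that the contour integral of \<open>G\<^sub>n (z / w) / w\<^bsup>n+1\<^esup> \<phi> w\<close> is the moment
  derivative near \<open>0\<close>. For \<open>z\<close> in the sector the circle is given a bulge around the direction of \<open>z\<close>, so
  that it does not meet the segment \<open>(0, z / c]\<close>; the size of the bulge is proportional to
  \<open>cmod z\<close>, which gives the bound. Contour integrals with values in a Banach space are reduced to
  complex ones by the Hahn-Banach theorem.
\<close>

subsection \<open>Contour integrals with values in a Banach space\<close>

text \<open>Three requirements shape the choices. The radius \<open>rt\<close> must not depend on
  \<open>\<theta>1\<close>: it comes from the circle \<open>\<rho>\<close> and the radius
  \<open>c\<close> of the series alone, and \<open>\<theta>1\<close> enters only through the
  half-width \<open>\<delta>\<close> of the bulge. The estimate must carry \<open>m n\<close>, while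
  the hypotheses on \<open>e\<close> and \<open>E\<close> speak of \<open>M\<close>: the decay of
  \<open>e\<close> bounds the moments above, Cauchy's inequality for the coefficients
  \<open>1 / m n\<close> of \<open>E\<close> bounds them below, and this equivalence also gives
  \<open>omega m = omega M\<close>. Finally, the length of the path brings in a factor linear in
  \<open>cmod z\<close> besides the growth of \<open>\<phi>\<close>; moderate growth of
  \<open>Mt\<close> turns the product of two growth factors into one with a dilated argument. As the
  opening may exceed a full turn, no single planar domain carries \<open>\<phi>\<close>. For one
  \<open>z\<close>, however, the path leaves the disc only in directions close to that of
  \<open>z\<close>, and there a planar reading of \<open>\<phi>\<close> suffices. The path moves
  with \<open>z\<close>, so holomorphy in \<open>z\<close> is obtained by freezing the path near a
  given point and deforming it.\<close>

text \<open>
  Partial functionals are represented by their graphs, subspaces of \<open>'a \<times> real\<close>; domination by the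
  norm makes such a subspace single-valued.
\<close>

lemma hahn_banach_norming:
  fixes x :: "'a::real_normed_vector"
  obtains f :: "'a \<Rightarrow> real" where "bounded_linear f" "f x = norm x"
proof -
  define P where "P G \<longleftrightarrow> subspace G \<and> (\<forall>(y, a)\<in>G. a \<le> norm y) \<and> (x, norm x) \<in> G"
    for G :: "('a \<times> real) set"
  have *: "t * norm x \<le> \<bar>t\<bar> * norm x" for t
    by (intro mult_right_mono) auto
  have "P (span {(x, norm x)})"
    unfolding P_def using subspace_span[of "{(x, norm x)}"] span_base[of "(x, norm x)" "{(x, norm x)}"]
    by (auto simp: span_singleton *)
  then have ne: "Collect P \<noteq> {}"
    by auto
  have chain: "\<Union>C \<in> Collect P" if "C \<noteq> {}" "subset.chain (Collect P) C" for C
  proof -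
    have CP: "P G" if "G \<in> C" for G
      using that \<open>subset.chain _ C\<close> by (auto simp: subset.chain_def)
    have tot: "G \<subseteq> H \<or> H \<subseteq> G" if "G \<in> C" "H \<in> C" for G H
      using that \<open>subset.chain _ C\<close> by (auto simp: subset.chain_def)
    have "subspace (\<Union>C)"
    proof (rule subspaceI)
      show "0 \<in> \<Union>C"
        using \<open>C \<noteq> {}\<close> CP by (auto simp: P_def intro: subspace_0)
      show "u + v \<in> \<Union>C" if uv: "u \<in> \<Union>C" "v \<in> \<Union>C" for u v
      proof -
        obtain G H where GH: "G \<in> C" "u \<in> G" "H \<in> C" "v \<in> H"
          using uv by blast
        then consider "u \<in> H" | "v \<in> G"
          using tot by blast
        then show ?thesis
          using GH CP by cases (auto simp: P_def intro: subspace_add)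
      qed
      show "t *\<^sub>R u \<in> \<Union>C" if "u \<in> \<Union>C" for t u
        using that CP by (auto simp: P_def intro: subspace_mul)
    qed
    moreover have "a \<le> norm y" if "(y, a) \<in> \<Union>C" for y a
      using that CP by (auto simp: P_def)
    moreover have "(x, norm x) \<in> \<Union>C"
      using \<open>C \<noteq> {}\<close> CP by (auto simp: P_def)
    ultimately show ?thesis
      by (auto simp: P_def)
  qed
  obtain G where G: "P G" and G_max: "\<And>H. P H \<Longrightarrow> G \<subseteq> H \<Longrightarrow> H = G"
    using subset_Zorn_nonempty[OF ne chain] by auto
  have sub: "subspace G" and le: "\<And>y a. (y, a) \<in> G \<Longrightarrow> a \<le> norm y" and xG: "(x, norm x) \<in> G"
    using G by (auto simp: P_def)
  have dom: "\<exists>b. (v, b) \<in> G" for v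
  proof -
    have *: "a' - norm (y' - v) \<le> norm (y + v) - a" if "(y, a) \<in> G" "(y', a') \<in> G" for y a y' a'
    proof -
      have "a + a' \<le> norm (y + y')"
        using le subspace_add[OF sub that] by simp
      also have "y + y' = (y + v) + (y' - v)"
        by simp
      also have "norm \<dots> \<le> norm (y + v) + norm (y' - v)"
        by (rule norm_triangle_ineq)
      finally show ?thesis
        by simp
    qed
    \<comment> \<open>The value \<open>b\<close> at \<open>v\<close> has to lie above all
      \<open>a - norm (y - v)\<close> and below all \<open>norm (y + v) - a\<close> for points
      \<open>(y, a)\<close> of the graph. The inequality just shown separates the two families, so
      the supremum of the lower one serves.\<close>
    define b where "b = (SUP (y, a)\<in>G. a - norm (y - v))"
    have bdd: "bdd_above ((\<lambda>(y, a). a - norm (y - v)) ` G)"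
      using *[OF xG] by (intro bdd_aboveI[where M = "norm (x + v) - norm x"]) auto
    have b1: "a - b \<le> norm (y - v)" if "(y, a) \<in> G" for y a
      using cSUP_upper[OF that bdd] by (simp add: b_def)
    have b2: "a + b \<le> norm (y + v)" if "(y, a) \<in> G" for y a
    proof -
      have "b \<le> norm (y + v) - a"
        unfolding b_def using xG *[OF that] by (intro cSUP_least) auto
      then show ?thesis
        by simp
    qed
    define H where "H = span (insert (v, b) G)"
    have "a \<le> norm y" if yH: "(y, a) \<in> H" for y a
    proof -
      obtain t where t: "(y - t *\<^sub>R v, a - t * b) \<in> G"
        using yH by (auto simp: H_def span_insert span_eq_iff[THEN iffD2, OF sub])
      \<comment> \<open>Division by the modulus of \<open>t\<close> reduces to the coefficients 1
        and -1 of \<open>v\<close>, where \<open>b2\<close> and \<open>b1\<close> are the required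
        bounds.\<close>
      consider "t = 0" | "t > 0" | "t < 0"
        by linarith
      then show ?thesis
      proof cases
        case 1
        then show ?thesis using t le by simp
      next
        case 2
        have "(inverse t *\<^sub>R (y - t *\<^sub>R v), inverse t * (a - t * b)) \<in> G"
          using subspace_mul[OF sub t, of "inverse t"] by simp
        from b2[OF this] have "inverse t * a \<le> norm (inverse t *\<^sub>R y)"
          using 2 by (simp add: algebra_simps)
        then show ?thesis
          using 2 by (simp add: field_simps)
      next
        case 3
        have "(inverse (-t) *\<^sub>R (y - t *\<^sub>R v), inverse (-t) * (a - t * b)) \<in> G"
          using subspace_mul[OF sub t, of "inverse (-t)"] by simp
        from b1[OF this] have "inverse (-t) * a \<le> norm (inverse (-t) *\<^sub>R y)"
          using 3 by (simp add: algebra_simps)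
        then show ?thesis
          using 3 by (simp add: field_simps)
      qed
    qed
    moreover have "G \<subseteq> H" "(v, b) \<in> H"
      by (auto simp: H_def intro: span_base)
    moreover have "subspace H"
      by (simp add: H_def)
    ultimately have "P H"
      using xG by (auto simp: P_def)
    with G_max \<open>G \<subseteq> H\<close> \<open>(v, b) \<in> H\<close> show ?thesis
      by blast
  qed
  have uniq: "a = b" if "(y, a) \<in> G" "(y, b) \<in> G" for y a b
    using le[of 0 "a - b"] le[of 0 "b - a"] subspace_diff[OF sub that]
      subspace_diff[OF sub that(2,1)] by simp
  define f where "f y = (THE a. (y, a) \<in> G)" for y
  have fG: "(y, f y) \<in> G" for y
    unfolding f_def using dom[of y] uniq by (metis theI)
  have f_eq: "f y = a" if "(y, a) \<in> G" for y a
    using uniq fG that by blast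
  have le': "f y \<le> norm y" for y
    using fG le by blast
  have "bounded_linear f"
  proof (rule bounded_linear_intro[where K = 1])
    show "f (y + y') = f y + f y'" for y y'
      using subspace_add[OF sub fG[of y] fG[of y']] by (auto intro: f_eq)
    show scale: "f (t *\<^sub>R y) = t *\<^sub>R f y" for t y
      using subspace_mul[OF sub fG[of y], of t] by (auto intro: f_eq)
    show "norm (f y) \<le> norm y * 1" for y
      using le'[of y] le'[of "-y"] scale[of "-1" y] by simp
  qed
  moreover have "f x = norm x"
    using xG by (rule f_eq)
  ultimately show thesis
    by (rule that)
qed

section \<open>Complex functionals and separation of points\<close>

definition complex_functional :: "('a::complex_banach \<Rightarrow> complex) \<Rightarrow> bool" where
  "complex_functional l \<longleftrightarrow> bounded_linear l \<and> (\<forall>a x. l (a *\<^sub>C x) = a * l x)"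

lemma bounded_bilinear_scaleC:
  "bounded_bilinear ((*\<^sub>C) :: complex \<Rightarrow> 'a \<Rightarrow> 'a::complex_banach)"
proof
  fix a b :: complex and x y :: 'a and t :: real
  show "(a + b) *\<^sub>C x = a *\<^sub>C x + b *\<^sub>C x" "a *\<^sub>C (x + y) = a *\<^sub>C x + a *\<^sub>C y"
    by (simp_all add: scaleC_add_left scaleC_add_right)
  show "(t *\<^sub>R a) *\<^sub>C x = t *\<^sub>R a *\<^sub>C x" "a *\<^sub>C t *\<^sub>R x = t *\<^sub>R a *\<^sub>C x"
    by (simp_all add: scaleR_scaleC scaleC_scaleC scaleC_complex_def mult.commute)
  show "\<exists>K. \<forall>(a::complex) (x::'a). norm (a *\<^sub>C x) \<le> norm a * norm x * K"
    by (intro exI[of _ 1]) (simp add: norm_scaleC)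
qed

interpretation scaleC: bounded_bilinear "(*\<^sub>C) :: complex \<Rightarrow> 'a \<Rightarrow> 'a::complex_banach"
  by (rule bounded_bilinear_scaleC)

text \<open>A norming real functional \<open>f\<close> is complexified to
  \<open>f y - \<i> * f (\<i> y)\<close>, which is complex homogeneous and whose real part at
  \<open>x\<close> is still \<open>norm x\<close>.\<close>

lemma complex_functional_separates:
  fixes x :: "'a::complex_banach"
  assumes "x \<noteq> 0"
  obtains l where "complex_functional l" "l x \<noteq> 0"
proof -
  obtain f where f: "bounded_linear f" "f x = norm x"
    by (rule hahn_banach_norming)
  interpret f: bounded_linear f by fact
  define l where "l y = of_real (f y) - \<i> * of_real (f (\<i> *\<^sub>C y))" for y
  have "bounded_linear l"
    unfolding l_def
    by (intro bounded_linear_sub bounded_linear_compose[OF bounded_linear_of_real f(1)]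
        bounded_linear_compose[OF bounded_linear_mult_right]
        bounded_linear_compose[OF bounded_linear_of_real]
        bounded_linear_compose[OF f(1)] scaleC.bounded_linear_right)
  moreover have "l (a *\<^sub>C y) = a * l y" for a y
  proof -
    have a: "a *\<^sub>C y = Re a *\<^sub>R y + Im a *\<^sub>R (\<i> *\<^sub>C y)"
      by (simp add: scaleR_scaleC scaleC_scaleC complex_eq[of a, symmetric] mult.commute
          flip: scaleC_add_left)
    have ia: "\<i> *\<^sub>C a *\<^sub>C y = Re a *\<^sub>R (\<i> *\<^sub>C y) - Im a *\<^sub>R y"
    proof -
      have "\<i> * a = of_real (Re a) * \<i> + - of_real (Im a)"
        by (simp add: complex_eq_iff)
      then show ?thesis
        by (simp only: scaleR_scaleC scaleC_scaleC scaleC_add_left scaleC.minus_left) simp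
    qed
    show ?thesis
      unfolding l_def ia unfolding a
      by (simp add: f.add f.diff f.scaleR complex_eq_iff algebra_simps)
  qed
  moreover have "l x \<noteq> 0"
  proof -
    have "Re (l x) = norm x"
      by (simp add: l_def f)
    then show ?thesis
      using assms by auto
  qed
  ultimately show thesis
    using that by (auto simp: complex_functional_def)
qed

lemma eqI_complex_functional:
  fixes x y :: "'a::complex_banach"
  assumes "\<And>l. complex_functional l \<Longrightarrow> l x = l y"
  shows "x = y"
proof (rule ccontr)
  assume "x \<noteq> y"
  then obtain l where l: "complex_functional l" "l (x - y) \<noteq> 0"
    using complex_functional_separates[of "x - y"] by auto
  then interpret bounded_linear l
    by (simp add: complex_functional_def)
  show False
    using l assms[OF l(1)] by (simp add: diff)
qed

section \<open>Holomorphic functions with values in a Banach space\<close>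

lemma vec_holomorphic_on_imp_continuous_on:
  "vec_holomorphic_on f S \<Longrightarrow> continuous_on S f"
  by (auto simp: vec_holomorphic_on_def continuous_on_eq_continuous_within
      intro: has_derivative_continuous)

lemma vec_holomorphic_on_subset:
  "vec_holomorphic_on f S \<Longrightarrow> T \<subseteq> S \<Longrightarrow> vec_holomorphic_on f T"
  unfolding vec_holomorphic_on_def by (meson has_derivative_subset subsetD)

lemma vec_holomorphic_on_open:
  assumes "open S"
  shows "vec_holomorphic_on f S \<longleftrightarrow> (\<forall>x\<in>S. \<exists>D. (f has_derivative (\<lambda>h. h *\<^sub>C D)) (at x))"
  unfolding vec_holomorphic_on_def using at_within_open[OF _ assms] by metis

lemma vec_holomorphic_on_transform:
  assumes "vec_holomorphic_on f S" "\<And>x. x \<in> S \<Longrightarrow> f x = g x"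
  shows "vec_holomorphic_on g S"
  using assms unfolding vec_holomorphic_on_def by (metis has_derivative_transform)

lemma vec_holomorphic_on_Un:
  assumes "vec_holomorphic_on f S" "vec_holomorphic_on f T" "open S" "open T"
  shows "vec_holomorphic_on f (S \<union> T)"
  using assms by (auto simp: vec_holomorphic_on_open open_Un)

text \<open>The contour integrals of the proof are represented with a fixed path only near each
  single point; this rule puts such local representations together.\<close>

lemma vec_holomorphic_on_local:
  assumes "\<And>x. x \<in> S \<Longrightarrow> \<exists>T. open T \<and> x \<in> T \<and> vec_holomorphic_on f T"
  shows "vec_holomorphic_on f S"
  unfolding vec_holomorphic_on_def
proof
  fix x assume "x \<in> S"
  with assms obtain T where "open T" "x \<in> T" "vec_holomorphic_on f T"
    by blast
  then show "\<exists>D. (f has_derivative (\<lambda>h. h *\<^sub>C D)) (at x within S)"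
    by (auto simp: vec_holomorphic_on_open intro: has_derivative_at_withinI)
qed

lemma vec_holomorphic_on_scaleC:
  assumes f: "f holomorphic_on S" and g: "vec_holomorphic_on g S"
  shows "vec_holomorphic_on (\<lambda>x. f x *\<^sub>C g x) S"
  unfolding vec_holomorphic_on_def
proof
  fix x assume x: "x \<in> S"
  obtain D where D: "(g has_derivative (\<lambda>h. h *\<^sub>C D)) (at x within S)"
    using g x by (auto simp: vec_holomorphic_on_def)
  obtain d where d: "(f has_field_derivative d) (at x within S)"
    using f x by (auto simp: holomorphic_on_def field_differentiable_def)
  have "((\<lambda>x. f x *\<^sub>C g x) has_derivative (\<lambda>h. f x *\<^sub>C h *\<^sub>C D + (d * h) *\<^sub>C g x)) (at x within S)"
    using scaleC.FDERIV[OF d[unfolded has_field_derivative_def] D] .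
  also have "(\<lambda>h. f x *\<^sub>C h *\<^sub>C D + (d * h) *\<^sub>C g x) = (\<lambda>h. h *\<^sub>C (f x *\<^sub>C D + d *\<^sub>C g x))"
    by (simp add: scaleC_add_right scaleC_scaleC mult.commute)
  finally show "\<exists>D. ((\<lambda>x. f x *\<^sub>C g x) has_derivative (\<lambda>h. h *\<^sub>C D)) (at x within S)"
    by blast
qed

lemma vec_holomorphic_on_compose:
  assumes f: "f holomorphic_on S" and g: "vec_holomorphic_on g T" and "f ` S \<subseteq> T"
  shows "vec_holomorphic_on (\<lambda>x. g (f x)) S"
  unfolding vec_holomorphic_on_def
proof
  fix x assume x: "x \<in> S"
  obtain D where D: "(g has_derivative (\<lambda>h. h *\<^sub>C D)) (at (f x) within T)"
    using g x assms(3) by (auto simp: vec_holomorphic_on_def)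
  obtain d where d: "(f has_field_derivative d) (at x within S)"
    using f x by (auto simp: holomorphic_on_def field_differentiable_def)
  have "((\<lambda>x. g (f x)) has_derivative (\<lambda>h. (d * h) *\<^sub>C D)) (at x within S)"
    using has_derivative_in_compose[OF d[unfolded has_field_derivative_def]
        has_derivative_subset[OF D assms(3)]] .
  also have "(\<lambda>h. (d * h) *\<^sub>C D) = (\<lambda>h. h *\<^sub>C (d *\<^sub>C D))"
    by (simp add: scaleC_scaleC mult.commute)
  finally show "\<exists>D. ((\<lambda>x. g (f x)) has_derivative (\<lambda>h. h *\<^sub>C D)) (at x within S)"
    by blast
qed

lemma complex_functional_holomorphic:
  assumes l: "complex_functional l" and f: "vec_holomorphic_on f S"
  shows "(\<lambda>x. l (f x)) holomorphic_on S"
  unfolding holomorphic_on_def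
proof
  fix x assume "x \<in> S"
  then obtain D where "(f has_derivative (\<lambda>h. h *\<^sub>C D)) (at x within S)"
    using f by (auto simp: vec_holomorphic_on_def)
  then have "((\<lambda>x. l (f x)) has_derivative (\<lambda>h. l (h *\<^sub>C D))) (at x within S)"
    using l by (auto simp: complex_functional_def dest: bounded_linear.has_derivative)
  moreover have "(\<lambda>h. l (h *\<^sub>C D)) = (*) (l D)"
    using l by (auto simp: complex_functional_def)
  ultimately show "(\<lambda>x. l (f x)) field_differentiable (at x within S)"
    by (auto simp: field_differentiable_def has_field_derivative_def)
qed

section \<open>Paths and vector-valued contour integrals\<close>

definition vec_contour_integral :: "(real \<Rightarrow> complex) \<Rightarrow> (complex \<Rightarrow> 'a) \<Rightarrow> 'a::complex_banach"
  where "vec_contour_integral g f =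
    integral {0..1} (\<lambda>t. vector_derivative g (at t within {0..1}) *\<^sub>C f (g t))"

text \<open>The derivative is required on the whole line: circles and keyholes are given by formulas
  valid for all parameters, so the derivative within \<open>{0..1}\<close> at the end points is an
  ordinary one.\<close>

definition C1_path :: "(real \<Rightarrow> complex) \<Rightarrow> bool" where
  "C1_path g \<longleftrightarrow> (\<exists>g'. continuous_on UNIV g' \<and> (\<forall>t. (g has_vector_derivative g' t) (at t)))"

lemma C1_path_continuous: "C1_path g \<Longrightarrow> continuous_on S g"
  unfolding C1_path_def
  by (meson continuous_at_imp_continuous_on has_vector_derivative_continuous)

lemma C1_path_vector_derivative:
  assumes "C1_path g"
  shows "continuous_on {0..1} (\<lambda>t. vector_derivative g (at t within {0..1}))"
    and "t \<in> {0..1} \<Longrightarrow>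
      (g has_vector_derivative vector_derivative g (at t within {0..1})) (at t)"
proof -
  obtain g' where g': "continuous_on UNIV g'" "\<And>t. (g has_vector_derivative g' t) (at t)"
    using assms by (auto simp: C1_path_def)
  have eq: "vector_derivative g (at t within {0..1}) = g' t" if "t \<in> {0..1}" for t
    by (rule vector_derivative_within_closed_interval[OF zero_less_one that])
      (rule has_vector_derivative_at_within[OF g'(2)])
  show "continuous_on {0..1} (\<lambda>t. vector_derivative g (at t within {0..1}))"
    using continuous_on_subset[OF g'(1)] by (subst continuous_on_cong[OF refl eq]) auto
  show "(g has_vector_derivative vector_derivative g (at t within {0..1})) (at t)"
    if "t \<in> {0..1}"
    using g'(2) eq[OF that] by simp
qed

lemma C1_path_valid_path:
  assumes "C1_path g"
  shows "valid_path g"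
proof -
  obtain g' where g': "continuous_on UNIV g'" "\<And>t. (g has_vector_derivative g' t) (at t)"
    using assms by (auto simp: C1_path_def)
  have "g C1_differentiable_on {0..1}"
    unfolding C1_differentiable_on_def using g' continuous_on_subset by blast
  then show ?thesis
    by (simp add: valid_path_def C1_differentiable_imp_piecewise)
qed

lemma has_vec_contour_integral:
  assumes "C1_path g" "continuous_on (g ` {0..1}) f"
  shows "((\<lambda>t. vector_derivative g (at t within {0..1}) *\<^sub>C f (g t)) has_integral
    vec_contour_integral g f) {0..1}"
  unfolding vec_contour_integral_def
  by (intro integrable_integral integrable_continuous_real scaleC.continuous_on
      C1_path_vector_derivative(1) assms(1) continuous_on_compose2[OF assms(2)]
      C1_path_continuous) auto

lemma complex_functional_contour_integral:
  assumes l: "complex_functional l" and "C1_path g" "continuous_on (g ` {0..1}) f"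
  shows "((\<lambda>w. l (f w)) has_contour_integral l (vec_contour_integral g f)) g"
proof -
  have "((l \<circ> (\<lambda>t. vector_derivative g (at t within {0..1}) *\<^sub>C f (g t))) has_integral
    l (vec_contour_integral g f)) {0..1}"
    using l by (intro has_integral_linear has_vec_contour_integral assms(2,3))
      (auto simp: complex_functional_def)
  then show ?thesis
    using l by (simp add: has_contour_integral_def complex_functional_def o_def mult.commute)
qed

lemma vec_contour_integral_homotopic_loops:
  assumes "open S" "vec_holomorphic_on f S" "C1_path g" "C1_path h" "homotopic_loops S g h"
  shows "vec_contour_integral g f = vec_contour_integral h f"
proof (rule eqI_complex_functional)
  fix l :: "'a \<Rightarrow> complex" assume l: "complex_functional l"
  have sub: "g ` {0..1} \<subseteq> S" "h ` {0..1} \<subseteq> S"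
    using homotopic_loops_imp_subset[OF assms(5)] by (auto simp: path_image_def)
  note cont = continuous_on_subset[OF vec_holomorphic_on_imp_continuous_on[OF assms(2)]]
  have "contour_integral g (\<lambda>w. l (f w)) = contour_integral h (\<lambda>w. l (f w))"
    by (intro Cauchy_theorem_homotopic_loops[OF assms(5,1)] complex_functional_holomorphic[OF l]
        assms C1_path_valid_path)
  then show "l (vec_contour_integral g f) = l (vec_contour_integral h f)"
    using complex_functional_contour_integral[OF l assms(3) cont[OF sub(1)]]
      complex_functional_contour_integral[OF l assms(4) cont[OF sub(2)]]
    by (simp add: contour_integral_unique)
qed

lemma C1_path_circlepath: "C1_path (circlepath z r)"
  unfolding C1_path_def circlepath_def part_circlepath_def
  by (rule exI[of _ "\<lambda>x. 2 * of_real pi * \<i> * r * exp (2 * of_real pi * \<i> * of_real x)"])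
    (auto simp: linepath_def scaleR_conv_of_real mult_ac
      intro!: continuous_intros derivative_eq_intros has_vector_derivative_real_field)

lemma vec_Cauchy_integral_circlepath:
  assumes "vec_holomorphic_on f (ball 0 R)" "0 < \<rho>" "\<rho> < R" "cmod z < \<rho>"
  shows "f z = (1 / (2 * complex_of_real pi * \<i>)) *\<^sub>C
    vec_contour_integral (circlepath 0 \<rho>) (\<lambda>w. (1 / (w - z)) *\<^sub>C f w)"
proof (rule eqI_complex_functional)
  fix l :: "'a \<Rightarrow> complex" assume l: "complex_functional l"
  then have lC: "l (a *\<^sub>C x) = a * l x" for a x
    by (simp add: complex_functional_def)
  have hol: "(\<lambda>w. l (f w)) holomorphic_on ball 0 R"
    by (rule complex_functional_holomorphic[OF l assms(1)])
  then have hol': "(\<lambda>w. l (f w)) holomorphic_on cball 0 \<rho>"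
    using assms by (elim holomorphic_on_subset) auto
  have "((\<lambda>w. l (f w) / (w - z)) has_contour_integral (2 * of_real pi * \<i> * l (f z)))
    (circlepath 0 \<rho>)"
    using assms by (intro Cauchy_integral_circlepath_simple hol') auto
  moreover have "((\<lambda>w. l ((1 / (w - z)) *\<^sub>C f w)) has_contour_integral
    l (vec_contour_integral (circlepath 0 \<rho>) (\<lambda>w. (1 / (w - z)) *\<^sub>C f w))) (circlepath 0 \<rho>)"
  proof (intro complex_functional_contour_integral[OF l] C1_path_circlepath
      scaleC.continuous_on continuous_intros)
    have "circlepath 0 \<rho> ` {0..1} \<subseteq> sphere 0 \<rho>"
      using assms by (simp flip: path_image_def)
    then show "continuous_on (circlepath 0 \<rho> ` {0..1}) f" "\<forall>w\<in>circlepath 0 \<rho> ` {0..1}. w - z \<noteq> 0"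
      using assms by (auto simp: intro!: continuous_on_subset[OF vec_holomorphic_on_imp_continuous_on[OF assms(1)]])
  qed
  ultimately have "l (vec_contour_integral (circlepath 0 \<rho>) (\<lambda>w. (1 / (w - z)) *\<^sub>C f w)) =
    2 * of_real pi * \<i> * l (f z)"
    by (intro has_contour_integral_unique) (auto simp: lC)
  then show "l (f z) = l ((1 / (2 * complex_of_real pi * \<i>)) *\<^sub>C
    vec_contour_integral (circlepath 0 \<rho>) (\<lambda>w. (1 / (w - z)) *\<^sub>C f w))"
    by (simp add: lC)
qed

text \<open>Testing with functionals would give only weak holomorphy, whereas
  \<open>vec_holomorphic_on\<close> asks for a derivative in norm. So the integral is differentiated
  under the integral sign.\<close>

lemma vec_contour_integral_holomorphic_parameter:
  assumes S: "open S" and g: "C1_path g" and f: "continuous_on (g ` {0..1}) f"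
    and h: "\<And>t. t \<in> {0..1} \<Longrightarrow> (\<lambda>z. h z (g t)) holomorphic_on S"
    and h': "continuous_on (S \<times> g ` {0..1}) (\<lambda>(z, w). h z w)"
      "continuous_on (S \<times> g ` {0..1}) (\<lambda>(z, w). deriv (\<lambda>z. h z w) z)"
  shows "vec_holomorphic_on (\<lambda>z. vec_contour_integral g (\<lambda>w. h z w *\<^sub>C f w)) S"
proof (rule vec_holomorphic_on_local)
  fix z0 assume "z0 \<in> S"
  with S obtain e where e: "e > 0" "ball z0 e \<subseteq> S"
    by (meson openE)
  define g' where "g' t = vector_derivative g (at t within {0..1})" for t
  have g': "continuous_on {0..1} g'"
    unfolding g'_def by (rule C1_path_vector_derivative[OF g])
  have cg: "continuous_on {0..1} g"
    by (rule C1_path_continuous[OF g])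
  define X where "X z t = g' t *\<^sub>C deriv (\<lambda>z. h z (g t)) z *\<^sub>C f (g t)" for z t
  have contX: "continuous_on (ball z0 e \<times> {0..1}) (\<lambda>(z, t). X z t)"
    unfolding X_def split_beta
  proof (intro scaleC.continuous_on)
    show "continuous_on (ball z0 e \<times> {0..1}) (\<lambda>p. g' (snd p))"
      by (intro continuous_on_compose2[OF g'] continuous_intros) auto
    show "continuous_on (ball z0 e \<times> {0..1}) (\<lambda>p. f (g (snd p)))"
      by (intro continuous_on_compose2[OF f] continuous_on_compose2[OF cg] continuous_intros) auto
    show "continuous_on (ball z0 e \<times> {0..1}) (\<lambda>p. deriv (\<lambda>z. h z (g (snd p))) (fst p))"
      using e by (intro continuous_on_compose2[OF h'(2), of _ "\<lambda>p. (fst p, g (snd p))", unfolded prod.case]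
          continuous_on_compose2[OF cg] continuous_intros) auto
  qed
  \<comment> \<open>\<open>leibniz_rule\<close> expects the derivative as a bounded linear map;
    \<open>bl x\<close> is multiplication of the vector \<open>x\<close> by a scalar. As
    \<open>bl\<close> is itself linear and bounded it commutes with the integral, so the derivative
    of the integral is again multiplication of a vector.\<close>
  define bl where "bl x = Blinfun (\<lambda>h. h *\<^sub>C x)" for x :: 'a
  have D: "blinfun_apply (bl x) h = h *\<^sub>C x" for h and x :: 'a
    by (simp add: bl_def bounded_linear_Blinfun_apply scaleC.bounded_linear_left)
  have blD: "bounded_linear bl"
  proof (rule bounded_linear_intro[where K = 1])
    show "bl (x + y) = bl x + bl y" for x y :: 'a
      by (rule blinfun_eqI) (unfold D blinfun.add_left, rule scaleC_add_right)
    show "bl (t *\<^sub>R x) = t *\<^sub>R bl x" for t and x :: 'a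
      by (rule blinfun_eqI) (unfold D blinfun.scaleR_left, rule scaleC.scaleR_right)
    show "norm (bl x) \<le> norm x * 1" for x :: 'a
      by (rule norm_blinfun_bound) (auto simp: D norm_scaleC)
  qed
  have "vec_holomorphic_on (\<lambda>z. vec_contour_integral g (\<lambda>w. h z w *\<^sub>C f w)) (ball z0 e)"
    unfolding vec_holomorphic_on_def
  proof
    fix z assume z: "z \<in> ball z0 e"
    have "((\<lambda>z. integral (cbox 0 1) (\<lambda>t. g' t *\<^sub>C h z (g t) *\<^sub>C f (g t))) has_derivative
        integral (cbox 0 1) (\<lambda>t. bl (X z t))) (at z within ball z0 e)"
    proof (rule leibniz_rule[where fx = "\<lambda>z t. bl (X z t)" and f = "\<lambda>z t. g' t *\<^sub>C h z (g t) *\<^sub>C f (g t)"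
          and a = 0 and b = 1 and U = "ball z0 e"])
      show "((\<lambda>z. g' t *\<^sub>C h z (g t) *\<^sub>C f (g t)) has_derivative blinfun_apply (bl (X z t)))
        (at z within ball z0 e)" if z: "z \<in> ball z0 e" and t: "t \<in> cbox 0 1" for z t
      proof -
        have "((\<lambda>z. h z (g t)) has_field_derivative deriv (\<lambda>z. h z (g t)) z) (at z within ball z0 e)"
          using z e t by (intro has_field_derivative_at_within[OF holomorphic_derivI[OF h S]]) auto
        then have "((\<lambda>z. g' t *\<^sub>C h z (g t) *\<^sub>C f (g t)) has_derivative
            (\<lambda>x. g' t *\<^sub>C (deriv (\<lambda>z. h z (g t)) z * x) *\<^sub>C f (g t))) (at z within ball z0 e)"
          unfolding has_field_derivative_def
          by (rule bounded_linear.has_derivative[OF scaleC.bounded_linear_right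
              bounded_linear.has_derivative[OF scaleC.bounded_linear_left]])
        moreover have "blinfun_apply (bl (X z t)) =
            (\<lambda>x. g' t *\<^sub>C (deriv (\<lambda>z. h z (g t)) z * x) *\<^sub>C f (g t))"
          by (auto simp: D X_def scaleC_scaleC mult_ac)
        ultimately show ?thesis
          by (simp only:)
      qed
      show "(\<lambda>t. g' t *\<^sub>C h z (g t) *\<^sub>C f (g t)) integrable_on cbox 0 1" if z: "z \<in> ball z0 e" for z
        unfolding cbox_interval
      proof (intro integrable_continuous_real scaleC.continuous_on g')
        show "continuous_on {0..1} (\<lambda>t. f (g t))"
          by (intro continuous_on_compose2[OF f cg]) auto
        show "continuous_on {0..1} (\<lambda>t. h z (g t))"
          using z e by (intro continuous_on_compose2[OF h'(1), of _ "\<lambda>t. (z, g t)", unfolded prod.case]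
              cg continuous_intros) auto
      qed
      show "continuous_on (ball z0 e \<times> cbox 0 1) (\<lambda>(z, t). bl (X z t))"
        unfolding cbox_interval split_beta
        using bounded_linear.continuous_on[OF blD contX] by (simp add: split_beta)
    qed (use z in auto)
    also have "integral (cbox 0 1) (\<lambda>t. bl (X z t)) = bl (integral (cbox 0 1) (X z))"
    proof -
      have "continuous_on {0..1} (X z)"
        using z by (intro continuous_on_compose2[OF contX, of _ "\<lambda>t. (z, t)", unfolded prod.case]
            continuous_intros) auto
      then show ?thesis
        using integral_linear[OF _ blD, of "X z" "cbox 0 1"]
        by (simp add: o_def integrable_continuous_real)
    qed
    finally show "\<exists>D. ((\<lambda>z. vec_contour_integral g (\<lambda>w. h z w *\<^sub>C f w)) has_derivative
        (\<lambda>h. h *\<^sub>C D)) (at z within ball z0 e)"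
      by (auto simp: vec_contour_integral_def g'_def D)
  qed
  then show "\<exists>T. open T \<and> z0 \<in> T \<and>
      vec_holomorphic_on (\<lambda>z. vec_contour_integral g (\<lambda>w. h z w *\<^sub>C f w)) T"
    using e by (intro exI[of _ "ball z0 e"]) auto
qed

lemma vec_contour_integral_cong:
  "(\<And>t. t \<in> {0..1} \<Longrightarrow> f (g t) = f' (g t)) \<Longrightarrow> vec_contour_integral g f = vec_contour_integral g f'"
  unfolding vec_contour_integral_def by (intro integral_cong) simp

lemma norm_vec_contour_integral_le:
  assumes "C1_path g" "continuous_on (g ` {0..1}) f" "0 \<le> L"
    and "\<And>t. t \<in> {0..1} \<Longrightarrow> cmod (vector_derivative g (at t within {0..1})) \<le> L"
    and "\<And>t. t \<in> {0..1} \<Longrightarrow> norm (f (g t)) \<le> B"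
  shows "norm (vec_contour_integral g f) \<le> L * B"
proof -
  have "norm (vec_contour_integral g f) \<le> L * B * (1 - 0)"
    unfolding vec_contour_integral_def
  proof (rule integral_bound)
    show "continuous_on {0..1} (\<lambda>t. vector_derivative g (at t within {0..1}) *\<^sub>C f (g t))"
      by (intro scaleC.continuous_on C1_path_vector_derivative(1) assms(1)
          continuous_on_compose2[OF assms(2)] C1_path_continuous) auto
    show "norm (vector_derivative g (at t within {0..1}) *\<^sub>C f (g t)) \<le> L * B" if "t \<in> {0..1}" for t
      unfolding norm_scaleC using assms that by (intro mult_mono) auto
  qed simp
  then show ?thesis
    by simp
qed

text \<open>On the circle \<open>cmod (z / w)\<close> is constantly \<open>cmod z / \<rho>\<close>,
  so the expansion of \<open>g (z / w)\<close> converges uniformly and may be integrated term by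
  term. It is used twice, with the geometric series for \<open>\<phi>\<close> itself and with the
  series of \<open>G n\<close> for the transform; both produce the same integrals over powers of
  \<open>w\<close>.\<close>

lemma vec_contour_integral_power_series:
  assumes f: "continuous_on (sphere 0 \<rho>) f" and \<rho>: "0 < \<rho>"
    and g: "\<And>u. cmod u < c \<Longrightarrow> (\<lambda>p. a p * u ^ p) sums g u" and z: "cmod z < c * \<rho>"
  shows "(\<lambda>p. z ^ p *\<^sub>C a p *\<^sub>C vec_contour_integral (circlepath 0 \<rho>) (\<lambda>w. (1 / w ^ Suc (n + p)) *\<^sub>C f w))
    sums vec_contour_integral (circlepath 0 \<rho>) (\<lambda>w. (g (z / w) / w ^ Suc n) *\<^sub>C f w)"
proof -
  let ?w = "circlepath 0 \<rho>"
  define v where "v t = vector_derivative ?w (at t within {0..1})" for t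
  have C1: "C1_path ?w"
    by (rule C1_path_circlepath)
  have v: "continuous_on {0..1} v"
    unfolding v_def by (rule C1_path_vector_derivative(1)[OF C1])
  have w: "cmod (?w t) = \<rho>" for t
    using \<rho> by (simp add: circlepath norm_mult)
  have w0: "?w t \<noteq> 0" for t
    using w[of t] \<rho> by auto
  have img: "?w ` {0..1} \<subseteq> sphere 0 \<rho>"
    using w by auto
  have fw: "continuous_on {0..1} (\<lambda>t. f (?w t))"
    using w by (intro continuous_on_compose2[OF f] C1_path_continuous[OF C1]) auto
  have "bounded ((\<lambda>t. v t *\<^sub>C f (?w t)) ` {0..1})"
    by (intro compact_imp_bounded compact_continuous_image scaleC.continuous_on v fw compact_Icc)
  then obtain L where L: "\<And>t. t \<in> {0..1} \<Longrightarrow> norm (v t *\<^sub>C f (?w t)) \<le> L"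
    unfolding bounded_iff by blast
  define h where "h p t = v t *\<^sub>C (a p * z ^ p / ?w t ^ Suc (n + p)) *\<^sub>C f (?w t)" for p t
  define B where "B p = cmod (a p * of_real (cmod z / \<rho>) ^ p) * (L / \<rho> ^ Suc n)" for p
  have "summable (\<lambda>p. cmod (a p * of_real (cmod z / \<rho>) ^ p))"
  proof -
    \<comment> \<open>Convergence at a real point strictly between \<open>cmod z / \<rho>\<close>
      and \<open>c\<close> gives absolute convergence at \<open>cmod z / \<rho>\<close>.\<close>
    obtain x where x: "cmod z / \<rho> < x" "x < c"
      using dense[of "cmod z / \<rho>" c] z \<rho> by (auto simp: pos_divide_less_eq)
    have "0 \<le> cmod z / \<rho>"
      using \<rho> by simp
    then have "0 < x"
      using x by linarith
    then have "summable (\<lambda>p. a p * of_real x ^ p)"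
      using g[of "of_real x"] x by (auto simp: sums_iff)
    then show ?thesis
      using x \<open>0 < x\<close> \<open>0 \<le> cmod z / \<rho>\<close>
      by (intro powser_insidea[of a "of_real x"]) (auto simp del: of_real_divide)
  qed
  then have B: "summable B"
    unfolding B_def by (intro summable_mult2)
  have hB: "norm (h p t) \<le> B p" if "t \<in> {0..1}" for p t
  proof -
    have "h p t = (a p * z ^ p / ?w t ^ Suc (n + p)) *\<^sub>C v t *\<^sub>C f (?w t)"
      by (simp add: h_def scaleC_scaleC mult.commute)
    then have "norm (h p t) = cmod (a p) * cmod z ^ p / \<rho> ^ Suc (n + p) * norm (v t *\<^sub>C f (?w t))"
      by (simp only: norm_scaleC norm_mult norm_divide norm_power w)
    also have "\<dots> \<le> cmod (a p) * cmod z ^ p / \<rho> ^ Suc (n + p) * L"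
      using L[OF that] \<rho> by (intro mult_left_mono) auto
    also have "\<dots> = B p"
      using \<rho> by (simp add: B_def norm_mult norm_power norm_divide power_add power_divide)
    finally show ?thesis .
  qed
  have sums_h: "(\<lambda>p. h p t) sums (v t *\<^sub>C (g (z / ?w t) / ?w t ^ Suc n) *\<^sub>C f (?w t))" for t
  proof -
    have "cmod (z / ?w t) < c"
      using z \<rho> by (simp add: norm_divide w pos_divide_less_eq)
    then have "(\<lambda>p. a p * (z / ?w t) ^ p / ?w t ^ Suc n) sums (g (z / ?w t) / ?w t ^ Suc n)"
      by (intro sums_divide g)
    then have "(\<lambda>p. a p * z ^ p / ?w t ^ Suc (n + p)) sums (g (z / ?w t) / ?w t ^ Suc n)"
      by (simp add: power_divide power_add mult_ac)
    then have "(\<lambda>p. (a p * z ^ p / ?w t ^ Suc (n + p)) *\<^sub>C f (?w t)) sums ((g (z / ?w t) / ?w t ^ Suc n) *\<^sub>C f (?w t))"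
      by (rule bounded_linear.sums[OF scaleC.bounded_linear_left])
    then show ?thesis
      unfolding h_def by (rule bounded_linear.sums[OF scaleC.bounded_linear_right])
  qed
  have ch: "continuous_on {0..1} (h p)" for p
    unfolding h_def using w0
    by (intro scaleC.continuous_on v fw continuous_intros C1_path_continuous[OF C1]) auto
  have int_h: "(h p has_integral z ^ p *\<^sub>C a p *\<^sub>C vec_contour_integral ?w (\<lambda>w. (1 / w ^ Suc (n + p)) *\<^sub>C f w)) {0..1}" for p
  proof -
    have "continuous_on (?w ` {0..1}) (\<lambda>w. (1 / w ^ Suc (n + p)) *\<^sub>C f w)"
      using w0 by (intro scaleC.continuous_on continuous_intros continuous_on_subset[OF f img]) auto
    from has_integral_linear[OF has_vec_contour_integral[OF C1 this] scaleC.bounded_linear_right[of "z ^ p * a p"]]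
    show ?thesis
      by (simp add: o_def h_def[abs_def] v_def scaleC_scaleC mult_ac)
  qed
  have "uniform_limit {0..1} (\<lambda>N t. \<Sum>p<N. h p t) (\<lambda>t. \<Sum>p. h p t) sequentially"
    using hB B by (intro Weierstrass_m_test[of _ _ B])
  then obtain I J where IJ: "\<And>N. ((\<lambda>t. \<Sum>p<N. h p t) has_integral I N) {0..1}"
      "((\<lambda>t. \<Sum>p. h p t) has_integral J) {0..1}" "I \<longlonglongrightarrow> J"
    by (rule uniform_limit_integral) (auto intro!: continuous_on_sum ch)
  have "I = (\<lambda>N. \<Sum>p<N. z ^ p *\<^sub>C a p *\<^sub>C vec_contour_integral ?w (\<lambda>w. (1 / w ^ Suc (n + p)) *\<^sub>C f w))"
    by (intro ext has_integral_unique[OF IJ(1)] has_integral_sum int_h finite_lessThan)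
  moreover have "J = vec_contour_integral ?w (\<lambda>w. (g (z / w) / w ^ Suc n) *\<^sub>C f w)"
    using integral_unique[OF IJ(2)] sums_h by (simp add: vec_contour_integral_def v_def sums_iff)
  ultimately show ?thesis
    using IJ(3) unfolding sums_def by (simp only:)
qed

text \<open>The variable enters through \<open>zf\<close> so that one statement serves both charts:
  \<open>zf\<close> is the identity on the disc and \<open>exp\<close> in the logarithmic coordinate
  of the sector.\<close>

lemma vec_contour_integral_quotient_holomorphic:
  assumes \<Omega>: "open \<Omega>" and g: "g holomorphic_on \<Omega>" and N: "open N" and zf: "zf holomorphic_on N"
    and \<gamma>: "C1_path \<gamma>" and f: "continuous_on (\<gamma> ` {0..1}) f"
    and \<gamma>0: "\<And>t. t \<in> {0..1} \<Longrightarrow> \<gamma> t \<noteq> 0"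
    and mem: "\<And>x t. x \<in> N \<Longrightarrow> t \<in> {0..1} \<Longrightarrow> zf x / \<gamma> t \<in> \<Omega>"
  shows "vec_holomorphic_on (\<lambda>x. vec_contour_integral \<gamma> (\<lambda>w. (g (zf x / w) / w ^ k) *\<^sub>C f w)) N"
proof (rule vec_contour_integral_holomorphic_parameter[OF N \<gamma> f])
  have q: "continuous_on (N \<times> \<gamma> ` {0..1}) (\<lambda>p. zf (fst p) / snd p)"
    using \<gamma>0 by (intro continuous_intros continuous_on_compose2[OF holomorphic_on_imp_continuous_on[OF zf]]) auto
  show "(\<lambda>x. g (zf x / \<gamma> t) / \<gamma> t ^ k) holomorphic_on N" if t: "t \<in> {0..1}" for t
  proof -
    have "g \<circ> (\<lambda>x. zf x / \<gamma> t) holomorphic_on N"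
      using mem t \<gamma>0 by (intro holomorphic_on_compose_gen[OF _ g] holomorphic_intros zf) auto
    then show ?thesis
      using t \<gamma>0 by (intro holomorphic_intros) (auto simp: o_def)
  qed
  show "continuous_on (N \<times> \<gamma> ` {0..1}) (\<lambda>(x, w). g (zf x / w) / w ^ k)"
    unfolding split_beta using mem \<gamma>0
    by (intro continuous_intros continuous_on_compose2[OF holomorphic_on_imp_continuous_on[OF g] q]) auto
  have d: "deriv (\<lambda>x. g (zf x / w) / w ^ k) x = deriv g (zf x / w) * (deriv zf x / w) / w ^ k"
    if "x \<in> N" "w \<in> \<gamma> ` {0..1}" for x w
  proof (rule DERIV_imp_deriv)
    have "((\<lambda>x. zf x / w) has_field_derivative deriv zf x / w) (at x)"
      using that by (intro DERIV_cdivide holomorphic_derivI[OF zf N])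
    moreover have "(g has_field_derivative deriv g (zf x / w)) (at (zf x / w))"
      using that mem by (intro holomorphic_derivI[OF g \<Omega>]) auto
    ultimately have "((\<lambda>x. g (zf x / w)) has_field_derivative deriv g (zf x / w) * (deriv zf x / w)) (at x)"
      by (rule DERIV_chain2[rotated])
    then show "((\<lambda>x. g (zf x / w) / w ^ k) has_field_derivative deriv g (zf x / w) * (deriv zf x / w) / w ^ k) (at x)"
      by (rule DERIV_cdivide)
  qed
  have "continuous_on (N \<times> \<gamma> ` {0..1})
      (\<lambda>p. deriv g (zf (fst p) / snd p) * (deriv zf (fst p) / snd p) / snd p ^ k)"
  proof -
    have "continuous_on (N \<times> \<gamma> ` {0..1}) (\<lambda>p. deriv g (zf (fst p) / snd p))"
      using mem
      by (intro continuous_on_compose2[OF holomorphic_on_imp_continuous_on[OF holomorphic_deriv[OF g \<Omega>]] q]) auto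
    moreover have "continuous_on (N \<times> \<gamma> ` {0..1}) (\<lambda>p. deriv zf (fst p))"
      by (intro continuous_on_compose2[OF holomorphic_on_imp_continuous_on[OF holomorphic_deriv[OF zf N]]]
          continuous_intros) auto
    ultimately show ?thesis
      using \<gamma>0 by (intro continuous_intros) auto
  qed
  then show "continuous_on (N \<times> \<gamma> ` {0..1}) (\<lambda>(x, w). deriv (\<lambda>x. g (zf x / w) / w ^ k) x)"
    using d by (subst continuous_on_cong[OF refl, of _ _ "\<lambda>p. deriv g (zf (fst p) / snd p) * (deriv zf (fst p) / snd p) / snd p ^ k"]) auto
qed

subsection \<open>Strongly regular sequences\<close>

text \<open>Boundedness is a hypothesis because the supremum in \<open>assoc_fun\<close> is
  meaningful only for a bounded family. The sequence \<open>N\<close> is arbitrary so that the lemma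
  also covers the moments.\<close>

lemma le_exp_assoc_fun:
  assumes "\<And>p. 0 < N p" "bdd_above (range (\<lambda>p. t ^ p / N p))" "0 < t"
  shows "t ^ p / N p \<le> exp (assoc_fun N t)"
proof -
  have "bdd_above (range (\<lambda>p. ln (t ^ p / N p)))"
  proof -
    obtain C where C: "\<And>p. t ^ p / N p \<le> C"
      using assms(2) by (auto simp: bdd_above_def)
    have "ln (t ^ p / N p) \<le> ln C" for p
      using C[of p] assms(1)[of p] assms(3) by (intro ln_mono) auto
    then show ?thesis
      by (auto simp: bdd_above_def)
  qed
  then have "ln (t ^ p / N p) \<le> assoc_fun N t"
    using assms(3) by (auto simp: assoc_fun_def intro: cSUP_upper)
  then have "exp (ln (t ^ p / N p)) \<le> exp (assoc_fun N t)"
    by simp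
  then show ?thesis
    using assms(1)[of p] assms(3) by simp
qed

lemma exp_assoc_fun_le:
  assumes "\<And>p. 0 < N p" "0 < t" "\<And>p. t ^ p / N p \<le> C"
  shows "exp (assoc_fun N t) \<le> C"
proof -
  have "0 < t ^ 0 / N 0"
    using assms(1)[of 0] by simp
  then have C: "C > 0"
    using assms(3)[of 0] by linarith
  have "ln (t ^ p / N p) \<le> ln C" for p
    using C assms(1)[of p] assms(2) assms(3)[of p] by (intro ln_mono) auto
  then have "assoc_fun N t \<le> ln C"
    using assms(2) by (auto simp: assoc_fun_def intro: cSUP_least)
  then show ?thesis
    using C by (simp add: ln_ge_iff)
qed

text \<open>The order as an extended real: orders can be compared before they are known to be
  finite, which matters because \<open>real_of_ereal\<close> sends infinite values to 0.\<close>

definition log_order :: "(real \<Rightarrow> real) \<Rightarrow> ereal" where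
  "log_order f = Limsup at_top (\<lambda>t. ereal (max 0 (ln (f t) / ln t)))"

lemma growth_order_eq_log_order: "growth_order M = real_of_ereal (log_order (assoc_fun M))"
  by (simp add: growth_order_def log_order_def)

text \<open>Neither the additive constant nor the dilation is seen asymptotically: for large
  \<open>t\<close> adding \<open>C\<close> at most doubles \<open>g (B * t)\<close>, and
  \<open>ln (B * t)\<close> differs from \<open>ln t\<close> by a constant.\<close>

lemma log_order_le:
  assumes f: "filterlim f at_top at_top" and g: "filterlim g at_top at_top"
    and B: "0 < B" and le: "\<And>t. 0 < t \<Longrightarrow> f t \<le> g (B * t) + C"
  shows "log_order f \<le> log_order g"
proof (rule dense_ge)
  fix x assume "log_order g < x"
  show "log_order f \<le> x"
  proof (cases x)
    case (real l)
    \<comment> \<open>The gap between \<open>l'\<close> and \<open>l\<close> absorbs the constant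
      \<open>ln 2 + l' * ln B\<close> once \<open>ln t\<close> is large.\<close>
    then obtain l' where l': "log_order g < ereal l'" "l' < l"
      using ereal_dense2[of "log_order g" "ereal l"] \<open>log_order g < x\<close> by auto
    have lim: "filterlim (\<lambda>t. B * t) at_top at_top"
      using B by (simp add: filterlim_tendsto_pos_mult_at_top[OF tendsto_const] filterlim_ident)
    have ev: "\<forall>\<^sub>F t in at_top. max 0 (ln (g t) / ln t) < l'"
      using Limsup_lessD[OF l'(1)[unfolded log_order_def]] by simp
    obtain t where "max 0 (ln (g t) / ln t) < l'"
      using eventually_happens'[OF _ ev] by auto
    then have "0 < l'"
      by linarith
    have 1: "\<forall>\<^sub>F t in at_top. max 0 (ln (g (B * t)) / ln (B * t)) < l'"
      using filterlim_iff[THEN iffD1, OF lim] ev by blast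
    have 2: "\<forall>\<^sub>F t in at_top. max 1 C \<le> g (B * t)"
      using filterlim_compose[OF g lim] unfolding filterlim_at_top by blast
    have 3: "\<forall>\<^sub>F t in at_top. 1 \<le> f t"
      using f by (simp add: filterlim_at_top)
    have 4: "\<forall>\<^sub>F t in at_top. max 1 ((ln 2 + l' * ln B) / (l - l')) \<le> ln (t :: real)"
      using ln_at_top unfolding filterlim_at_top by blast
    have 5: "\<forall>\<^sub>F t in at_top. 1 \<le> ln (B * t)"
      using filterlim_compose[OF ln_at_top lim] by (simp add: filterlim_at_top)
    have 6: "\<forall>\<^sub>F t :: real in at_top. 0 < t"
      by (rule eventually_gt_at_top)
    have "\<forall>\<^sub>F t in at_top. ereal (max 0 (ln (f t) / ln t)) \<le> ereal l"
      using 1 2 3 4 5 6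
    proof eventually_elim
      case (elim t)
      have "ln (g (B * t)) < l' * ln (B * t)"
        using elim(1,5) by (simp add: divide_less_eq)
      moreover have "f t \<le> 2 * g (B * t)"
        using le[OF elim(6)] elim(2) by linarith
      then have "ln (f t) \<le> ln (2 * g (B * t))"
        using elim(3) by (intro ln_mono) auto
      moreover have "ln (2 * g (B * t)) = ln 2 + ln (g (B * t))"
        using elim(2) by (simp add: ln_mult)
      moreover have "ln (B * t) = ln B + ln t"
        using B elim(6) by (simp add: ln_mult)
      ultimately have "ln (f t) \<le> (ln 2 + l' * ln B) + l' * ln t"
        by (simp add: algebra_simps)
      moreover have "ln 2 + l' * ln B \<le> (l - l') * ln t"
        using elim(4) l'(2) by (simp add: divide_le_eq mult.commute)
      ultimately have "ln (f t) \<le> l * ln t"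
        by (simp add: algebra_simps)
      then show ?case
        using elim(4) l'(2) \<open>0 < l'\<close> by (simp add: divide_le_eq)
    qed
    then show ?thesis
      unfolding log_order_def real by (rule Limsup_bounded)
  qed (use \<open>log_order g < x\<close> in auto)
qed

section \<open>Consequences of log-convexity, moderate growth and strong
  non-quasianalyticity\<close>

locale strongly_regular_sequence =
  fixes M :: "nat \<Rightarrow> real"
  assumes strongly_regular: "strongly_regular M"
begin

lemma pos: "0 < M p"
  using strongly_regular by (simp add: strongly_regular_def)

lemma zero [simp]: "M 0 = 1"
  using strongly_regular by (simp add: strongly_regular_def)

lemma nonzero [simp]: "M p \<noteq> 0"
  using pos[of p] by linarith

lemma moderate_growth:
  obtains A where "2 \<le> A" "\<And>p q. M (p + q) \<le> A ^ (p + q) * M p * M q"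
proof -
  obtain A where A: "A > 0" "\<And>p q. M (p + q) \<le> A ^ (p + q) * M p * M q"
    using strongly_regular unfolding strongly_regular_def by blast
  have "M (p + q) \<le> max 2 A ^ (p + q) * M p * M q" for p q
    using A(2)[of p q] A(1) pos[of p] pos[of q]
    by (elim order_trans) (intro mult_right_mono power_mono; simp)
  then show thesis
    by (intro that[of "max 2 A"]) auto
qed

text \<open>Log-convexity says that these quotients increase. Passing from \<open>p\<close> to
  \<open>Suc p\<close> multiplies \<open>t ^ p / M p\<close> by \<open>t / quot p\<close>, so the
  terms grow while \<open>quot p\<close> is below \<open>t\<close> and decrease afterwards.\<close>

definition quot :: "nat \<Rightarrow> real" where
  "quot p = M (Suc p) / M p"

lemma quot_pos: "0 < quot p"
  by (simp add: quot_def pos)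

lemma quot_mono: "p \<le> q \<Longrightarrow> quot p \<le> quot q"
proof (induction rule: dec_induct)
  case (step q)
  have "(M (Suc q))\<^sup>2 \<le> M q * M (Suc (Suc q))"
    using strongly_regular unfolding strongly_regular_def
    by (metis (no_types, lifting) Suc_eq_plus1 diff_Suc_1 le_add2)
  then have "quot q \<le> quot (Suc q)"
    using pos[of q] pos[of "Suc q"] by (simp add: quot_def field_simps power2_eq_square)
  with step show ?case by linarith
qed simp

lemma Suc_quot: "M (Suc p) = quot p * M p"
  by (simp add: quot_def)

lemma power_le: "M 1 ^ p \<le> M p"
proof (induction p)
  case (Suc p)
  have "M 1 \<le> quot p"
    using quot_mono[of 0 p] by (simp add: quot_def)
  then show ?case
    using Suc pos[of 1] by (simp add: Suc_quot[of p] mult_mono less_imp_le)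
qed simp

text \<open>Let s p be the tail from j = p of the sum of 1 / ((j + 1) quot j). The summability
  condition bounds s p by \<open>A * Suc p\<close> times its own leading term, so s p decays like
  the power -1/A of p + 1. The tail dominates its block from p to 2 p, hence a constant multiple of
  1 / quot (2 p).\<close>

lemma quot_growth: "\<exists>c>0. \<exists>g>0. \<forall>p. c * real (Suc p) powr g \<le> quot p"
proof -
  define a where "a j = 1 / (real (Suc j) * quot j)" for j
  have a_pos: "0 < a j" for j
    using quot_pos by (simp add: a_def)
  have a_eq: "M (p + j) / (real (p + j + 1) * M (p + j + 1)) = a (p + j)" for p j
    by (simp add: a_def quot_def)
  obtain A where A: "A > 0" "\<And>p. summable (\<lambda>j. a (p + j))" "\<And>p. (\<Sum>j. a (p + j)) \<le> A * (M p / M (p + 1))"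
    using strongly_regular unfolding strongly_regular_def a_eq by blast
  define s where "s p = (\<Sum>j. a (p + j))" for p
  define g where "g = 1 / A"
  have g: "g > 0"
    using A by (simp add: g_def)
  have s_Suc: "s p = a p + s (Suc p)" for p
    using suminf_split_head[OF A(2)[of p]] by (simp add: s_def)
  have s_le: "g / real (Suc p) * s p \<le> a p" for p
  proof -
    have "s p \<le> A / quot p"
      using A(3)[of p] by (simp add: s_def quot_def)
    then have "s p \<le> A * (real (Suc p) * a p)"
      using quot_pos[of p] by (simp add: a_def)
    then have "s p \<le> a p * (A * real (Suc p))"
      by (simp only: mult_ac)
    then have "s p / (A * real (Suc p)) \<le> a p"
      using A(1) by (subst pos_divide_le_eq) auto
    then show ?thesis
      by (simp add: g_def)
  qed
  have s_pos: "s p > 0" for p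
    unfolding s_def using A(2) a_pos by (intro suminf_pos) auto
  \<comment> \<open>With \<open>x = 1 / Suc p\<close> the factor \<open>1 - g * x\<close> is at most
    \<open>(1 + x) powr (-g)\<close>; as \<open>1 + x\<close> is a ratio of consecutive integers,
    the product telescopes.\<close>
  have decay: "s p \<le> s 0 * real (Suc p) powr (-g)" for p
  proof (induction p)
    case (Suc p)
    define x where "x = 1 / real (Suc p)"
    have x: "x > 0" "1 + x = real (Suc (Suc p)) / real (Suc p)"
      by (auto simp: x_def field_simps)
    have "s (Suc p) \<le> (1 - g * x) * s p"
      using s_Suc[of p] s_le[of p] by (simp add: x_def algebra_simps)
    also have "\<dots> \<le> (1 + x) powr (-g) * s p"
    proof (intro mult_right_mono)
      have "1 - g * x \<le> exp (- (g * x))"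
        using exp_ge_add_one_self[of "- (g * x)"] by simp
      also have "\<dots> \<le> exp (- g * ln (1 + x))"
        using g x(1) ln_add_one_self_le_self[of x] by simp
      also have "\<dots> = (1 + x) powr (-g)"
        using x(1) by (simp add: powr_def)
      finally show "1 - g * x \<le> (1 + x) powr (-g)" .
    qed (use s_pos[of p] in simp)
    also have "\<dots> \<le> (1 + x) powr (-g) * (s 0 * real (Suc p) powr (-g))"
      using Suc by (intro mult_left_mono) auto
    also have "\<dots> = s 0 * ((1 + x) * real (Suc p)) powr (-g)"
      using x(1) by (simp add: powr_mult)
    also have "(1 + x) * real (Suc p) = real (Suc (Suc p))"
      using x(2) by simp
    finally show ?case .
  qed simp
  \<comment> \<open>The block from \<open>p\<close> to \<open>2 * p\<close> has \<open>Suc p\<close>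
    terms, each at least \<open>1 / ((2 * p + 1) * quot (2 * p))\<close>; their number compensates
    for the factor \<open>2 * p + 1\<close>.\<close>
  have even: "real (Suc p) powr g / (2 * s 0) \<le> quot (2 * p)" for p
  proof -
    have "(\<Sum>j<Suc p. 1 / (real (2 * p + 1) * quot (2 * p))) \<le> (\<Sum>j<Suc p. a (p + j))"
      unfolding a_def using quot_mono quot_pos
      by (intro sum_mono divide_left_mono mult_mono mult_pos_pos) (auto simp: less_imp_le)
    also have "\<dots> \<le> s p"
      unfolding s_def using a_pos by (intro sum_le_suminf A(2)) (auto simp: less_imp_le)
    finally have "real (Suc p) / real (2 * p + 1) / quot (2 * p) \<le> s p"
      by simp
    moreover have "1 / 2 / quot (2 * p) \<le> real (Suc p) / real (2 * p + 1) / quot (2 * p)"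
      using quot_pos[of "2 * p"] by (intro divide_right_mono) (auto simp: field_simps)
    ultimately have "1 / 2 / quot (2 * p) \<le> s 0 * real (Suc p) powr (-g)"
      using decay[of p] by linarith
    then show ?thesis
      using quot_pos[of "2 * p"] s_pos[of 0] by (simp add: powr_minus field_simps)
  qed
  \<comment> \<open>Odd indices are rounded down to \<open>2 * (p div 2)\<close>; halving
    \<open>Suc p\<close> costs the factor \<open>(1 / 2) powr g\<close>.\<close>
  have "(1 / 2) powr g / (2 * s 0) * real (Suc p) powr g \<le> quot p" for p
  proof -
    have "(1 / 2) powr g / (2 * s 0) * real (Suc p) powr g = (real (Suc p) / 2) powr g / (2 * s 0)"
      by (simp add: powr_divide)
    also have "\<dots> \<le> real (Suc (p div 2)) powr g / (2 * s 0)"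
      using g s_pos[of 0] by (intro divide_right_mono powr_mono2) auto
    also have "\<dots> \<le> quot (2 * (p div 2))"
      by (rule even)
    also have "\<dots> \<le> quot p"
      by (rule quot_mono) simp
    finally show ?thesis .
  qed
  then show ?thesis
    using g s_pos[of 0] by (intro exI[of _ "(1 / 2) powr g / (2 * s 0)"] exI[of _ g] conjI allI) auto
qed

text \<open>Each of the first \<open>N\<close> steps multiplies the term by at most
  \<open>t / M 1\<close>, as \<open>M 1 = quot 0\<close> is the smallest quotient; later steps do
  not increase it.\<close>

lemma power_div_le:
  assumes "0 \<le> t" "\<And>j. N \<le> j \<Longrightarrow> t \<le> quot j"
  shows "t ^ p / M p \<le> max 1 (t / M 1) ^ N"
proof -
  let ?X = "max 1 (t / M 1)"
  have "t ^ p / M p \<le> ?X ^ min p N"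
  proof (induction p)
    case (Suc p)
    have eq: "t ^ Suc p / M (Suc p) = t / quot p * (t ^ p / M p)"
      by (simp add: Suc_quot)
    show ?case
    proof (cases "p < N")
      case True
      have "t / quot p \<le> t / M 1"
        using quot_mono[of 0 p] pos[of 1] quot_pos[of p] assms(1)
        by (intro divide_left_mono mult_pos_pos) (auto simp: quot_def)
      then have "t / quot p * (t ^ p / M p) \<le> ?X * ?X ^ min p N"
        using Suc assms(1) pos[of p] by (intro mult_mono) auto
      also have "?X * ?X ^ min p N = ?X ^ min (Suc p) N"
        using True by (simp add: min_def)
      finally show ?thesis
        by (simp only: eq)
    next
      case False
      then have "t / quot p * (t ^ p / M p) \<le> 1 * ?X ^ min p N"
        using Suc assms pos[of p] quot_pos[of p] by (intro mult_mono) auto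
      then show ?thesis
        using False unfolding eq by (auto simp: min_def split: if_splits)
    qed
  qed simp
  also have "\<dots> \<le> ?X ^ N"
    by (intro power_increasing) auto
  finally show ?thesis .
qed

text \<open>By \<open>quot_growth\<close> the quotients exceed \<open>t\<close> from an index of
  size \<open>t powr (1 / g)\<close> on. Bounding each earlier factor by the exponential of itself
  costs one more power of \<open>t\<close>. This yields both finiteness of
  \<open>assoc_fun M\<close> and finiteness of the order.\<close>

lemma power_div_le_polynomial:
  "\<exists>K>0. \<exists>a>0. \<forall>t\<ge>1. \<forall>p. t ^ p / M p \<le> exp (K * t powr a)"
proof -
  obtain c g where cg: "c > 0" "g > 0" "\<And>p. c * real (Suc p) powr g \<le> quot p"
    using quot_growth by blast
  define K where "K = ((1 / c) powr (1 / g) + 1) * (1 + 1 / M 1)"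
  have "t ^ p / M p \<le> exp (K * t powr (1 / g + 1))" if t: "t \<ge> 1" for t p
  proof -
    define N where "N = nat \<lceil>(t / c) powr (1 / g)\<rceil>"
    have "t \<le> quot j" if "N \<le> j" for j
    proof -
      have "(t / c) powr (1 / g) \<le> real N"
        unfolding N_def by linarith
      then have "(t / c) powr (1 / g) \<le> real (Suc j)"
        using that by simp
      then have "((t / c) powr (1 / g)) powr g \<le> real (Suc j) powr g"
        using cg by (intro powr_mono2) auto
      then have "t / c \<le> real (Suc j) powr g"
        using cg t by (simp add: powr_powr)
      then have "t \<le> c * real (Suc j) powr g"
        using cg by (simp add: field_simps)
      then show ?thesis
        using cg(3)[of j] by linarith
    qed
    then have "t ^ p / M p \<le> max 1 (t / M 1) ^ N"
      using t by (intro power_div_le) auto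
    also have "\<dots> \<le> exp (max 1 (t / M 1)) ^ N"
      by (intro power_mono) (use exp_ge_add_one_self[of "max 1 (t / M 1)"] in linarith)+
    also have "\<dots> = exp (real N * max 1 (t / M 1))"
      by (simp add: exp_of_nat_mult)
    also have "\<dots> \<le> exp (K * t powr (1 / g + 1))"
    proof -
      have t1: "1 \<le> t powr (1 / g)"
        using t cg by (intro ge_one_powr_ge_zero) auto
      have "real N \<le> (t / c) powr (1 / g) + 1"
          unfolding N_def using cg t by (simp add: of_nat_nat)
      also have "(t / c) powr (1 / g) = (1 / c) powr (1 / g) * t powr (1 / g)"
        using t cg by (simp add: powr_divide)
      also have "\<dots> + 1 \<le> ((1 / c) powr (1 / g) + 1) * t powr (1 / g)"
        using t1 by (simp add: algebra_simps)
      finally have N: "real N \<le> ((1 / c) powr (1 / g) + 1) * t powr (1 / g)" .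
      have "max 1 (t / M 1) \<le> (1 + 1 / M 1) * t"
        using t pos[of 1] by (auto simp: algebra_simps intro: order_trans[OF t])
      then have "real N * max 1 (t / M 1) \<le>
          (((1 / c) powr (1 / g) + 1) * t powr (1 / g)) * ((1 + 1 / M 1) * t)"
        using N t by (intro mult_mono) auto
      also have "\<dots> = K * t powr (1 / g + 1)"
        using t by (simp add: K_def powr_add)
      finally show ?thesis
        by simp
    qed
    finally show ?thesis .
  qed
  moreover have "K > 0"
    unfolding K_def using cg pos[of 1] by (intro mult_pos_pos add_nonneg_pos add_pos_pos) auto
  ultimately show ?thesis
    using cg by (intro exI[of _ K] conjI exI[of _ "1 / g + 1"]) (auto intro: add_pos_pos)
qed

lemma bdd_above_power_div: "0 \<le> t \<Longrightarrow> bdd_above (range (\<lambda>p. t ^ p / M p))"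
proof -
  assume t: "0 \<le> t"
  obtain K a where K: "\<And>t p. t \<ge> 1 \<Longrightarrow> t ^ p / M p \<le> exp (K * t powr a)"
    using power_div_le_polynomial by blast
  have "t ^ p / M p \<le> exp (K * (max 1 t) powr a)" for p
  proof -
    have "t ^ p / M p \<le> (max 1 t) ^ p / M p"
      using t pos[of p] by (intro divide_right_mono power_mono) auto
    also have "\<dots> \<le> exp (K * (max 1 t) powr a)"
      by (rule K) simp
    finally show ?thesis .
  qed
  then show ?thesis
    by (auto simp: bdd_above_def)
qed

lemma power_le_exp_assoc: "0 \<le> t \<Longrightarrow> t ^ p / M p \<le> exp (assoc_fun M t)"
proof (cases "t = 0")
  case True
  then show ?thesis
    by (cases p) (simp_all add: assoc_fun_def)
qed (auto intro: le_exp_assoc_fun pos bdd_above_power_div)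

text \<open>Trades the decay of \<open>e\<close> for that of an arbitrary power; the exponent
  \<open>p\<close> is chosen wherever an integral at infinity has to converge.\<close>

lemma exp_minus_assoc_le: "0 < t \<Longrightarrow> exp (- assoc_fun M t) \<le> M p / t ^ p"
  using power_le_exp_assoc[of t p] pos[of p] by (simp add: exp_minus field_simps)

lemma exp_assoc_ge_1: "0 \<le> t \<Longrightarrow> 1 \<le> exp (assoc_fun M t)"
  using power_le_exp_assoc[of t 0] by simp

lemma assoc_fun_nonneg: "0 \<le> t \<Longrightarrow> 0 \<le> assoc_fun M t"
  using exp_assoc_ge_1[of t] by simp

lemma exp_assoc_le: "0 < t \<Longrightarrow> (\<And>p. t ^ p / M p \<le> C) \<Longrightarrow> exp (assoc_fun M t) \<le> C"
  by (intro exp_assoc_fun_le pos)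

lemma assoc_fun_mono:
  assumes "0 \<le> s" "s \<le> t"
  shows "assoc_fun M s \<le> assoc_fun M t"
proof (cases "s = 0")
  case True
  then show ?thesis
    using assms assoc_fun_nonneg[of t] by (simp add: assoc_fun_def)
next
  case False
  have "s ^ p / M p \<le> exp (assoc_fun M t)" for p
  proof -
    have "s ^ p / M p \<le> t ^ p / M p"
      using assms pos[of p] by (intro divide_right_mono power_mono) auto
    also have "\<dots> \<le> exp (assoc_fun M t)"
      using assms by (intro power_le_exp_assoc) auto
    finally show ?thesis .
  qed
  then show ?thesis
    using exp_assoc_le[of s] False assms by auto
qed

text \<open>Moderate growth bounds \<open>(t ^ p / M p) * (t ^ q / M q)\<close> by
  \<open>(A * t) ^ (p + q) / M (p + q)\<close>; the suprema over \<open>p\<close> and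
  \<open>q\<close> are taken separately. Products of growth factors are thereby absorbed into a
  dilation of the argument.\<close>

lemma exp_assoc_square:
  obtains A where "2 \<le> A" "\<And>t. 0 \<le> t \<Longrightarrow> (exp (assoc_fun M t))\<^sup>2 \<le> exp (assoc_fun M (A * t))"
proof -
  obtain A where A: "2 \<le> A" "\<And>p q. M (p + q) \<le> A ^ (p + q) * M p * M q"
    using moderate_growth by metis
  have "(exp (assoc_fun M t))\<^sup>2 \<le> exp (assoc_fun M (A * t))" if "0 \<le> t" for t
  proof (cases "t = 0")
    case False
    with that have t: "0 < t" by simp
    let ?E = "exp (assoc_fun M (A * t))"
    have *: "(t ^ p / M p) * (t ^ q / M q) \<le> ?E" for p q
    proof -
      have "(t ^ p / M p) * (t ^ q / M q) = t ^ (p + q) / (M p * M q)"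
        by (simp add: power_add)
      also have "\<dots> \<le> t ^ (p + q) / (M (p + q) / A ^ (p + q))"
        using A(1) A(2)[of p q] pos t
        by (intro divide_left_mono mult_pos_pos divide_pos_pos) (auto simp: field_simps)
      also have "\<dots> = (A * t) ^ (p + q) / M (p + q)"
        by (simp add: power_mult_distrib)
      also have "\<dots> \<le> ?E"
        using A(1) t by (intro power_le_exp_assoc) auto
      finally show ?thesis .
    qed
    have "t ^ q / M q \<le> ?E / exp (assoc_fun M t)" for q
    proof -
      have tq: "0 < t ^ q / M q"
        using t pos[of q] by simp
      have "exp (assoc_fun M t) \<le> ?E / (t ^ q / M q)"
        using *[of _ q] by (intro exp_assoc_le[OF t], subst pos_le_divide_eq[OF tq])
      then have "exp (assoc_fun M t) * (t ^ q / M q) \<le> ?E"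
        unfolding pos_le_divide_eq[OF tq] .
      then show ?thesis
        unfolding pos_le_divide_eq[OF exp_gt_zero] by (simp only: mult.commute)
    qed
    from exp_assoc_le[OF t this] show ?thesis
      by (simp add: pos_le_divide_eq power2_eq_square)
  qed (simp add: assoc_fun_def)
  with A(1) show thesis
    by (rule that)
qed

text \<open>At \<open>t = quot p\<close> the terms \<open>t ^ q / M q\<close> do not decrease up to
  \<open>q = p\<close> and do not increase from there on, so the term of index \<open>p\<close> is
  the supremum. In Cauchy's inequality this is the radius that loses only a geometric
  factor.\<close>

lemma exp_assoc_quot_le: "exp (assoc_fun M (quot p)) \<le> quot p ^ p / M p"
proof (rule exp_assoc_le[OF quot_pos])
  fix q
  show "quot p ^ q / M q \<le> quot p ^ p / M p"
  proof (cases "p \<le> q")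
    case True
    then show ?thesis
    proof (induction q rule: dec_induct)
      case (step q)
      have "quot p ^ Suc q / M (Suc q) = quot p / quot q * (quot p ^ q / M q)"
        by (simp add: Suc_quot)
      also have "\<dots> \<le> 1 * (quot p ^ q / M q)"
        using quot_mono[of p q] quot_pos[of p] quot_pos[of q] pos[of q] step
        by (intro mult_right_mono) auto
      finally show ?case
        using step by simp
    qed simp
  next
    case False
    then have "q \<le> p" by simp
    then show ?thesis
    proof (induction q rule: inc_induct)
      case (step q)
      have "1 * (quot p ^ q / M q) \<le> quot p / quot q * (quot p ^ q / M q)"
        using quot_mono[of q p] quot_pos[of p] quot_pos[of q] pos[of q] step
        by (intro mult_right_mono) auto
      also have "\<dots> = quot p ^ Suc q / M (Suc q)"
        by (simp add: Suc_quot)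
      finally show ?case
        using step by simp
    qed simp
  qed
qed

lemma filterlim_assoc_fun:
  assumes "\<And>p. 0 < N p" "\<And>t. 0 < t \<Longrightarrow> bdd_above (range (\<lambda>p. t ^ p / N p))"
  shows "filterlim (assoc_fun N) at_top at_top"
proof (rule filterlim_at_top_mono)
  have "filterlim (\<lambda>t. t * inverse (N 1)) at_top at_top"
    using assms(1)[of 1] by (intro filterlim_at_top_mult_tendsto_pos[OF tendsto_const] filterlim_ident) simp
  from filterlim_compose[OF ln_at_top this]
  show "filterlim (\<lambda>t. ln (t * inverse (N 1))) at_top at_top" .
  show "\<forall>\<^sub>F t in at_top. ln (t * inverse (N 1)) \<le> assoc_fun N t"
    using eventually_gt_at_top[of 0]
  proof eventually_elim
    case (elim t)
    have "exp (ln (t * inverse (N 1))) = t ^ 1 / N 1"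
      using elim assms(1)[of 1] by (simp add: divide_inverse)
    also have "\<dots> \<le> exp (assoc_fun N t)"
      by (rule le_exp_assoc_fun[OF assms(1) assms(2)[OF elim] elim])
    finally show ?case
      by simp
  qed
qed

text \<open>
  Iterating the doubling inequality \<open>exp_assoc_square\<close> gives polynomial growth of \<open>assoc_fun M\<close> along a
  geometric sequence.
\<close>

lemma log_order_pos: "0 < log_order (assoc_fun M)"
proof -
  obtain A where A: "2 \<le> A" "\<And>t. 0 \<le> t \<Longrightarrow> (exp (assoc_fun M t))\<^sup>2 \<le> exp (assoc_fun M (A * t))"
    by (rule exp_assoc_square) blast
  have double: "2 * assoc_fun M t \<le> assoc_fun M (A * t)" if "0 \<le> t" for t
    using A(2)[OF that] by (simp flip: exp_double)
  \<comment> \<open>Chosen so that the function is at least 1 at \<open>s\<close>, where the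
    doubling starts; \<open>2 \<le> s\<close> makes \<open>ln s\<close> positive.\<close>
  define s where "s = max 2 (exp 1 * M 1)"
  have s: "2 \<le> s" "1 \<le> assoc_fun M s"
  proof -
    have "exp 1 \<le> s ^ 1 / M 1"
      using pos[of 1] by (simp add: s_def pos_le_divide_eq)
    also have "\<dots> \<le> exp (assoc_fun M s)"
      by (intro power_le_exp_assoc) (simp add: s_def)
    finally show "1 \<le> assoc_fun M s"
      by simp
  qed (simp add: s_def)
  have pow: "2 ^ k \<le> assoc_fun M (A ^ k * s)" for k
  proof (induction k)
    case (Suc k)
    have "2 * 2 ^ k \<le> 2 * assoc_fun M (A ^ k * s)"
      using Suc by simp
    also have "\<dots> \<le> assoc_fun M (A * (A ^ k * s))"
      using A s by (intro double) auto
    finally show ?case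
      by (simp add: mult.assoc)
  qed (use s in simp)
  \<comment> \<open>With this \<open>h\<close>, a bound by \<open>h * ln t\<close> at
    \<open>t = A ^ k * s\<close> would allow only \<open>k * ln 2 / 2\<close> where doubling yields
    \<open>k * ln 2\<close>.\<close>
  define h where "h = ln 2 / (2 * (ln A + ln s))"
  have lns: "0 < ln A" "0 < ln s"
    using A s by auto
  have h: "h > 0"
    using lns by (auto simp: h_def)
  have "ereal h \<le> log_order (assoc_fun M)"
  proof (rule ccontr)
    assume "\<not> ?thesis"
    then have "\<forall>\<^sub>F t in at_top. max 0 (ln (assoc_fun M t) / ln t) < h"
      using Limsup_lessD[of at_top "\<lambda>t. ereal (max 0 (ln (assoc_fun M t) / ln t))" "ereal h"]
      by (simp add: log_order_def)
    then obtain T where T: "\<And>t. T \<le> t \<Longrightarrow> max 0 (ln (assoc_fun M t) / ln t) < h"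
      by (auto simp: eventually_at_top_linorder)
    obtain k where k: "max 1 T < A ^ k"
      using real_arch_pow[of A "max 1 T"] A by auto
    have "k \<noteq> 0"
      using k by (intro notI) auto
    define t where "t = A ^ k * s"
    have t: "T \<le> t" "1 < t"
    proof -
      have "A ^ k * 1 \<le> t"
        unfolding t_def using A s by (intro mult_left_mono) auto
      then show "T \<le> t" "1 < t"
        using k by auto
    qed
    have "real k * ln 2 = ln (2 ^ k)"
      by (simp add: ln_realpow)
    also have "\<dots> \<le> ln (assoc_fun M t)"
      unfolding t_def using pow[of k] by (intro ln_mono) (auto intro: less_le_trans[of _ "2 ^ k"])
    also have "\<dots> < h * ln t"
      using T[OF t(1)] t(2) by (simp add: divide_less_eq)
    also have "ln t = real k * ln A + ln s"
      using A s by (simp add: t_def ln_mult ln_realpow)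
    also have "h * \<dots> \<le> h * (real k * (ln A + ln s))"
      using h lns \<open>k \<noteq> 0\<close> by (intro mult_left_mono) (auto simp: algebra_simps)
    also have "\<dots> = real k * ln 2 / 2"
      using lns by (simp add: h_def field_simps)
    finally have "real k * ln 2 < real k * ln 2 / 2" .
    moreover have "0 \<le> real k * ln (2 :: real)"
      by simp
    ultimately show False
      by linarith
  qed
  with h show ?thesis
    by (metis ereal_less(2) less_le_trans)
qed

lemma log_order_finite: "log_order (assoc_fun M) < \<infinity>"
proof -
  obtain K a where K: "K > 0" "a > 0" "\<And>t p. t \<ge> 1 \<Longrightarrow> t ^ p / M p \<le> exp (K * t powr a)"
    using power_div_le_polynomial by blast
  have le: "assoc_fun M t \<le> K * t powr a" if "t \<ge> 1" for t
    using exp_assoc_le[OF _ K(3)[OF that]] that by simp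
  have 1: "\<forall>\<^sub>F t in at_top. 1 \<le> assoc_fun M t"
    using filterlim_assoc_fun[OF pos bdd_above_power_div] by (simp add: filterlim_at_top)
  have 2: "\<forall>\<^sub>F t :: real in at_top. 1 \<le> t"
    by (rule eventually_ge_at_top)
  have 3: "\<forall>\<^sub>F t in at_top. max 1 (ln K) \<le> ln (t :: real)"
    using ln_at_top unfolding filterlim_at_top by blast
  have "\<forall>\<^sub>F t in at_top. ereal (max 0 (ln (assoc_fun M t) / ln t)) \<le> ereal (a + 1)"
    using 1 2 3
  proof eventually_elim
    case (elim t)
    have "ln (assoc_fun M t) \<le> ln (K * t powr a)"
      using elim le[OF elim(2)] by (intro ln_mono) auto
    also have "\<dots> = ln K + a * ln t"
      using K elim by (simp add: ln_mult ln_powr)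
    also have "\<dots> \<le> (a + 1) * ln t"
      using elim by (simp add: algebra_simps)
    finally show ?case
      using elim K by (simp add: divide_le_eq)
  qed
  then have "log_order (assoc_fun M) \<le> ereal (a + 1)"
    unfolding log_order_def by (rule Limsup_bounded)
  then show ?thesis
    by (rule le_less_trans) simp
qed

text \<open>Both bounds on the order enter: an order of 0 and, through \<open>real_of_ereal\<close>,
  an infinite one would make \<open>omega M\<close> equal to \<open>1 / 0\<close>, which is
  0.\<close>

lemma omega_pos: "0 < omega M"
  unfolding omega_def growth_order_eq_log_order
  using log_order_pos log_order_finite by (cases "log_order (assoc_fun M)") auto

text \<open>Geometric factors between the sequences become dilations of the argument of the
  associated functions, constant factors become additive constants, and \<open>log_order_le\<close>
  ignores both. Finiteness of the supremum for \<open>N\<close> is inherited from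
  \<open>M\<close>.\<close>

lemma omega_equivalent:
  assumes N: "\<And>p. 0 < N p" and b: "0 < b" "0 < c" "\<And>p. c * b ^ p * M p \<le> N p"
    and B: "0 < B" "0 < C" "\<And>p. N p \<le> C * B ^ p * M p"
  shows "omega N = omega M"
proof -
  have *: "t ^ p / N p \<le> 1 / c * exp (assoc_fun M (1 / b * t))" if "0 < t" for t p
  proof -
    have "t ^ p / N p \<le> t ^ p / (c * b ^ p * M p)"
      using that b pos[of p] N[of p] by (intro divide_left_mono mult_pos_pos) auto
    also have "\<dots> = 1 / c * ((1 / b * t) ^ p / M p)"
      by (simp add: power_divide)
    also have "\<dots> \<le> 1 / c * exp (assoc_fun M (1 / b * t))"
      using b that by (intro mult_left_mono power_le_exp_assoc) auto
    finally show ?thesis .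
  qed
  then have bddN: "bdd_above (range (\<lambda>p. t ^ p / N p))" if "0 < t" for t
    using that by (auto simp: bdd_above_def)
  have le1: "assoc_fun N t \<le> assoc_fun M (1 / b * t) + ln (1 / c)" if "0 < t" for t
  proof -
    have "exp (assoc_fun N t) \<le> 1 / c * exp (assoc_fun M (1 / b * t))"
      by (rule exp_assoc_fun_le[OF N that *[OF that]])
    also have "\<dots> = exp (assoc_fun M (1 / b * t) + ln (1 / c))"
      using b by (simp add: exp_add)
    finally show ?thesis
      by simp
  qed
  have le2: "assoc_fun M t \<le> assoc_fun N (B * t) + ln C" if "0 < t" for t
  proof -
    have "t ^ p / M p \<le> C * exp (assoc_fun N (B * t))" for p
    proof -
      have "t ^ p / M p \<le> t ^ p / (N p / (C * B ^ p))"
        using that B pos[of p] N[of p]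
        by (intro divide_left_mono mult_pos_pos divide_pos_pos) (auto simp: field_simps)
      also have "\<dots> = C * ((B * t) ^ p / N p)"
        by (simp add: power_mult_distrib)
      also have "\<dots> \<le> C * exp (assoc_fun N (B * t))"
        using B that by (intro mult_left_mono le_exp_assoc_fun N bddN) auto
      finally show ?thesis .
    qed
    from exp_assoc_le[OF that this] have "exp (assoc_fun M t) \<le> exp (assoc_fun N (B * t) + ln C)"
      using B by (simp add: exp_add mult.commute)
    then show ?thesis
      by simp
  qed
  note lim = filterlim_assoc_fun[OF N bddN] filterlim_assoc_fun[OF pos bdd_above_power_div]
  have "log_order (assoc_fun N) = log_order (assoc_fun M)"
    using b B by (intro antisym log_order_le[OF lim _ le1] log_order_le[OF lim(2,1) _ le2]) auto
  then show ?thesis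
    by (simp add: omega_def growth_order_eq_log_order)
qed

end

subsection \<open>Parameter integrals and plane sectors\<close>

text \<open>A local majorant \<open>g\<close> of the integrand is enough: Cauchy's inequality on
  discs of radius \<open>d / 2\<close> turns it into the majorant \<open>2 / d * g\<close> of the
  derivative, hence of the difference quotients, and dominated convergence applies.\<close>

lemma holomorphic_on_set_integral:
  fixes f :: "complex \<Rightarrow> 'a \<Rightarrow> complex"
  assumes U: "open U"
    and meas: "\<And>u. u \<in> U \<Longrightarrow> set_borel_measurable M A (f u)"
    and hol: "\<And>s. s \<in> A \<Longrightarrow> (\<lambda>u. f u s) holomorphic_on U"
    and dom: "\<And>u0. u0 \<in> U \<Longrightarrow> \<exists>d>0. \<exists>g. set_integrable M A g \<and>
      (\<forall>u\<in>ball u0 d \<inter> U. \<forall>s\<in>A. cmod (f u s) \<le> g s)"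
  shows "(\<lambda>u. LINT s:A|M. f u s) holomorphic_on U"
  unfolding holomorphic_on_def
proof
  fix u0 assume u0: "u0 \<in> U"
  obtain d0 g where d0: "d0 > 0" "set_integrable M A g"
    "\<And>u s. u \<in> ball u0 d0 \<inter> U \<Longrightarrow> s \<in> A \<Longrightarrow> cmod (f u s) \<le> g s"
    using dom[OF u0] by blast
  obtain d1 where d1: "d1 > 0" "ball u0 d1 \<subseteq> U"
    using U u0 by (meson openE)
  define d where "d = min d0 d1"
  have d: "d > 0" "ball u0 d \<subseteq> U"
    "\<And>u s. u \<in> ball u0 d \<Longrightarrow> s \<in> A \<Longrightarrow> cmod (f u s) \<le> g s"
    using d0 d1 by (auto simp: d_def)
  have int: "set_integrable M A (f u)" if "u \<in> ball u0 d" for u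
  proof (rule set_integrable_bound[OF d0(2) meas])
    show "AE s in M. s \<in> A \<longrightarrow> norm (f u s) \<le> norm (g s)"
      using d(3)[OF that] by (intro AE_I2) (auto intro: order_trans[OF _ abs_ge_self])
  qed (use that d in auto)
  define D where "D s = deriv (\<lambda>u. f u s) u0" for s
  have lip: "cmod (f u s - f u0 s) \<le> (2 / d * g s) * cmod (u - u0)"
    if s: "s \<in> A" and u: "u \<in> ball u0 (d / 2)" for u s
  proof (rule field_differentiable_bound[OF convex_ball])
    fix z assume z: "z \<in> ball u0 (d / 2)"
    have sub: "cball z (d / 2) \<subseteq> ball u0 d"
    proof
      fix x assume "x \<in> cball z (d / 2)"
      then show "x \<in> ball u0 d"
        using z dist_triangle[of u0 x z] by simp
    qed
    have hol': "(\<lambda>u. f u s) holomorphic_on cball z (d / 2)"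
      using sub d by (intro holomorphic_on_subset[OF hol[OF s]]) auto
    have "z \<in> U"
      using z d by auto
    show "((\<lambda>u. f u s) has_field_derivative deriv (\<lambda>u. f u s) z) (at z within ball u0 (d / 2))"
      using \<open>z \<in> U\<close> by (intro has_field_derivative_at_within[OF holomorphic_derivI[OF hol[OF s] U]])
    have "norm ((deriv ^^ 1) (\<lambda>u. f u s) z) \<le> fact 1 * g s / (d / 2) ^ 1"
    proof (rule Cauchy_inequality)
      show "(\<lambda>u. f u s) holomorphic_on ball z (d / 2)" "continuous_on (cball z (d / 2)) (\<lambda>u. f u s)"
        using hol' holomorphic_on_subset ball_subset_cball holomorphic_on_imp_continuous_on by blast+
      show "cmod (f x s) \<le> g s" if "cmod (z - x) = d / 2" for x
        using that sub s by (intro d(3)) (auto simp: dist_norm subset_eq)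
    qed (use d in simp)
    then show "cmod (deriv (\<lambda>u. f u s) z) \<le> 2 / d * g s"
      by (simp add: mult.commute)
  qed (use u d in auto)
  have "((\<lambda>u. LINT s:A|M. f u s) has_field_derivative (LINT s:A|M. D s)) (at u0 within ball u0 (d / 2))"
    unfolding has_field_derivative_iff tendsto_at_iff_sequentially
  proof (intro allI impI)
    fix X assume X: "\<forall>i. X i \<in> ball u0 (d / 2) - {u0}" "X \<longlonglongrightarrow> u0"
    define q where "q i s = indicator A s *\<^sub>R ((f (X i) s - f u0 s) / (X i - u0))" for i s
    have X1: "X i \<in> ball u0 d" "X i \<in> ball u0 (d / 2)" "X i \<noteq> u0" for i
      using X(1)[rule_format, of i] d(1) by auto
    have q: "integrable M (q i)" "integral\<^sup>L M (q i) =
        ((LINT s:A|M. f (X i) s) - (LINT s:A|M. f u0 s)) / (X i - u0)" for i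
    proof -
      have "set_integrable M A (\<lambda>s. f (X i) s - f u0 s)"
        using int[OF X1(1)[of i]] int[of u0] d by (intro set_integral_diff) auto
      then have "set_integrable M A (\<lambda>s. (f (X i) s - f u0 s) / (X i - u0))"
        by (rule set_integrable_divide)
      then show "integrable M (q i)"
        by (simp add: q_def[abs_def] set_integrable_def)
      have "integral\<^sup>L M (q i) = (LINT s:A|M. (f (X i) s - f u0 s) / (X i - u0))"
        by (simp only: q_def[abs_def] set_lebesgue_integral_def)
      also have "\<dots> = (LINT s:A|M. f (X i) s - f u0 s) / (X i - u0)"
        by (rule set_integral_divide_zero)
      also have "\<dots> = ((LINT s:A|M. f (X i) s) - (LINT s:A|M. f u0 s)) / (X i - u0)"
        using int[OF X1(1)[of i]] int[of u0] d by (subst set_integral_diff(2)) auto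
      finally show "integral\<^sup>L M (q i) =
        ((LINT s:A|M. f (X i) s) - (LINT s:A|M. f u0 s)) / (X i - u0)" .
    qed
    have lim: "(\<lambda>i. q i s) \<longlonglongrightarrow> indicator A s *\<^sub>R D s" for s
    proof (cases "s \<in> A")
      case True
      have "((\<lambda>u. f u s) has_field_derivative D s) (at u0)"
        unfolding D_def using u0 by (intro holomorphic_derivI[OF hol[OF True] U])
      then have "((\<lambda>u. (f u s - f u0 s) / (u - u0)) \<longlongrightarrow> D s) (at u0)"
        by (simp add: has_field_derivative_iff)
      then have "((\<lambda>u. (f u s - f u0 s) / (u - u0)) \<circ> X) \<longlonglongrightarrow> D s"
        unfolding tendsto_at_iff_sequentially using X by blast
      then show ?thesis
        using True by (simp add: q_def o_def)
    qed (simp add: q_def)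
    have "(\<lambda>i. integral\<^sup>L M (q i)) \<longlonglongrightarrow> integral\<^sup>L M (\<lambda>s. indicator A s *\<^sub>R D s)"
    proof (rule integral_dominated_convergence[where w = "\<lambda>s. indicator A s *\<^sub>R (2 / d * g s)"])
      show "(\<lambda>s. indicator A s *\<^sub>R D s) \<in> borel_measurable M"
        by (rule borel_measurable_LIMSEQ_metric[OF _ lim]) (use q in auto)
      show "integrable M (\<lambda>s. indicator A s *\<^sub>R (2 / d * g s))"
        using set_integrable_mult_right[of "2 / d" M A g] d0(2) by (simp add: set_integrable_def)
      show "AE s in M. norm (q i s) \<le> indicator A s *\<^sub>R (2 / d * g s)" for i
      proof (rule AE_I2)
        fix s
        show "norm (q i s) \<le> indicator A s *\<^sub>R (2 / d * g s)"
        proof (cases "s \<in> A")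
          case True
          then show ?thesis
            using lip[OF True X1(2)] X1(3)[of i]
            by (simp add: q_def norm_divide divide_le_eq)
        qed (simp add: q_def)
      qed
    qed (use lim q in auto)
    then show "((\<lambda>u. ((LINT s:A|M. f u s) - (LINT s:A|M. f u0 s)) / (u - u0)) \<circ> X) \<longlonglongrightarrow> (LINT s:A|M. D s)"
      by (simp add: q(2) o_def set_lebesgue_integral_def)
  qed
  then have "((\<lambda>u. LINT s:A|M. f u s) has_field_derivative (LINT s:A|M. D s)) (at u0)"
    using d(1) by (simp add: at_within_open[of u0 "ball u0 (d / 2)"])
  then show "(\<lambda>u. LINT s:A|M. f u s) field_differentiable at u0 within U"
    using field_differentiable_at_within field_differentiable_def by blast
qed

lemma set_borel_measurable_continuous_on_lborel:
  fixes f :: "real \<Rightarrow> 'a::real_normed_vector"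
  shows "A \<in> sets borel \<Longrightarrow> continuous_on A f \<Longrightarrow> set_borel_measurable lborel A f"
  unfolding set_borel_measurable_def
  using borel_measurable_continuous_on_indicator[of A f] by simp

lemma set_integrable_nn_integral_bound:
  fixes g :: "'a \<Rightarrow> real"
  assumes "set_borel_measurable M A g" "\<And>s. s \<in> A \<Longrightarrow> 0 \<le> g s"
    and "(\<integral>\<^sup>+s\<in>A. ennreal (g s) \<partial>M) \<le> ennreal C" "0 \<le> C"
  shows "set_integrable M A g" "(LINT s:A|M. g s) \<le> C"
proof -
  have eq: "(\<integral>\<^sup>+s. ennreal (indicator A s *\<^sub>R g s) \<partial>M) = (\<integral>\<^sup>+s\<in>A. ennreal (g s) \<partial>M)"
    by (intro nn_integral_cong) (auto split: split_indicator)
  have nonneg: "0 \<le> indicator A s *\<^sub>R g s" for s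
    using assms(2) by (auto split: split_indicator)
  have meas: "(\<lambda>s. indicator A s *\<^sub>R g s) \<in> borel_measurable M"
    using assms(1) by (simp add: set_borel_measurable_def)
  have int: "integrable M (\<lambda>s. indicator A s *\<^sub>R g s)"
  proof (rule integrableI_nonneg[OF meas])
    show "(\<integral>\<^sup>+s. ennreal (indicator A s *\<^sub>R g s) \<partial>M) < \<infinity>"
      unfolding eq using assms(3) by (rule le_less_trans) simp
  qed (use nonneg in simp)
  then show "set_integrable M A g"
    by (simp add: set_integrable_def)
  have "ennreal (LINT s:A|M. g s) = (\<integral>\<^sup>+s. ennreal (indicator A s *\<^sub>R g s) \<partial>M)"
    unfolding set_lebesgue_integral_def using nonneg
    by (intro nn_integral_eq_integral[symmetric] int) auto
  also have "\<dots> \<le> ennreal C"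
    unfolding eq by (rule assms(3))
  finally show "(LINT s:A|M. g s) \<le> C"
    using assms(4) by simp
qed

lemma set_integral_Ioi_scale:
  fixes f :: "real \<Rightarrow> complex"
  assumes "0 < c"
  shows "(LINT s:{0<..}|lborel. f (c * s)) = (LINT s:{0<..}|lborel. f s) / c"
    and "set_integrable lborel {0<..} (\<lambda>s. f (c * s)) \<longleftrightarrow> set_integrable lborel {0<..} f"
proof -
  have ind: "indicator {0<..} (c * s) = (indicator {0<..} s :: real)" for s
    using assms by (auto simp: indicator_def zero_less_mult_iff)
  show "(LINT s:{0<..}|lborel. f (c * s)) = (LINT s:{0<..}|lborel. f s) / c"
    using lborel_integral_real_affine[of c "\<lambda>s. indicator {0<..} s *\<^sub>R f s" 0] assms
    by (simp add: set_lebesgue_integral_def ind scaleR_conv_of_real)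
  show "set_integrable lborel {0<..} (\<lambda>s. f (c * s)) \<longleftrightarrow> set_integrable lborel {0<..} f"
    using lborel_integrable_real_affine_iff[of c "\<lambda>s. indicator {0<..} s *\<^sub>R f s" 0] assms
    by (simp add: set_integrable_def ind)
qed

lemma nn_integral_inverse_square:
  assumes "0 < (a :: real)"
  shows "(\<integral>\<^sup>+s\<in>{a..}. ennreal (1 / s\<^sup>2) \<partial>lborel) = ennreal (1 / a)"
proof -
  have "((\<lambda>x. x powr (-2)) has_integral -(a powr (-2 + 1)) / (-2 + 1)) {a..}"
    by (rule has_integral_powr_to_inf) (use assms in auto)
  then have "((\<lambda>x. x powr (-2)) has_integral 1 / a) {a..}"
    using assms by (simp add: powr_minus_divide)
  from nn_integral_has_integral_lebesgue'[OF _ this]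
  have "(\<integral>\<^sup>+s. ennreal (s powr (-2)) * indicator {a..} s \<partial>lborel) = ennreal (1 / a)"
    by simp
  moreover have "(\<integral>\<^sup>+s\<in>{a..}. ennreal (1 / s\<^sup>2) \<partial>lborel) =
      (\<integral>\<^sup>+s. ennreal (s powr (-2)) * indicator {a..} s \<partial>lborel)"
    using assms by (intro nn_integral_cong) (auto simp: powr_minus_divide split: split_indicator)
  ultimately show ?thesis
    by simp
qed

text \<open>The shape of majorant for the radial moment integrals: \<open>e\<close> is bounded at
  the origin and decays faster than any power at infinity.\<close>

lemma set_integrable_powr_cut:
  fixes q :: real
  assumes "0 < q"
  shows "set_integrable lborel {0<..} (\<lambda>s. if s < 1 then s powr (q - 1) else 1 / s\<^sup>2)"
proof (rule set_integrable_nn_integral_bound(1)[where C = "1 / q + 1"])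
  show "set_borel_measurable lborel {0<..} (\<lambda>s. if s < 1 then s powr (q - 1) else 1 / s\<^sup>2)"
    unfolding set_borel_measurable_def by measurable
  have "((\<lambda>x. x powr (q - 1)) has_integral (1 powr (q - 1 + 1) / (q - 1 + 1))) {0..1}"
    by (rule has_integral_powr_from_0) (use assms in auto)
  then have I: "(\<integral>\<^sup>+s. ennreal (s powr (q - 1)) * indicator {0..1} s \<partial>lborel) = ennreal (1 / q)"
    by (subst nn_integral_has_integral_lebesgue'[of _ _ "1 / q"]) auto
  have "(\<integral>\<^sup>+s\<in>{0<..}. ennreal (if s < 1 then s powr (q - 1) else 1 / s\<^sup>2) \<partial>lborel) \<le>
      (\<integral>\<^sup>+s. ennreal (s powr (q - 1)) * indicator {0..1} s + ennreal (1 / s\<^sup>2) * indicator {1..} s \<partial>lborel)"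
    by (intro nn_integral_mono) (auto split: split_indicator)
  also have "\<dots> = ennreal (1 / q) + ennreal (1 / 1)"
    by (subst nn_integral_add) (auto simp: I nn_integral_inverse_square)
  also have "\<dots> = ennreal (1 / q + 1)"
    using assms by (subst ennreal_plus) auto
  finally show "(\<integral>\<^sup>+s\<in>{0<..}. ennreal (if s < 1 then s powr (q - 1) else 1 / s\<^sup>2) \<partial>lborel)
      \<le> ennreal (1 / q + 1)" .
qed (use assms in auto)

section \<open>Sectors in the plane and the principal argument\<close>

lemma nonpos_Reals_iff_Arg: "z \<in> \<real>\<^sub>\<le>\<^sub>0 \<longleftrightarrow> z = 0 \<or> Arg z = pi"
  by (auto simp: Arg_eq_pi complex_nonpos_Reals_iff complex_eq_iff)

lemma open_Arg_sector:
  assumes "\<sigma> \<le> pi"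
  shows "open {z. z \<noteq> 0 \<and> \<bar>Arg z\<bar> < \<sigma>}"
proof -
  have "{z. z \<noteq> 0 \<and> \<bar>Arg z\<bar> < \<sigma>} = {z \<in> - \<real>\<^sub>\<le>\<^sub>0. \<bar>Arg z\<bar> \<in> {..<\<sigma>}}"
    using assms by (auto simp: nonpos_Reals_iff_Arg)
  moreover have "open {z \<in> - \<real>\<^sub>\<le>\<^sub>0. \<bar>Arg z\<bar> \<in> {..<\<sigma>}}"
    by (intro continuous_open_preimage[unfolded vimage_def Int_def mem_Collect_eq]) (auto intro!: continuous_intros)
  ultimately show ?thesis
    by simp
qed

lemma mem_plane_sector_rcis: "0 < s \<Longrightarrow> \<bar>\<tau> - d\<bar> < \<theta> / 2 \<Longrightarrow> of_real s * cis \<tau> \<in> plane_sector d \<theta>"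
  unfolding plane_sector_def log_sector_def
  by (rule image_eqI[of _ _ "Complex (ln s) \<tau>"]) (auto simp: exp_eq_polar exp_of_real)

lemma plane_sector_0_eq:
  assumes "\<theta> \<le> 2 * pi"
  shows "plane_sector 0 \<theta> = {z. z \<noteq> 0 \<and> \<bar>Arg z\<bar> < \<theta> / 2}"
proof (intro equalityI subsetI)
  fix z assume "z \<in> plane_sector 0 \<theta>"
  then obtain x where x: "\<bar>Im x\<bar> < \<theta> / 2" "z = exp x"
    by (auto simp: plane_sector_def log_sector_def)
  then have "Arg z = Im x"
    using assms by (simp add: Arg_exp)
  then show "z \<in> {z. z \<noteq> 0 \<and> \<bar>Arg z\<bar> < \<theta> / 2}"
    using x by simp
next
  fix z assume z: "z \<in> {z. z \<noteq> 0 \<and> \<bar>Arg z\<bar> < \<theta> / 2}"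
  then have "of_real (cmod z) * cis (Arg z) \<in> plane_sector 0 \<theta>"
    by (intro mem_plane_sector_rcis) auto
  then show "z \<in> plane_sector 0 \<theta>"
    using z by (simp add: rcis_cmod_Arg flip: rcis_def)
qed

lemma open_plane_sector_0: "\<theta> \<le> 2 * pi \<Longrightarrow> open (plane_sector 0 \<theta>)"
  using open_Arg_sector[of "\<theta> / 2"] by (simp add: plane_sector_0_eq)

lemma connected_plane_sector: "connected (plane_sector d \<theta>)"
proof -
  have "log_sector d \<theta> = Im -` {d - \<theta> / 2<..<d + \<theta> / 2}"
    unfolding log_sector_def vimage_def greaterThanLessThan_iff by (intro Collect_cong) linarith
  then have "convex (log_sector d \<theta>)"
    using convex_linear_vimage[of Im "{d - \<theta> / 2<..<d + \<theta> / 2}"] by (simp add: bounded_linear.linear[OF bounded_linear_Im])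
  then show ?thesis
    unfolding plane_sector_def by (intro connected_continuous_image convex_connected continuous_intros)
qed

subsection \<open>Moments of the kernels\<close>

locale moment_kernel = strongly_regular_sequence M for M +
  fixes e E :: "complex \<Rightarrow> complex" and m :: "nat \<Rightarrow> real"
  assumes omega_less_2: "omega M < 2"
    and kernel_functions: "kernel_functions M e E"
    and moment: "complex_of_real (m p) = moment_fun e (of_nat p)"
    and moment_pos: "0 < m p"
begin

abbreviation \<kappa> :: real where "\<kappa> \<equiv> omega M"

lemma kernel_e: "kernel_e M e" and kernel_E: "kernel_E M E"
  and E_sums: "(\<lambda>p. z ^ p / complex_of_real (m p)) sums E z"
  and moment_fun_continuous: "continuous_on {z. 0 \<le> Re z} (moment_fun e)"
  using kernel_functions by (simp_all add: kernel_functions_def moment)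

lemma E_holomorphic: "E holomorphic_on S"
  using kernel_E holomorphic_on_subset unfolding kernel_E_def by blast

lemma E_continuous: "continuous_on S E"
  by (rule holomorphic_on_imp_continuous_on[OF E_holomorphic])

lemma moment_nonzero [simp]: "m p \<noteq> 0"
  using moment_pos[of p] by simp

lemma kappa_pi_less: "\<kappa> * pi < 2 * pi"
  using omega_less_2 by simp

lemma e_holomorphic: "e holomorphic_on plane_sector 0 (\<kappa> * pi)"
  using kernel_e by (simp add: kernel_e_def)

lemma rcis_mem_sector: "0 < s \<Longrightarrow> \<bar>\<tau>\<bar> < \<kappa> * pi / 2 \<Longrightarrow> of_real s * cis \<tau> \<in> plane_sector 0 (\<kappa> * pi)"
  by (rule mem_plane_sector_rcis) auto

lemma e_ray_continuous:
  assumes "\<bar>\<tau>\<bar> < \<kappa> * pi / 2"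
  shows "continuous_on {0<..} (\<lambda>s. e (of_real s * cis \<tau>))"
  by (rule continuous_on_compose2[OF holomorphic_on_imp_continuous_on[OF e_holomorphic]])
    (use rcis_mem_sector assms in \<open>auto intro!: continuous_intros\<close>)

lemma e_decay:
  assumes "T < \<kappa> * pi / 2"
  obtains c k where "0 < c" "0 < k"
    "\<And>s \<tau>. 0 < s \<Longrightarrow> \<bar>\<tau>\<bar> \<le> T \<Longrightarrow> cmod (e (of_real s * cis \<tau>)) \<le> c * exp (- assoc_fun M (s / k))"
proof -
  \<comment> \<open>Half of the gap between \<open>\<kappa> * pi\<close> and \<open>2 * T\<close>:
    the closed range of directions up to \<open>T\<close> then lies in the open sector of opening
    \<open>\<kappa> * pi - \<epsilon>\<close>.\<close>
  define \<epsilon> where "\<epsilon> = (\<kappa> * pi - 2 * T) / 2"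
  have "\<epsilon> > 0"
    using assms by (simp add: \<epsilon>_def)
  then have "\<exists>c>0. \<exists>k>0. \<forall>z\<in>plane_sector 0 (\<kappa> * pi - \<epsilon>). cmod (e z) \<le> c * exp (- assoc_fun M (cmod z / k))"
    using kernel_e by (simp add: kernel_e_def)
  then obtain c k where ck: "0 < c" "0 < k"
    "\<And>z. z \<in> plane_sector 0 (\<kappa> * pi - \<epsilon>) \<Longrightarrow> cmod (e z) \<le> c * exp (- assoc_fun M (cmod z / k))"
    by blast
  have "cmod (e (of_real s * cis \<tau>)) \<le> c * exp (- assoc_fun M (s / k))" if "0 < s" "\<bar>\<tau>\<bar> \<le> T" for s \<tau>
    using ck(3)[OF mem_plane_sector_rcis[OF that(1), of \<tau>]] that assms
    by (simp add: norm_mult \<epsilon>_def field_simps)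
  with ck show thesis
    by (auto intro: that)
qed

text \<open>The hypothesis on \<open>e\<close> is local in \<open>z\<close>. For
  \<open>z = cis (- \<tau>)\<close> the value \<open>e (t / z)\<close> is that on the ray of
  direction \<open>\<tau>\<close>, and compactness of \<open>{-T..T}\<close> makes the bound uniform
  in the direction.\<close>

lemma e_integrable_near_0:
  obtains t0 where "0 < t0" "\<And>T. T < \<kappa> * pi / 2 \<Longrightarrow> \<exists>B\<ge>0. \<forall>\<tau>. \<bar>\<tau>\<bar> \<le> T \<longrightarrow>
    (\<integral>\<^sup>+s\<in>{0<..<t0}. ennreal (cmod (e (of_real s * cis \<tau>)) / s) \<partial>lborel) \<le> ennreal B"
proof -
  define J where "J t0 U = (\<integral>\<^sup>+t\<in>{0<..<t0}. (SUP z\<in>U. ennreal (cmod (e (complex_of_real t / z)))) / ennreal t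
             \<partial>lborel)" for t0 U
  obtain t0 where t0: "t0 > 0" "\<forall>z0\<in>plane_sector 0 (\<kappa> * pi).
        \<exists>U. open U \<and> z0 \<in> U \<and> U \<subseteq> plane_sector 0 (\<kappa> * pi) \<and> J t0 U < \<infinity>"
    using kernel_e by (auto simp: kernel_e_def J_def)
  have "\<exists>B\<ge>0. \<forall>\<tau>. \<bar>\<tau>\<bar> \<le> T \<longrightarrow>
    (\<integral>\<^sup>+s\<in>{0<..<t0}. ennreal (cmod (e (of_real s * cis \<tau>)) / s) \<partial>lborel) \<le> ennreal B"
    if T: "T < \<kappa> * pi / 2" for T
  proof -
    have "\<forall>\<tau>\<in>{-T..T}. \<exists>U. open U \<and> cis (-\<tau>) \<in> U \<and> J t0 U < \<infinity>"
    proof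
      fix \<tau> assume "\<tau> \<in> {-T..T}"
      then have "of_real 1 * cis (-\<tau>) \<in> plane_sector 0 (\<kappa> * pi)"
        using T by (intro rcis_mem_sector) auto
      with t0(2) show "\<exists>U. open U \<and> cis (-\<tau>) \<in> U \<and> J t0 U < \<infinity>"
        by force
    qed
    then obtain U where U: "\<And>\<tau>. \<tau> \<in> {-T..T} \<Longrightarrow> open (U \<tau>) \<and> cis (-\<tau>) \<in> U \<tau> \<and> J t0 (U \<tau>) < \<infinity>"
      by metis
    obtain C where C: "C \<subseteq> {-T..T}" "finite C" "{-T..T} \<subseteq> (\<Union>\<tau>\<in>C. (\<lambda>x. cis (-x)) -` U \<tau>)"
    proof (rule compactE_image[of "{-T..T}" "{-T..T}" "\<lambda>\<tau>. (\<lambda>x. cis (-x)) -` U \<tau>"])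
      show "open ((\<lambda>x. cis (-x)) -` U \<tau>)" if "\<tau> \<in> {-T..T}" for \<tau>
        using U[OF that] by (intro open_vimage continuous_intros) auto
    qed (use U in auto)
    define B where "B = (\<Sum>\<tau>\<in>C. enn2real (J t0 (U \<tau>)))"
    have "(\<integral>\<^sup>+s\<in>{0<..<t0}. ennreal (cmod (e (of_real s * cis \<tau>)) / s) \<partial>lborel) \<le> ennreal B"
      if "\<bar>\<tau>\<bar> \<le> T" for \<tau>
    proof -
      have "\<tau> \<in> {-T..T}"
        using that by auto
      then obtain \<tau>' where \<tau>': "\<tau>' \<in> C" "cis (-\<tau>) \<in> U \<tau>'"
        using C(3) by blast
      have "(\<integral>\<^sup>+s\<in>{0<..<t0}. ennreal (cmod (e (of_real s * cis \<tau>)) / s) \<partial>lborel) \<le> J t0 (U \<tau>')"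
        unfolding J_def
      proof (intro nn_integral_mono)
        fix s
        have "ennreal (cmod (e (of_real s * cis \<tau>))) \<le> (SUP z\<in>U \<tau>'. ennreal (cmod (e (complex_of_real s / z))))"
          using \<tau>'(2) by (intro SUP_upper2[of "cis (-\<tau>)"]) (simp_all add: cis_inverse divide_inverse)
        then have "ennreal (cmod (e (of_real s * cis \<tau>)) / s) \<le>
            (SUP z\<in>U \<tau>'. ennreal (cmod (e (complex_of_real s / z)))) / ennreal s" if "0 < s"
          using that by (subst divide_ennreal[symmetric]) (auto intro: divide_right_mono_ennreal)
        then show "ennreal (cmod (e (of_real s * cis \<tau>)) / s) * indicator {0<..<t0} s \<le>
            (SUP z\<in>U \<tau>'. ennreal (cmod (e (complex_of_real s / z)))) / ennreal s * indicator {0<..<t0} s"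
          by (auto split: split_indicator)
      qed
      also have "\<dots> = ennreal (enn2real (J t0 (U \<tau>')))"
        using U[of \<tau>'] \<tau>'(1) C(1) by (subst ennreal_enn2real) auto
      also have "\<dots> \<le> ennreal B"
        unfolding B_def using \<tau>'(1) C(2) by (intro ennreal_leI member_le_sum) auto
      finally show ?thesis .
    qed
    moreover have "B \<ge> 0"
      by (simp add: B_def sum_nonneg)
    ultimately show ?thesis
      by blast
  qed
  with t0(1) show thesis
    by (rule that)
qed

text \<open>The modulus of the integrand of the \<open>n\<close>-th moment along the ray of
  direction \<open>\<tau>\<close>; where \<open>E\<close> is bounded it majorizes the inner integral
  up to a constant.\<close>

definition wt :: "nat \<Rightarrow> real \<Rightarrow> real \<Rightarrow> real" where
  "wt n \<tau> s = s ^ n * (cmod (e (of_real s * cis \<tau>)) / s)"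

lemma wt_nonneg: "0 < s \<Longrightarrow> 0 \<le> wt n \<tau> s"
  by (simp add: wt_def)

text \<open>The integral is split at \<open>t0\<close>. Below, \<open>s ^ n\<close> is at most
  \<open>t0 ^ n\<close>, which is compared with \<open>M n\<close> through
  \<open>M 1 ^ n \<le> M n\<close>; above, the decay of \<open>e\<close> gives
  \<open>M (Suc n)\<close>, which moderate growth brings back to \<open>M n\<close>.\<close>

lemma wt_bound:
  assumes "T < \<kappa> * pi / 2"
  obtains C B where "0 < C" "0 < B" "\<And>n \<tau>. \<bar>\<tau>\<bar> \<le> T \<Longrightarrow>
    set_integrable lborel {0<..} (wt n \<tau>) \<and> (LINT s:{0<..}|lborel. wt n \<tau> s) \<le> C * B ^ n * M n"
proof -
  obtain t0 where t0: "0 < t0" and near_0: "\<And>T. T < \<kappa> * pi / 2 \<Longrightarrow> \<exists>B\<ge>0. \<forall>\<tau>. \<bar>\<tau>\<bar> \<le> T \<longrightarrow>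
    (\<integral>\<^sup>+s\<in>{0<..<t0}. ennreal (cmod (e (of_real s * cis \<tau>)) / s) \<partial>lborel) \<le> ennreal B"
    by (rule e_integrable_near_0) blast
  obtain B0 where B0: "0 \<le> B0" "\<And>\<tau>. \<bar>\<tau>\<bar> \<le> T \<Longrightarrow>
    (\<integral>\<^sup>+s\<in>{0<..<t0}. ennreal (cmod (e (of_real s * cis \<tau>)) / s) \<partial>lborel) \<le> ennreal B0"
    using near_0[OF assms] by blast
  obtain c k where ck: "0 < c" "0 < k"
    "\<And>s \<tau>. 0 < s \<Longrightarrow> \<bar>\<tau>\<bar> \<le> T \<Longrightarrow> cmod (e (of_real s * cis \<tau>)) \<le> c * exp (- assoc_fun M (s / k))"
    by (rule e_decay[OF assms]) blast
  obtain A where A: "2 \<le> A" "\<And>p q. M (p + q) \<le> A ^ (p + q) * M p * M q"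
    using moderate_growth by metis
  define B where "B = max (t0 / M 1) (k * A)"
  define C where "C = B0 + c * k * A * M 1 / t0"
  have C: "0 < C"
    unfolding C_def using B0(1) ck A pos[of 1] t0 by (intro add_nonneg_pos) auto
  have B_ge: "t0 / M 1 \<le> B" "k * A \<le> B"
    by (simp_all add: B_def)
  have B: "0 < B"
    unfolding B_def using ck A by (simp add: less_max_iff_disj)
  have "set_integrable lborel {0<..} (wt n \<tau>) \<and> (LINT s:{0<..}|lborel. wt n \<tau> s) \<le> C * B ^ n * M n"
    if \<tau>: "\<bar>\<tau>\<bar> \<le> T" for n \<tau>
  proof -
    have cont: "continuous_on {0<..} (\<lambda>s. cmod (e (of_real s * cis \<tau>)) / s)"
      using \<tau> assms by (intro continuous_intros e_ray_continuous) auto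
    then have meas: "set_borel_measurable lborel {0<..} (wt n \<tau>)"
      unfolding wt_def
      by (intro set_borel_measurable_continuous_on_lborel continuous_on_mult[OF _ cont])
        (auto intro!: continuous_intros)
    define K where "K = c * (M (Suc n) * k ^ Suc n)"
    have meas0: "(\<lambda>s. ennreal (cmod (e (of_real s * cis \<tau>)) / s) * indicator {0<..<t0} s) \<in> borel_measurable lborel"
    proof -
      have "(\<lambda>s. indicator {0<..<t0} s *\<^sub>R (cmod (e (of_real s * cis \<tau>)) / s)) \<in> borel_measurable borel"
        by (intro borel_measurable_continuous_on_indicator continuous_on_subset[OF cont]) auto
      then have "(\<lambda>s. ennreal (indicator {0<..<t0} s *\<^sub>R (cmod (e (of_real s * cis \<tau>)) / s))) \<in> borel_measurable lborel"
        by simp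
      also have "(\<lambda>s. ennreal (indicator {0<..<t0} s *\<^sub>R (cmod (e (of_real s * cis \<tau>)) / s))) =
        (\<lambda>s. ennreal (cmod (e (of_real s * cis \<tau>)) / s) * indicator {0<..<t0} s)"
        by (auto split: split_indicator)
      finally show ?thesis .
    qed
    have "(\<integral>\<^sup>+s\<in>{0<..}. ennreal (wt n \<tau> s) \<partial>lborel) \<le>
      (\<integral>\<^sup>+s. ennreal (t0 ^ n) * (ennreal (cmod (e (of_real s * cis \<tau>)) / s) * indicator {0<..<t0} s)
        + ennreal K * (ennreal (1 / s\<^sup>2) * indicator {t0..} s) \<partial>lborel)"
    proof (intro nn_integral_mono)
      fix s :: real
      consider "s \<le> 0" | "0 < s" "s < t0" | "t0 \<le> s"
        by linarith
      then show "ennreal (wt n \<tau> s) * indicator {0<..} s \<le>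
        ennreal (t0 ^ n) * (ennreal (cmod (e (of_real s * cis \<tau>)) / s) * indicator {0<..<t0} s)
        + ennreal K * (ennreal (1 / s\<^sup>2) * indicator {t0..} s)"
      proof cases
        case 2
        then have "wt n \<tau> s \<le> t0 ^ n * (cmod (e (of_real s * cis \<tau>)) / s)"
          unfolding wt_def by (intro mult_right_mono power_mono) auto
        then show ?thesis
          using 2 t0 by (simp add: ennreal_mult[symmetric] ennreal_leI)
      next
        case 3
        then have s: "0 < s"
          using t0 by linarith
        have "cmod (e (of_real s * cis \<tau>)) \<le> c * exp (- assoc_fun M (s / k))"
          using ck(3)[OF s \<tau>] .
        \<comment> \<open>The exponent \<open>Suc n\<close>, together with the factor
          \<open>1 / s\<close> of the weight, turns \<open>s ^ n\<close> into
          \<open>1 / s\<^sup>2\<close>, which is integrable on \<open>{t0..}\<close>.\<close>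
        also have "\<dots> \<le> c * (M (Suc n) / (s / k) ^ Suc n)"
          using ck s by (intro mult_left_mono exp_minus_assoc_le) auto
        also have "\<dots> = K / s ^ Suc n"
          by (simp add: K_def power_divide)
        finally have "wt n \<tau> s \<le> s ^ n * (K / s ^ Suc n / s)"
          unfolding wt_def using s by (intro mult_left_mono divide_right_mono) auto
        also have "\<dots> = K * (1 / s\<^sup>2)"
          using s by (simp add: field_simps power2_eq_square)
        finally have "wt n \<tau> s \<le> K * (1 / s\<^sup>2)" .
        moreover have "K \<ge> 0"
          using ck pos[of "Suc n"] by (simp add: K_def)
        ultimately show ?thesis
          using s 3 by (simp add: ennreal_mult[symmetric] ennreal_leI)
      qed simp
    qed
    also have "\<dots> = ennreal (t0 ^ n) * (\<integral>\<^sup>+s\<in>{0<..<t0}. ennreal (cmod (e (of_real s * cis \<tau>)) / s) \<partial>lborel)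
        + ennreal K * (\<integral>\<^sup>+s\<in>{t0..}. ennreal (1 / s\<^sup>2) \<partial>lborel)"
      using meas0 by (subst nn_integral_add) (auto simp: nn_integral_cmult)
    also have "\<dots> \<le> ennreal (t0 ^ n) * ennreal B0 + ennreal K * ennreal (1 / t0)"
      using B0(2)[OF \<tau>] t0 by (intro add_mono mult_left_mono) (auto simp: nn_integral_inverse_square)
    also have "\<dots> = ennreal (t0 ^ n * B0 + K * (1 / t0))"
      using t0 B0(1) ck pos[of "Suc n"] by (simp add: K_def flip: ennreal_plus ennreal_mult)
    also have "\<dots> \<le> ennreal (C * B ^ n * M n)"
    proof (rule ennreal_leI)
      have "t0 ^ n = (t0 / M 1) ^ n * M 1 ^ n"
        using pos[of 1] by (simp add: power_divide)
      also have "\<dots> \<le> B ^ n * M n"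
        using t0 pos[of 1] B B_ge power_le[of n]
        by (intro mult_mono power_mono) (auto simp: less_imp_le)
      finally have 1: "t0 ^ n * B0 \<le> B ^ n * M n * B0"
        using B0(1) by (intro mult_right_mono)
      have "K \<le> c * (A ^ Suc n * M 1 * M n * k ^ Suc n)"
        unfolding K_def using ck A(2)[of 1 n] by (intro mult_left_mono mult_right_mono) auto
      also have "\<dots> = c * k * A * M 1 * ((k * A) ^ n * M n)"
        by (simp add: power_mult_distrib)
      also have "\<dots> \<le> c * k * A * M 1 * (B ^ n * M n)"
        using ck A pos[of 1] pos[of n] B_ge
        by (intro mult_left_mono mult_right_mono power_mono) (auto simp: less_imp_le)
      finally have "K * (1 / t0) \<le> c * k * A * M 1 * (B ^ n * M n) * (1 / t0)"
        using t0 by (intro mult_right_mono) auto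
      then show "t0 ^ n * B0 + K * (1 / t0) \<le> C * B ^ n * M n"
        using 1 by (simp add: C_def algebra_simps)
    qed
    finally have bnd: "(\<integral>\<^sup>+s\<in>{0<..}. ennreal (wt n \<tau> s) \<partial>lborel) \<le> ennreal (C * B ^ n * M n)" .
    have "0 \<le> C * B ^ n * M n"
      using C B pos[of n] by simp
    then show ?thesis
      using set_integrable_nn_integral_bound[OF meas _ bnd] wt_nonneg by auto
  qed
  with C B show thesis
    by (rule that)
qed

lemma wt_integrable: "\<bar>\<tau>\<bar> < \<kappa> * pi / 2 \<Longrightarrow> set_integrable lborel {0<..} (wt n \<tau>)"
  using wt_bound[of "\<bar>\<tau>\<bar>"] by (metis order_refl)

text \<open>
  As a function of \<open>v\<close>, the integral of \<open>s powr (q - 1) * e (s v)\<close> is holomorphic and, for \<open>v > 0\<close>,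
  equal to \<open>v powr (- q)\<close> times its value at \<open>1\<close>; the identity theorem then rotates the ray. This needs
  \<open>q > 0\<close>, as \<open>e\<close> is only known to be bounded near \<open>0\<close>; the moment \<open>q = 0\<close> is a limit.
\<close>

lemma e_radial_integral:
  assumes q: "0 < q" and \<tau>: "\<bar>\<tau>\<bar> < \<kappa> * pi / 2"
  shows "(LINT s:{0<..}|lborel. of_real (s powr (q - 1)) * e (of_real s * cis \<tau>)) =
    cis (- q * \<tau>) * moment_fun e (of_real q)"
proof -
  let ?S = "plane_sector 0 (\<kappa> * pi)"
  have S: "?S = {z. z \<noteq> 0 \<and> \<bar>Arg z\<bar> < \<kappa> * pi / 2}"
    using kappa_pi_less by (simp add: plane_sector_0_eq)
  have openS: "open ?S"
    using kappa_pi_less by (simp add: open_plane_sector_0)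
  have smult: "of_real s * v \<in> ?S" if "0 < s" "v \<in> ?S" for s v
    using that by (auto simp: S)
  define f where "f v s = of_real (s powr (q - 1)) * e (of_real s * v)" for v and s :: real
  define P where "P v = (LINT s:{0<..}|lborel. f v s)" for v
  have fmeas: "set_borel_measurable lborel {0<..} (f v)" if "v \<in> ?S" for v
    unfolding f_def using that smult
    by (intro set_borel_measurable_continuous_on_lborel continuous_intros
        continuous_on_compose2[OF holomorphic_on_imp_continuous_on[OF e_holomorphic]]) auto
  have P_hol: "P holomorphic_on ?S"
    unfolding P_def
  proof (rule holomorphic_on_set_integral[OF openS fmeas])
    fix s :: real assume s: "s \<in> {0<..}"
    show "(\<lambda>u. f u s) holomorphic_on ?S"
      unfolding f_def using s smult
      by (intro holomorphic_intros holomorphic_on_compose_gen[OF _ e_holomorphic, unfolded o_def]) auto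
  next
    fix v0 assume v0: "v0 \<in> ?S"
    \<comment> \<open>Midway between the argument of \<open>v0\<close> and the edge of the sector:
      directions near \<open>v0\<close> stay in a range where the decay of \<open>e\<close> is
      uniform.\<close>
    define T where "T = (\<bar>Arg v0\<bar> + \<kappa> * pi / 2) / 2"
    have "\<bar>Arg v0\<bar> < \<kappa> * pi / 2"
      using v0 by (simp add: S)
    then have "\<bar>Arg v0\<bar> < T \<and> T < \<kappa> * pi / 2"
      unfolding T_def by argo
    then have T: "\<bar>Arg v0\<bar> < T" "T < \<kappa> * pi / 2"
      by simp_all
    obtain c k where ck: "0 < c" "0 < k"
      "\<And>s \<tau>. 0 < s \<Longrightarrow> \<bar>\<tau>\<bar> \<le> T \<Longrightarrow> cmod (e (of_real s * cis \<tau>)) \<le> c * exp (- assoc_fun M (s / k))"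
      by (rule e_decay[OF T(2)]) blast
    have "T \<le> pi"
      using T kappa_pi_less by linarith
    then have "open ({z. z \<noteq> 0 \<and> \<bar>Arg z\<bar> < T} \<inter> - cball 0 (cmod v0 / 2))"
      by (intro open_Int open_Arg_sector) auto
    moreover have "v0 \<in> {z. z \<noteq> 0 \<and> \<bar>Arg z\<bar> < T} \<inter> - cball 0 (cmod v0 / 2)"
      using v0 T by (auto simp: S)
    ultimately obtain d where d: "d > 0" "ball v0 d \<subseteq> {z. z \<noteq> 0 \<and> \<bar>Arg z\<bar> < T} \<inter> - cball 0 (cmod v0 / 2)"
      by (meson openE)
    obtain N where N: "q + 1 \<le> real N"
      using real_arch_simple by blast
    define \<delta> where "\<delta> = cmod v0 / 2"
    have \<delta>: "\<delta> > 0"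
      using v0 by (auto simp: \<delta>_def S)
    \<comment> \<open>One constant for both regimes: \<open>e\<close> is bounded by \<open>c\<close>
      for \<open>s < 1\<close>, and for \<open>s \<ge> 1\<close> it decays like the power
      \<open>N \<ge> q + 1\<close>, which leaves \<open>s powr (-2)\<close> after multiplication by
      \<open>s powr (q - 1)\<close>. On the ball, \<open>\<delta>\<close> is a lower bound for
      \<open>cmod v\<close>.\<close>
    define K where "K = c + c * (M N * (k / \<delta>) ^ N)"
    have K1: "c \<le> K" and K2: "c * (M N * (k / \<delta>) ^ N) \<le> K"
      using ck \<delta> pos[of N] by (auto simp: K_def)
    have "cmod (f v s) \<le> K * (if s < 1 then s powr (q - 1) else 1 / s\<^sup>2)"
      if v: "v \<in> ball v0 d" and s: "0 < s" for v s
    proof -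
      have v': "v \<noteq> 0" "\<bar>Arg v\<bar> \<le> T" "\<delta> < cmod v"
        using subsetD[OF d(2) v] by (auto simp: \<delta>_def)
      have sv: "of_real s * v = of_real (s * cmod v) * cis (Arg v)"
        using rcis_cmod_Arg[of v] by (simp add: rcis_def)
      have e1: "cmod (e (of_real s * v)) \<le> c * exp (- assoc_fun M (s * cmod v / k))"
        unfolding sv using v' s by (intro ck) auto
      show ?thesis
      proof (cases "s < 1")
        case True
        have "exp (- assoc_fun M (s * cmod v / k)) \<le> 1"
          using assoc_fun_nonneg s ck by simp
        then have "c * exp (- assoc_fun M (s * cmod v / k)) \<le> c * 1"
          using ck by (intro mult_left_mono) auto
        then have "cmod (e (of_real s * v)) \<le> K"
          using e1 K1 by simp
        then have "s powr (q - 1) * cmod (e (of_real s * v)) \<le> s powr (q - 1) * K"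
          by (intro mult_left_mono) auto
        then show ?thesis
          using True by (simp add: f_def norm_mult mult.commute)
      next
        case False
        then have "1 \<le> s" by simp
        have "c * exp (- assoc_fun M (s * cmod v / k)) \<le> c * (M N / (s * cmod v / k) ^ N)"
          using ck s v' by (intro mult_left_mono exp_minus_assoc_le) auto
        also have "\<dots> \<le> c * (M N / (s * \<delta> / k) ^ N)"
          using ck s v' \<delta> pos[of N]
          by (intro mult_left_mono divide_left_mono power_mono divide_right_mono mult_pos_pos zero_less_power) auto
        also have "\<dots> = c * (M N * (k / \<delta>) ^ N) / s ^ N"
          by (simp add: power_divide power_mult_distrib)
        also have "\<dots> \<le> K / s ^ N"
          using K2 s by (intro divide_right_mono) auto
        finally have "cmod (e (of_real s * v)) \<le> K / s ^ N"
          using e1 by simp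
        then have "cmod (f v s) \<le> s powr (q - 1) * (K / s ^ N)"
          unfolding f_def norm_mult by (auto simp del: times_divide_eq_right intro!: mult_left_mono)
        also have "\<dots> = K * s powr (q - 1 - N)"
          using s by (simp add: powr_diff powr_realpow)
        also have "\<dots> \<le> K * s powr (-2)"
          using N \<open>1 \<le> s\<close> K1 ck by (intro mult_left_mono powr_mono) auto
        finally show ?thesis
          using False s by (simp add: powr_minus_divide)
      qed
    qed
    moreover have "set_integrable lborel {0<..} (\<lambda>s. K * (if s < 1 then s powr (q - 1) else 1 / s\<^sup>2))"
      by (intro set_integrable_mult_right set_integrable_powr_cut q)
    ultimately show "\<exists>d>0. \<exists>g. set_integrable lborel {0<..} g \<and>
        (\<forall>u\<in>ball v0 d \<inter> ?S. \<forall>s\<in>{0<..}. cmod (f u s) \<le> g s)"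
      using d(1) by (intro exI[of _ d] conjI exI[of _ "\<lambda>s. K * (if s < 1 then s powr (q - 1) else 1 / s\<^sup>2)"]) auto
  qed
  have P1: "P 1 = moment_fun e (of_real q)"
    unfolding P_def f_def moment_fun_def
    by (intro set_lebesgue_integral_cong) (auto simp flip: powr_of_real of_real_diff[of q 1, simplified])
  have P_real: "P (of_real x) = of_real (x powr (-q)) * P 1" if x: "0 < x" for x
  proof -
    have "P (of_real x) = (LINT s:{0<..}|lborel. of_real (x powr (1 - q)) * f 1 (x * s))"
      unfolding P_def
    proof (intro set_lebesgue_integral_cong allI impI)
      fix s :: real assume "s \<in> {0<..}"
      then have "(x * s) powr (q - 1) = x powr (q - 1) * s powr (q - 1)"
        using x by (simp add: powr_mult)
      moreover have "x powr (1 - q) * x powr (q - 1) = 1"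
        using x by (simp flip: powr_add)
      ultimately have "x powr (1 - q) * (x * s) powr (q - 1) = s powr (q - 1)"
        by simp
      then show "f (of_real x) s = of_real (x powr (1 - q)) * f 1 (x * s)"
        unfolding f_def by (simp add: mult_ac flip: of_real_mult mult.assoc)
    qed simp
    also have "\<dots> = of_real (x powr (1 - q)) * (P 1 / of_real x)"
      using set_integral_Ioi_scale(1)[OF x, of "f 1"] by (simp add: P_def)
    also have "\<dots> = of_real (x powr (1 - q) / x) * P 1"
      by simp
    also have "x powr (1 - q) / x = x powr (-q)"
      using x by (simp add: powr_diff powr_minus divide_simps)
    finally show ?thesis .
  qed
  have "P (cis \<tau>) - cis \<tau> powr (- of_real q) * P 1 = 0"
  proof (rule analytic_continuation[of "\<lambda>v. P v - v powr (- of_real q) * P 1" ?S "of_real ` {1..2}" 1 "cis \<tau>"])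
    show "(\<lambda>v. P v - v powr (- of_real q) * P 1) holomorphic_on ?S"
    proof (intro holomorphic_intros P_hol)
      show "v \<notin> \<real>\<^sub>\<le>\<^sub>0" if "v \<in> ?S" for v
        using that kappa_pi_less by (auto simp: S nonpos_Reals_iff_Arg)
    qed
    show "open ?S" "connected ?S"
      by (fact openS, rule connected_plane_sector)
    show "of_real ` {1..2} \<subseteq> ?S"
      using smult[of _ 1] rcis_mem_sector[of 1 0] omega_pos by auto
    show "1 \<in> ?S" "cis \<tau> \<in> ?S"
      using rcis_mem_sector[of 1 0] rcis_mem_sector[of 1 \<tau>] \<tau> omega_pos by auto
    show "1 islimpt complex_of_real ` {1..2}"
    proof (rule connected_imp_perfect)
      show "connected (complex_of_real ` {1..2})"
        by (intro connected_continuous_image continuous_intros connected_Icc)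
      show "complex_of_real ` {1..2} \<noteq> {x}" for x
      proof
        assume "complex_of_real ` {1..2} = {x}"
        then have "complex_of_real 1 = x" "complex_of_real 2 = x"
          by (metis (no_types, lifting) atLeastAtMost_iff image_eqI one_le_numeral order_refl singletonD)+
        then show False by simp
      qed
    qed auto
    show "P z - z powr (- of_real q) * P 1 = 0" if z: "z \<in> complex_of_real ` {1..2}" for z
    proof -
      obtain x where x: "z = of_real x" "0 < x"
        using z by auto
      have "of_real x powr (- of_real q) = complex_of_real (x powr (- q))"
        using x(2) powr_of_real[of x "-q"] by simp
      then show ?thesis
        using P_real[OF x(2)] x(1) by simp
    qed
  qed
  moreover have "cis \<tau> powr (- of_real q) = cis (- q * \<tau>)"
  proof -
    have "\<bar>\<tau>\<bar> < pi"
      using \<tau> kappa_pi_less by linarith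
    then have "Ln (cis \<tau>) = \<i> * \<tau>"
      by (simp add: cis_conv_exp)
    then show ?thesis
      by (simp add: powr_def cis_conv_exp mult_ac)
  qed
  ultimately show ?thesis
    by (simp add: P1) (simp add: P_def f_def)
qed

text \<open>The factor \<open>cis (n * \<tau>)\<close> of the integrand cancels the rotation factor
  of \<open>e_radial_integral\<close>, so the value does not depend on the ray; hence the inner
  integrals along different rays share one power series at 0.\<close>

lemma e_ray_integral:
  assumes \<tau>: "\<bar>\<tau>\<bar> < \<kappa> * pi / 2"
  shows "(LINT s:{0<..}|lborel. (of_real s * cis \<tau>) ^ n * (e (of_real s * cis \<tau>) / (of_real s * cis \<tau>)) * cis \<tau>)
    = of_real (m n)"
proof -
  have eq: "(of_real s * cis \<tau>) ^ n * (e (of_real s * cis \<tau>) / (of_real s * cis \<tau>)) * cis \<tau> =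
      cis (n * \<tau>) * (of_real (s powr (real n - 1)) * e (of_real s * cis \<tau>))" if "0 < s" for s
  proof -
    have "s powr (real n - 1) = s ^ n / s"
      using that by (simp add: powr_diff powr_realpow)
    then show ?thesis
      by (simp add: power_mult_distrib Complex.DeMoivre)
  qed
  have I: "(LINT s:{0<..}|lborel. of_real (s powr (real n - 1)) * e (of_real s * cis \<tau>)) =
      cis (- real n * \<tau>) * of_real (m n)"
  proof (cases "n = 0")
    case False
    then show ?thesis
      using e_radial_integral[of n \<tau>] \<tau> by (simp add: moment)
  next
    case True
    define q where "q k = 1 / real (Suc k)" for k
    have q: "0 < q k" "q k \<le> 1" for k
      by (auto simp: q_def)
    have q0: "q \<longlonglongrightarrow> 0"
      unfolding q_def using LIMSEQ_inverse_real_of_nat by (simp add: inverse_eq_divide)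
    have "(\<lambda>k. LINT s:{0<..}|lborel. of_real (s powr (q k - 1)) * e (of_real s * cis \<tau>)) \<longlonglongrightarrow>
      (LINT s:{0<..}|lborel. of_real (s powr (0 - 1)) * e (of_real s * cis \<tau>))"
      unfolding set_lebesgue_integral_def
    \<comment> \<open>For exponents between 0 and 1, \<open>s powr q k\<close> is at most
      \<open>1 + s\<close>; the weights for \<open>n = 0\<close> and \<open>n = 1\<close> together
      dominate all the approximants.\<close>
    proof (rule integral_dominated_convergence[where w = "\<lambda>s. indicator {0<..} s *\<^sub>R (wt 0 \<tau> s + wt 1 \<tau> s)"])
      have meas: "set_borel_measurable lborel {0<..} (\<lambda>s. of_real (s powr (x - 1)) * e (of_real s * cis \<tau>))" for x
        by (intro set_borel_measurable_continuous_on_lborel continuous_intros e_ray_continuous \<tau>) auto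
      show "(\<lambda>s. indicator {0<..} s *\<^sub>R (of_real (s powr (0 - 1)) * e (of_real s * cis \<tau>))) \<in> borel_measurable lborel"
        "(\<lambda>s. indicator {0<..} s *\<^sub>R (of_real (s powr (q k - 1)) * e (of_real s * cis \<tau>))) \<in> borel_measurable lborel" for k
        using meas[of 0] meas[of "q k"] by (simp_all add: set_borel_measurable_def)
      show "integrable lborel (\<lambda>s. indicator {0<..} s *\<^sub>R (wt 0 \<tau> s + wt 1 \<tau> s))"
        using set_integral_add(1)[OF wt_integrable[OF \<tau>, of 0] wt_integrable[OF \<tau>, of 1]]
        by (simp add: set_integrable_def)
      show "AE s in lborel. (\<lambda>k. indicator {0<..} s *\<^sub>R (of_real (s powr (q k - 1)) * e (of_real s * cis \<tau>)))
        \<longlonglongrightarrow> indicator {0<..} s *\<^sub>R (of_real (s powr (0 - 1)) * e (of_real s * cis \<tau>))"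
      proof (intro AE_I2)
        fix s :: real
        show "(\<lambda>k. indicator {0<..} s *\<^sub>R (of_real (s powr (q k - 1)) * e (of_real s * cis \<tau>)))
          \<longlonglongrightarrow> indicator {0<..} s *\<^sub>R (of_real (s powr (0 - 1)) * e (of_real s * cis \<tau>))"
        proof (cases "0 < s")
          case True
          then show ?thesis
            by (intro tendsto_intros q0) auto
        qed simp
      qed
      show "AE s in lborel. norm (indicator {0<..} s *\<^sub>R (of_real (s powr (q k - 1)) * e (of_real s * cis \<tau>)))
        \<le> indicator {0<..} s *\<^sub>R (wt 0 \<tau> s + wt 1 \<tau> s)" for k
      proof (intro AE_I2)
        fix s :: real
        show "norm (indicator {0<..} s *\<^sub>R (of_real (s powr (q k - 1)) * e (of_real s * cis \<tau>)))
          \<le> indicator {0<..} s *\<^sub>R (wt 0 \<tau> s + wt 1 \<tau> s)"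
        proof (cases "0 < s")
          case True
          have "s powr q k \<le> 1 + s"
          proof (cases "s \<le> 1")
            case True
            then have "s powr q k \<le> 1 powr q k"
              using q \<open>0 < s\<close> by (intro powr_mono2) (auto simp: less_imp_le)
            then show ?thesis using \<open>0 < s\<close> by simp
          next
            case False
            then have "s powr q k \<le> s powr 1"
              using q by (intro powr_mono) auto
            then show ?thesis using False by simp
          qed
          then have "s powr q k * (cmod (e (of_real s * cis \<tau>)) / s) \<le> (1 + s) * (cmod (e (of_real s * cis \<tau>)) / s)"
            using True by (intro mult_right_mono) auto
          moreover have "norm (of_real (s powr (q k - 1)) * e (of_real s * cis \<tau>)) =
              s powr q k * (cmod (e (of_real s * cis \<tau>)) / s)"
            using True by (simp add: norm_mult norm_divide powr_diff)
          moreover have "wt 0 \<tau> s + wt 1 \<tau> s = (1 + s) * (cmod (e (of_real s * cis \<tau>)) / s)"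
            using True by (simp add: wt_def field_simps)
          ultimately show ?thesis
            using True by simp
        qed simp
      qed
    qed
    then have "(\<lambda>k. cis (- q k * \<tau>) * moment_fun e (of_real (q k))) \<longlonglongrightarrow>
      (LINT s:{0<..}|lborel. of_real (s powr (0 - 1)) * e (of_real s * cis \<tau>))"
      by (simp only: e_radial_integral[OF q(1) \<tau>])
    moreover have "(\<lambda>k. moment_fun e (of_real (q k))) \<longlonglongrightarrow> moment_fun e (of_real 0)"
      by (rule continuous_on_tendsto_compose[OF moment_fun_continuous])
        (use q tendsto_of_real[OF q0, where 'a = complex] in \<open>auto intro!: always_eventually simp: less_imp_le\<close>)
    then have "(\<lambda>k. cis (- q k * \<tau>) * moment_fun e (of_real (q k))) \<longlonglongrightarrow> cis (- 0 * \<tau>) * moment_fun e (of_real 0)"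
      by (intro tendsto_mult isCont_tendsto_compose[of _ "\<lambda>x. cis (- x * \<tau>)", OF _ q0])
        (auto intro!: continuous_on_interior[of UNIV] continuous_intros)
    ultimately have "(LINT s:{0<..}|lborel. of_real (s powr (0 - 1)) * e (of_real s * cis \<tau>)) =
        cis (- 0 * \<tau>) * moment_fun e (of_real 0)"
      by (rule LIMSEQ_unique)
    then show ?thesis
      using True moment[of 0] by simp
  qed
  have "(LINT s:{0<..}|lborel. (of_real s * cis \<tau>) ^ n * (e (of_real s * cis \<tau>) / (of_real s * cis \<tau>)) * cis \<tau>) =
    (LINT s:{0<..}|lborel. cis (n * \<tau>) * (of_real (s powr (real n - 1)) * e (of_real s * cis \<tau>)))"
    using eq by (intro set_lebesgue_integral_cong) auto
  also have "\<dots> = cis (n * \<tau>) * (cis (- real n * \<tau>) * of_real (m n))"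
    unfolding set_integral_mult_right I ..
  also have "\<dots> = of_real (m n)"
    by (simp add: cis_mult flip: mult.assoc)
  finally show ?thesis .
qed

section \<open>Equivalence of the moments with the sequence \<open>M\<close>\<close>

lemma moment_le: obtains C B where "0 < C" "0 < B" "\<And>n. m n \<le> C * B ^ n * M n"
proof -
  have 0: "\<bar>0\<bar> < \<kappa> * pi / 2"
    using omega_pos by simp
  obtain C B where CB: "0 < C" "0 < B" "\<And>n \<tau>. \<bar>\<tau>\<bar> \<le> 0 \<Longrightarrow>
    set_integrable lborel {0<..} (wt n \<tau>) \<and> (LINT s:{0<..}|lborel. wt n \<tau> s) \<le> C * B ^ n * M n"
    using wt_bound[of 0] 0 by auto
  have "m n \<le> C * B ^ n * M n" for n
  proof -
    let ?f = "\<lambda>s. (of_real s * cis 0) ^ n * (e (of_real s * cis 0) / (of_real s * cis 0)) * cis 0"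
    have "m n = cmod (LINT s:{0<..}|lborel. ?f s)"
      using e_ray_integral[OF 0, of n] moment_pos[of n] by simp
    also have "\<dots> \<le> (LINT s:{0<..}|lborel. cmod (?f s))"
      unfolding set_lebesgue_integral_def by (rule order_trans[OF integral_norm_bound]) simp
    also have "\<dots> = (LINT s:{0<..}|lborel. wt n 0 s)"
      by (intro set_lebesgue_integral_cong) (auto simp: wt_def norm_mult norm_divide norm_power)
    also have "\<dots> \<le> C * B ^ n * M n"
      using CB(3)[of 0 n] by simp
    finally show ?thesis .
  qed
  with CB(1,2) show thesis
    by (rule that)
qed

text \<open>The numbers \<open>1 / m n\<close> are the Taylor coefficients of \<open>E\<close>, so
  the growth of \<open>E\<close> bounds them by Cauchy's inequality. At the radius
  \<open>k * quot n\<close> the associated function is given by its term of index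
  \<open>n\<close>.\<close>

lemma moment_ge: obtains c b where "0 < c" "0 < b" "\<And>n. c * b ^ n * M n \<le> m n"
proof -
  obtain c k where ck: "0 < c" "0 < k" "\<And>z. cmod (E z) \<le> c * exp (assoc_fun M (cmod z / k))"
    using kernel_E unfolding kernel_E_def by blast
  have "1 / c * k ^ n * M n \<le> m n" for n
  proof -
    define r where "r = k * quot n"
    have r: "r > 0"
      using ck quot_pos[of n] by (simp add: r_def)
    have "E has_fps_expansion Abs_fps (\<lambda>p. 1 / of_real (m p))"
    proof (rule has_fps_expansionI)
      show "\<forall>\<^sub>F u in nhds 0. (\<lambda>n. fps_nth (Abs_fps (\<lambda>p. 1 / complex_of_real (m p))) n * u ^ n) sums E u"
        using E_sums by (intro always_eventually allI) simp
    qed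
    then have coeff: "(deriv ^^ n) E 0 / fact n = 1 / of_real (m n)"
      using fps_nth_fps_expansion by fastforce
    have "cmod ((deriv ^^ n) E 0) \<le> fact n * (c * exp (assoc_fun M (quot n))) / r ^ n"
    proof (rule Cauchy_inequality[OF E_holomorphic E_continuous r])
      show "cmod (E x) \<le> c * exp (assoc_fun M (quot n))" if "cmod (0 - x) = r" for x
        using ck(3)[of x] that ck(1,2) by (simp add: r_def)
    qed
    then have "cmod ((deriv ^^ n) E 0 / fact n) \<le> c * exp (assoc_fun M (quot n)) / r ^ n"
      by (simp add: norm_divide divide_le_eq mult_ac)
    also have "\<dots> \<le> c * (quot n ^ n / M n) / r ^ n"
      using exp_assoc_quot_le ck r by (intro divide_right_mono mult_left_mono) auto
    also have "\<dots> = c / (k ^ n * M n)"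
      using quot_pos[of n] by (simp add: r_def power_mult_distrib)
    finally have "1 / m n \<le> c / (k ^ n * M n)"
      using coeff moment_pos[of n] by (simp add: norm_divide)
    then show ?thesis
      using ck moment_pos[of n] pos[of n] by (simp add: field_simps)
  qed
  with ck show thesis
    by (intro that[of "1 / c" k]) auto
qed

lemma omega_moment: "omega m = \<kappa>"
  using moment_le moment_ge omega_equivalent[of m] moment_pos by metis

end

subsection \<open>Analytic continuation of the inner integral\<close>

text \<open>Equality is known near 0, which lies outside \<open>W\<close> in the applications, and
  \<open>W\<close> need not be connected. Joining \<open>W\<close> to a disc about 0 gives a set
  starlike about 0, where the identity theorem applies.\<close>

lemma holomorphic_eq_star_shaped:
  assumes W: "open W" "\<And>u t. u \<in> W \<Longrightarrow> 0 < t \<Longrightarrow> t \<le> 1 \<Longrightarrow> of_real t * u \<in> W" and d: "0 < d"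
    and f: "f holomorphic_on W" "f holomorphic_on ball 0 d"
    and g: "g holomorphic_on W" "g holomorphic_on ball 0 d"
    and eq: "\<And>u. u \<in> ball 0 d \<Longrightarrow> f u = g u" and u: "u \<in> W"
  shows "f u = g u"
proof (rule analytic_continuation_open[of "ball 0 d" "W \<union> ball 0 d" f g])
  show "f holomorphic_on W \<union> ball 0 d" "g holomorphic_on W \<union> ball 0 d"
    using W f g by (auto intro: holomorphic_on_Un)
  have "starlike (W \<union> ball 0 d)"
    unfolding starlike_def
  proof (intro bexI[of _ 0] ballI subsetI)
    fix x y assume x: "x \<in> W \<union> ball 0 d" and "y \<in> closed_segment 0 x"
    then obtain t where t: "0 \<le> t" "t \<le> 1" "y = of_real t * x"
      by (auto simp: in_segment scaleR_conv_of_real)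
    show "y \<in> W \<union> ball 0 d"
    proof (cases "t = 0")
      case True
      then show ?thesis using t d by simp
    next
      case False
      have "t * cmod x \<le> cmod x"
        using t by (simp add: mult_left_le_one_le)
      then show ?thesis
        using False t x W(2)[of x t] by (auto simp: norm_mult)
    qed
  qed (use d in simp)
  then show "connected (W \<union> ball 0 d)"
    by (rule starlike_imp_connected)
qed (use W d eq u in auto)

context moment_kernel
begin

text \<open>
  \<open>K n \<tau> z\<close> is the inner integral for \<open>w = 1\<close> along the ray of direction \<open>\<tau>\<close>; the lemma \<open>K_ray_integral\<close>
  reduces all other \<open>w\<close> to this case.
\<close>

definition kint :: "nat \<Rightarrow> real \<Rightarrow> complex \<Rightarrow> real \<Rightarrow> complex" where
  "kint n \<tau> u s = (of_real s * cis \<tau>) ^ n * E (u * (of_real s * cis \<tau>)) *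
    (e (of_real s * cis \<tau>) / (of_real s * cis \<tau>)) * cis \<tau>"

definition K :: "nat \<Rightarrow> real \<Rightarrow> complex \<Rightarrow> complex" where
  "K n \<tau> u = (LINT s:{0<..}|lborel. kint n \<tau> u s)"

text \<open>The points \<open>u\<close> for which \<open>u\<close> times the ray of direction
  \<open>\<tau>\<close> lies in the sector of opening \<open>2 * pi - \<kappa> * pi\<close> about
  the negative real axis, where \<open>E\<close> is controlled; the minus sign moves that axis to
  argument 0.\<close>

definition ray_sector :: "real \<Rightarrow> complex set" where
  "ray_sector \<tau> = {u. u \<noteq> 0 \<and> \<bar>Arg (- (u * cis \<tau>))\<bar> < (1 - \<kappa> / 2) * pi}"

lemma norm_kint: "0 < s \<Longrightarrow> cmod (kint n \<tau> u s) = cmod (E (u * (of_real s * cis \<tau>))) * wt n \<tau> s"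
  by (simp add: kint_def wt_def norm_mult norm_divide norm_power)

lemma kint_measurable:
  "\<bar>\<tau>\<bar> < \<kappa> * pi / 2 \<Longrightarrow> set_borel_measurable lborel {0<..} (kint n \<tau> u)"
  unfolding kint_def
  by (intro set_borel_measurable_continuous_on_lborel continuous_intros e_ray_continuous
      continuous_on_compose2[OF E_continuous[of UNIV]]) auto

lemma opening_pos: "0 < (1 - \<kappa> / 2) * pi" and opening_less_pi: "(1 - \<kappa> / 2) * pi < pi"
  using omega_less_2 omega_pos by auto

lemma E_sector_bounded:
  assumes "\<sigma> < (1 - \<kappa> / 2) * pi"
  obtains C where "0 < C" "\<And>z. z \<noteq> 0 \<Longrightarrow> \<bar>Arg (- z)\<bar> \<le> \<sigma> \<Longrightarrow> cmod (E z) \<le> C"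
proof -
  \<comment> \<open>Its half is the midpoint of \<open>max \<sigma> 0\<close> and the limiting
    half-opening, so it exceeds \<open>\<sigma>\<close> while the sector is still admissible for
    \<open>E\<close>; the maximum keeps \<open>\<theta>\<close> positive.\<close>
  define \<theta> where "\<theta> = max \<sigma> 0 + (1 - \<kappa> / 2) * pi"
  have \<theta>: "0 < \<theta>" "\<sigma> < \<theta> / 2" "\<theta> < 2 * pi - \<kappa> * pi"
  proof -
    have "(1 - \<kappa> / 2) * pi = pi - \<kappa> * pi / 2"
      by (simp add: algebra_simps)
    moreover have "0 \<le> max \<sigma> 0" "\<sigma> \<le> max \<sigma> 0" "max \<sigma> 0 < (1 - \<kappa> / 2) * pi"
      using assms opening_pos by auto
    ultimately have "0 < \<theta> \<and> \<sigma> < \<theta> / 2 \<and> \<theta> < 2 * pi - \<kappa> * pi"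
      unfolding \<theta>_def using assms opening_pos by argo
    then show "0 < \<theta>" "\<sigma> < \<theta> / 2" "\<theta> < 2 * pi - \<kappa> * pi"
      by simp_all
  qed
  obtain \<beta> where \<beta>: "\<beta> > 0" "\<And>\<theta> R. 0 < \<theta> \<Longrightarrow> \<theta> < 2 * pi - \<kappa> * pi \<Longrightarrow> 0 < R \<Longrightarrow>
      \<exists>c>0. \<forall>z\<in>plane_sector pi \<theta> - ball 0 R. cmod (E z) \<le> c * cmod z powr (- \<beta>)"
    using kernel_E by (auto simp: kernel_E_def)
  obtain c where c: "c > 0" "\<And>z. z \<in> plane_sector pi \<theta> - ball 0 1 \<Longrightarrow> cmod (E z) \<le> c * cmod z powr (- \<beta>)"
    using \<beta>(2)[OF \<theta>(1,3) zero_less_one] by blast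
  have "compact (E ` cball 0 1)"
    by (intro compact_continuous_image E_continuous compact_cball)
  then obtain C0 where C0: "\<And>z. z \<in> cball 0 1 \<Longrightarrow> cmod (E z) \<le> C0"
    using compact_imp_bounded bounded_iff by (metis imageI)
  have "cmod (E z) \<le> c + \<bar>C0\<bar>" if z: "z \<noteq> 0" "\<bar>Arg (- z)\<bar> \<le> \<sigma>" for z
  proof (cases "cmod z \<le> 1")
    case True
    then show ?thesis
      using C0[of z] c(1) by auto
  next
    case False
    have "of_real (cmod z) * cis (pi + Arg (- z)) \<in> plane_sector pi \<theta>"
      using z \<theta> by (intro mem_plane_sector_rcis) auto
    also have "of_real (cmod z) * cis (pi + Arg (- z)) = - (of_real (cmod (- z)) * cis (Arg (- z)))"
      by (simp flip: cis_mult)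
    also have "\<dots> = z"
      using rcis_cmod_Arg[of "- z"] by (simp add: rcis_def)
    finally have "cmod (E z) \<le> c * cmod z powr (- \<beta>)"
      using False by (intro c(2)) auto
    also have "\<dots> \<le> c * 1"
      using False c \<beta>(1) by (intro mult_left_mono) (auto simp: powr_le_one_le powr_minus inverse_le_1_iff ge_one_powr_ge_zero)
    finally show ?thesis
      by simp
  qed
  with c(1) show thesis
    by (intro that[of "c + \<bar>C0\<bar>"]) auto
qed

lemma K_sector_bound:
  assumes "T < \<kappa> * pi / 2" "\<sigma> < (1 - \<kappa> / 2) * pi"
  obtains C B where "0 < C" "0 < B" "\<And>n \<tau> u. \<bar>\<tau>\<bar> \<le> T \<Longrightarrow> u \<noteq> 0 \<Longrightarrow> \<bar>Arg (- (u * cis \<tau>))\<bar> \<le> \<sigma> \<Longrightarrow>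
    set_integrable lborel {0<..} (kint n \<tau> u) \<and> cmod (K n \<tau> u) \<le> C * B ^ n * M n"
proof -
  obtain C0 where C0: "0 < C0" "\<And>z. z \<noteq> 0 \<Longrightarrow> \<bar>Arg (- z)\<bar> \<le> \<sigma> \<Longrightarrow> cmod (E z) \<le> C0"
    by (rule E_sector_bounded[OF assms(2)]) blast
  obtain C B where CB: "0 < C" "0 < B" "\<And>n \<tau>. \<bar>\<tau>\<bar> \<le> T \<Longrightarrow>
    set_integrable lborel {0<..} (wt n \<tau>) \<and> (LINT s:{0<..}|lborel. wt n \<tau> s) \<le> C * B ^ n * M n"
    by (rule wt_bound[OF assms(1)]) blast
  have "set_integrable lborel {0<..} (kint n \<tau> u) \<and> cmod (K n \<tau> u) \<le> (C0 * C) * B ^ n * M n"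
    if \<tau>: "\<bar>\<tau>\<bar> \<le> T" and u: "u \<noteq> 0" "\<bar>Arg (- (u * cis \<tau>))\<bar> \<le> \<sigma>" for n \<tau> u
  proof -
    have bnd: "cmod (kint n \<tau> u s) \<le> C0 * wt n \<tau> s" if s: "0 < s" for s
    proof -
      have "Arg (- (u * (of_real s * cis \<tau>))) = Arg (of_real s * (- (u * cis \<tau>)))"
        by (simp add: mult_ac)
      also have "\<dots> = Arg (- (u * cis \<tau>))"
        by (rule Arg_times_of_real[OF s])
      finally have "cmod (E (u * (of_real s * cis \<tau>))) \<le> C0"
        using u s by (intro C0) auto
      then show ?thesis
        using wt_nonneg[OF s] by (simp add: norm_kint[OF s] mult_right_mono)
    qed
    have int: "set_integrable lborel {0<..} (\<lambda>s. C0 * wt n \<tau> s)"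
      using CB(3)[OF \<tau>] by (intro set_integrable_mult_right) auto
    have int': "set_integrable lborel {0<..} (kint n \<tau> u)"
    proof (rule set_integrable_bound[OF int kint_measurable])
      show "AE s in lborel. s \<in> {0<..} \<longrightarrow> norm (kint n \<tau> u s) \<le> norm (C0 * wt n \<tau> s)"
        using bnd C0(1) wt_nonneg by (intro AE_I2) (auto simp: abs_mult)
    qed (use \<tau> assms in simp)
    have "cmod (K n \<tau> u) \<le> (LINT s:{0<..}|lborel. cmod (kint n \<tau> u s))"
      unfolding K_def set_lebesgue_integral_def by (rule order_trans[OF integral_norm_bound]) simp
    also have "\<dots> \<le> (LINT s:{0<..}|lborel. C0 * wt n \<tau> s)"
      using bnd by (intro set_integral_mono set_integrable_norm int' int) auto
    also have "\<dots> = C0 * (LINT s:{0<..}|lborel. wt n \<tau> s)"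
      by (rule set_integral_mult_right)
    also have "\<dots> \<le> C0 * (C * B ^ n * M n)"
      using CB(3)[OF \<tau>] C0(1) by (intro mult_left_mono) auto
    finally show ?thesis
      using int' by (simp add: mult_ac)
  qed
  then show thesis
    using that[of "C0 * C" B] CB(1,2) C0(1) by simp
qed

lemma open_rotated_sector:
  assumes "\<sigma> \<le> pi"
  shows "open {u. u \<noteq> 0 \<and> \<bar>Arg (- (u * cis \<tau>))\<bar> < \<sigma>}"
proof -
  have "{u. u \<noteq> 0 \<and> \<bar>Arg (- (u * cis \<tau>))\<bar> < \<sigma>} = (\<lambda>u. - (u * cis \<tau>)) -` {z. z \<noteq> 0 \<and> \<bar>Arg z\<bar> < \<sigma>}"
    by auto
  also have "open \<dots>"
    by (intro open_vimage open_Arg_sector assms continuous_intros)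
  finally show ?thesis .
qed

lemma open_ray_sector: "open (ray_sector \<tau>)"
  unfolding ray_sector_def using opening_less_pi by (intro open_rotated_sector) auto

lemma ray_sector_scale: "u \<in> ray_sector \<tau> \<Longrightarrow> 0 < t \<Longrightarrow> of_real t * u \<in> ray_sector \<tau>"
  using Arg_times_of_real[of t "- (u * cis \<tau>)"] by (simp add: ray_sector_def mult.assoc)

lemma K_holomorphic_ray_sector:
  assumes \<tau>: "\<bar>\<tau>\<bar> < \<kappa> * pi / 2"
  shows "K n \<tau> holomorphic_on ray_sector \<tau>"
  unfolding K_def[abs_def]
proof (rule holomorphic_on_set_integral[OF open_ray_sector kint_measurable[OF \<tau>]])
  fix s :: real assume "s \<in> {0<..}"
  have "E \<circ> (\<lambda>u. u * (of_real s * cis \<tau>)) holomorphic_on ray_sector \<tau>"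
    by (intro holomorphic_on_compose_gen[OF _ E_holomorphic[of UNIV]] holomorphic_intros) auto
  then show "(\<lambda>u. kint n \<tau> u s) holomorphic_on ray_sector \<tau>"
    unfolding kint_def o_def by (intro holomorphic_on_mult holomorphic_on_const)
next
  fix u0 assume u0: "u0 \<in> ray_sector \<tau>"
  define \<sigma> where "\<sigma> = (\<bar>Arg (- (u0 * cis \<tau>))\<bar> + (1 - \<kappa> / 2) * pi) / 2"
  have "\<bar>Arg (- (u0 * cis \<tau>))\<bar> < (1 - \<kappa> / 2) * pi"
    using u0 by (simp add: ray_sector_def)
  then have "\<bar>Arg (- (u0 * cis \<tau>))\<bar> < \<sigma> \<and> \<sigma> < (1 - \<kappa> / 2) * pi"
    unfolding \<sigma>_def by argo
  then have \<sigma>: "\<bar>Arg (- (u0 * cis \<tau>))\<bar> < \<sigma>" "\<sigma> < (1 - \<kappa> / 2) * pi"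
    by simp_all
  obtain C0 where C0: "0 < C0" "\<And>z. z \<noteq> 0 \<Longrightarrow> \<bar>Arg (- z)\<bar> \<le> \<sigma> \<Longrightarrow> cmod (E z) \<le> C0"
    by (rule E_sector_bounded[OF \<sigma>(2)]) blast
  have "open {u. u \<noteq> 0 \<and> \<bar>Arg (- (u * cis \<tau>))\<bar> < \<sigma>}"
    by (rule open_rotated_sector, rule less_imp_le, rule less_trans[OF \<sigma>(2) opening_less_pi])
  moreover have "u0 \<in> {u. u \<noteq> 0 \<and> \<bar>Arg (- (u * cis \<tau>))\<bar> < \<sigma>}"
    using u0 \<sigma> by (auto simp: ray_sector_def)
  ultimately obtain d where d: "d > 0" "ball u0 d \<subseteq> {u. u \<noteq> 0 \<and> \<bar>Arg (- (u * cis \<tau>))\<bar> < \<sigma>}"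
    by (meson openE)
  have "cmod (kint n \<tau> u s) \<le> C0 * wt n \<tau> s" if u: "u \<in> ball u0 d" and s: "0 < s" for u s
  proof -
    have "Arg (- (u * (of_real s * cis \<tau>))) = Arg (of_real s * (- (u * cis \<tau>)))"
      by (simp add: mult_ac)
    also have "\<dots> = Arg (- (u * cis \<tau>))"
      by (rule Arg_times_of_real[OF s])
    finally have "cmod (E (u * (of_real s * cis \<tau>))) \<le> C0"
      using subsetD[OF d(2) u] s by (intro C0) auto
    then show ?thesis
      using wt_nonneg[OF s] by (simp add: norm_kint[OF s] mult_right_mono)
  qed
  moreover have "set_integrable lborel {0<..} (\<lambda>s. C0 * wt n \<tau> s)"
    using wt_integrable[OF \<tau>] by (intro set_integrable_mult_right) auto
  ultimately show "\<exists>d>0. \<exists>g. set_integrable lborel {0<..} g \<and>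
      (\<forall>u\<in>ball u0 d \<inter> ray_sector \<tau>. \<forall>s\<in>{0<..}. cmod (kint n \<tau> u s) \<le> g s)"
    using d(1) by (intro exI[of _ d] conjI exI[of _ "\<lambda>s. C0 * wt n \<tau> s"]) auto
qed

text \<open>Expanding \<open>E\<close> and integrating term by term produces the coefficients
  \<open>m (n + p) / m p\<close>. For the exchange, moderate growth of \<open>M\<close> and the
  lower bound for \<open>m p\<close> compare the integrals of the moduli with a geometric series of
  ratio \<open>cmod u / c\<close>, where \<open>c\<close> does not depend on
  \<open>n\<close>.\<close>

lemma K_series:
  assumes \<tau>: "\<bar>\<tau>\<bar> < \<kappa> * pi / 2"
  obtains c where "0 < c" "\<And>n u. cmod u < c \<Longrightarrow> set_integrable lborel {0<..} (kint n \<tau> u)"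
    "\<And>n u. cmod u < c \<Longrightarrow> (\<lambda>p. of_real (m (n + p) / m p) * u ^ p) sums K n \<tau> u"
proof -
  obtain C B where CB: "0 < C" "0 < B" "\<And>n \<tau>'. \<bar>\<tau>'\<bar> \<le> \<bar>\<tau>\<bar> \<Longrightarrow>
    set_integrable lborel {0<..} (wt n \<tau>') \<and> (LINT s:{0<..}|lborel. wt n \<tau>' s) \<le> C * B ^ n * M n"
    by (rule wt_bound[OF \<tau>]) blast
  obtain c0 b where cb: "0 < c0" "0 < b" "\<And>n. c0 * b ^ n * M n \<le> m n"
    by (rule moment_ge) blast
  obtain A where A: "2 \<le> A" "\<And>p q. M (p + q) \<le> A ^ (p + q) * M p * M q"
    by (rule moderate_growth) blast
  define c where "c = b / (A * B)"
  have "0 < c"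
    using A CB cb by (simp add: c_def)
  moreover have "set_integrable lborel {0<..} (kint n \<tau> u) \<and>
      (\<lambda>p. of_real (m (n + p) / m p) * u ^ p) sums K n \<tau> u" if u: "cmod u < c" for n u
  proof -
    define f where "f p s = u ^ p / of_real (m p) *
      ((of_real s * cis \<tau>) ^ (n + p) * (e (of_real s * cis \<tau>) / (of_real s * cis \<tau>)) * cis \<tau>)" for p s
    have f_norm: "cmod (f p s) = cmod u ^ p / m p * wt (n + p) \<tau> s" if "0 < s" for p s
      using that moment_pos[of p] by (simp add: f_def wt_def norm_mult norm_divide norm_power)
    have f_meas: "set_borel_measurable lborel {0<..} (f p)" for p
      unfolding f_def
      by (intro set_borel_measurable_continuous_on_lborel continuous_intros e_ray_continuous \<tau>) auto
    have wt_int: "set_integrable lborel {0<..} (\<lambda>s. cmod u ^ p / m p * wt (n + p) \<tau> s)" for p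
      by (intro set_integrable_mult_right wt_integrable \<tau>)
    have f_int: "set_integrable lborel {0<..} (f p)" for p
    proof (rule set_integrable_bound[OF wt_int f_meas])
      show "AE s in lborel. s \<in> {0<..} \<longrightarrow> norm (f p s) \<le> norm (cmod u ^ p / m p * wt (n + p) \<tau> s)"
        using moment_pos[of p] wt_nonneg by (intro AE_I2) (auto simp: f_norm)
    qed
    have f_integral: "(LINT s:{0<..}|lborel. f p s) = of_real (m (n + p) / m p) * u ^ p" for p
      unfolding f_def set_integral_mult_right e_ray_integral[OF \<tau>] by simp
    have f_norm_integral: "(LINT s:{0<..}|lborel. cmod (f p s)) \<le> C * (B * A) ^ n * M n / c0 * (cmod u / c) ^ p" for p
    proof -
      have "(LINT s:{0<..}|lborel. cmod (f p s)) = cmod u ^ p / m p * (LINT s:{0<..}|lborel. wt (n + p) \<tau> s)"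
        unfolding set_integral_mult_right[symmetric]
        by (intro set_lebesgue_integral_cong) (auto simp: f_norm)
      also have "\<dots> \<le> cmod u ^ p / m p * (C * B ^ (n + p) * M (n + p))"
        using CB(3)[of \<tau> "n + p"] moment_pos[of p] by (intro mult_left_mono) auto
      also have "\<dots> \<le> cmod u ^ p / m p * (C * B ^ (n + p) * (A ^ (n + p) * M n * M p))"
        using A(2)[of n p] moment_pos[of p] CB by (intro mult_left_mono) auto
      also have "\<dots> = C * (B * A) ^ (n + p) * M n * cmod u ^ p * (M p / m p)"
        by (simp add: power_mult_distrib)
      also have "M p / m p \<le> 1 / (c0 * b ^ p)"
        using cb moment_pos[of p] by (simp add: field_simps)
      also have "C * (B * A) ^ (n + p) * M n * cmod u ^ p * (1 / (c0 * b ^ p)) =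
          C * (B * A) ^ n * M n / c0 * (cmod u / c) ^ p"
        using A CB by (simp add: c_def power_add power_mult_distrib power_divide)
      finally show ?thesis
        using A CB pos[of n] by (simp add: mult_left_mono)
    qed
    define F where "F p s = indicator {0<..} s *\<^sub>R f p s" for p and s :: real
    have F: "integrable lborel (F p)" for p
      using f_int by (simp add: F_def[abs_def] set_integrable_def)
    have F_norm: "(\<integral>s. norm (F p s) \<partial>lborel) = (LINT s:{0<..}|lborel. cmod (f p s))" for p
      unfolding F_def set_lebesgue_integral_def by (intro Bochner_Integration.integral_cong) auto
    have sums: "(\<lambda>p. f p s) sums kint n \<tau> u s" if "0 < s" for s
    proof -
      let ?x = "of_real s * cis \<tau>"
      have "(\<lambda>p. (?x ^ n * (e ?x / ?x) * cis \<tau>) * ((u * ?x) ^ p / of_real (m p))) sums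
          ((?x ^ n * (e ?x / ?x) * cis \<tau>) * E (u * ?x))"
        by (intro sums_mult E_sums)
      then show ?thesis
        by (simp add: f_def kint_def power_add power_mult_distrib mult_ac)
    qed
    have summ: "AE s in lborel. summable (\<lambda>p. norm (F p s))"
    proof (intro AE_I2)
      fix s :: real
      show "summable (\<lambda>p. norm (F p s))"
      proof (cases "0 < s")
        case True
        have "summable (\<lambda>p. complex_of_real ((cmod u * s) ^ p / m p))"
          using E_sums[of "of_real (cmod u * s)"] by (simp add: sums_iff)
        then have "summable (\<lambda>p. (cmod u * s) ^ p / m p)"
          by (simp only: summable_of_real_iff)
        then have "summable (\<lambda>p. wt n \<tau> s * ((cmod u * s) ^ p / m p))"
          by (rule summable_mult)
        moreover have "norm (F p s) = wt n \<tau> s * ((cmod u * s) ^ p / m p)" for p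
          using True by (simp add: F_def f_norm) (simp add: wt_def power_add power_mult_distrib)
        ultimately show ?thesis
          by simp
      qed (simp add: F_def)
    qed
    have summ': "summable (\<lambda>p. \<integral>s. norm (F p s) \<partial>lborel)"
    proof (rule summable_comparison_test)
      show "\<exists>N. \<forall>p\<ge>N. norm (\<integral>s. norm (F p s) \<partial>lborel) \<le> C * (B * A) ^ n * M n / c0 * (cmod u / c) ^ p"
        using f_norm_integral by (auto simp: F_norm[symmetric] intro!: exI[of _ 0])
      show "summable (\<lambda>p. C * (B * A) ^ n * M n / c0 * (cmod u / c) ^ p)"
        using u \<open>0 < c\<close> by (intro summable_mult summable_geometric) auto
    qed
    have eq: "(\<Sum>p. F p s) = indicator {0<..} s *\<^sub>R kint n \<tau> u s" for s
      using sums[of s] by (cases "0 < s") (auto simp: F_def sums_iff)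
    show ?thesis
      using integrable_suminf[OF F summ summ'] sums_integral[OF F summ summ']
      unfolding eq using f_integral
      by (simp add: set_integrable_def K_def set_lebesgue_integral_def F_def)
  qed
  ultimately show thesis
    using that by blast
qed

lemma K_holomorphic_disc:
  assumes "\<And>u. cmod u < c \<Longrightarrow> (\<lambda>p. of_real (m (n + p) / m p) * u ^ p) sums K n \<tau> u"
  shows "K n \<tau> holomorphic_on ball 0 c"
  by (rule power_series_holomorphic[of _ _ "\<lambda>p. of_real (m (n + p) / m p)"]) (use assms in auto)

text \<open>Near 0 both sides have the same power series, whatever the direction, and the
  intersection of the two sectors is invariant under contraction towards 0.\<close>

lemma K_eq_on_ray_sectors:
  assumes \<tau>: "\<bar>\<tau>\<bar> < \<kappa> * pi / 2" "\<bar>\<tau>'\<bar> < \<kappa> * pi / 2"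
    and u: "u \<in> ray_sector \<tau>" "u \<in> ray_sector \<tau>'"
  shows "K n \<tau> u = K n \<tau>' u"
proof -
  obtain c where c: "0 < c" "\<And>n u. cmod u < c \<Longrightarrow> (\<lambda>p. of_real (m (n + p) / m p) * u ^ p) sums K n \<tau> u"
    by (rule K_series[OF \<tau>(1)]) blast
  obtain c' where c': "0 < c'" "\<And>n u. cmod u < c' \<Longrightarrow> (\<lambda>p. of_real (m (n + p) / m p) * u ^ p) sums K n \<tau>' u"
    by (rule K_series[OF \<tau>(2)]) blast
  show ?thesis
  proof (rule holomorphic_eq_star_shaped[where W = "ray_sector \<tau> \<inter> ray_sector \<tau>'" and d = "min c c'"
        and f = "K n \<tau>" and g = "K n \<tau>'"])
    show "K n \<tau> holomorphic_on ball 0 (min c c')" "K n \<tau>' holomorphic_on ball 0 (min c c')"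
      using c(2) c'(2) by (auto intro: K_holomorphic_disc)
    show "K n \<tau> holomorphic_on ray_sector \<tau> \<inter> ray_sector \<tau>'"
      "K n \<tau>' holomorphic_on ray_sector \<tau> \<inter> ray_sector \<tau>'"
      using K_holomorphic_ray_sector \<tau> by (auto intro: holomorphic_on_subset)
    show "K n \<tau> v = K n \<tau>' v" if "v \<in> ball 0 (min c c')" for v
      using sums_unique2[OF c(2) c'(2)] that by simp
  qed (use u c c' in \<open>auto intro: ray_sector_scale open_Int open_ray_sector\<close>)
qed

text \<open>The series along \<open>\<tau>\<close> may have been established in a smaller disc than
  the one along \<open>\<tau>'\<close>; equality in the smaller disc is continued to the part of the
  larger one inside the ray sector.\<close>

lemma K_eq_disc:
  assumes \<tau>: "\<bar>\<tau>\<bar> < \<kappa> * pi / 2"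
    and c: "\<And>n u. cmod u < c \<Longrightarrow> (\<lambda>p. of_real (m (n + p) / m p) * u ^ p) sums K n \<tau>' u"
    and u: "u \<in> ray_sector \<tau>" "cmod u < c"
  shows "K n \<tau> u = K n \<tau>' u"
proof -
  obtain c' where c': "0 < c'" "\<And>n u. cmod u < c' \<Longrightarrow> (\<lambda>p. of_real (m (n + p) / m p) * u ^ p) sums K n \<tau> u"
    by (rule K_series[OF \<tau>]) blast
  have "0 < c"
    using u(2) norm_ge_zero[of u] by linarith
  show ?thesis
  proof (rule holomorphic_eq_star_shaped[where W = "ray_sector \<tau> \<inter> ball 0 c" and d = "min c c'"
        and f = "K n \<tau>" and g = "K n \<tau>'"])
    show "K n \<tau> holomorphic_on ball 0 (min c c')" "K n \<tau>' holomorphic_on ball 0 (min c c')"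
      using c c'(2) by (auto intro: K_holomorphic_disc)
    show "K n \<tau> holomorphic_on ray_sector \<tau> \<inter> ball 0 c"
      "K n \<tau>' holomorphic_on ray_sector \<tau> \<inter> ball 0 c"
      using K_holomorphic_ray_sector[OF \<tau>] K_holomorphic_disc[OF c] by (auto intro: holomorphic_on_subset)
    show "K n \<tau> v = K n \<tau>' v" if "v \<in> ball 0 (min c c')" for v
      using sums_unique2[OF c'(2) c] that by simp
    show "of_real t * v \<in> ray_sector \<tau> \<inter> ball 0 c" if "v \<in> ray_sector \<tau> \<inter> ball 0 c" "0 < t" "t \<le> 1" for v t
    proof -
      have "t * cmod v \<le> 1 * cmod v"
        using that by (intro mult_right_mono) auto
      then show ?thesis
        using that ray_sector_scale[of v \<tau> t] by (auto simp: norm_mult)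
    qed
  qed (use u c' \<open>0 < c\<close> in \<open>auto intro: open_ray_sector\<close>)
qed

text \<open>Moderate growth passes from \<open>M\<close> to \<open>m\<close> by equivalence. It
  bounds the coefficients \<open>m (n + p) / m p\<close> by \<open>m n\<close> times geometric
  factors in \<open>n\<close> and \<open>p\<close>.\<close>

lemma moment_moderate_growth:
  obtains C B where "0 < C" "0 < B" "\<And>n p. m (n + p) \<le> C * B ^ n * m n * (B ^ p * m p)"
proof -
  obtain C B where CB: "0 < C" "0 < B" "\<And>n. m n \<le> C * B ^ n * M n"
    by (rule moment_le) blast
  obtain c b where cb: "0 < c" "0 < b" "\<And>n. c * b ^ n * M n \<le> m n"
    by (rule moment_ge) blast
  obtain A where A: "2 \<le> A" "\<And>p q. M (p + q) \<le> A ^ (p + q) * M p * M q"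
    by (rule moderate_growth) blast
  have Mm: "M n \<le> m n / (c * b ^ n)" for n
    using cb by (simp add: pos_le_divide_eq mult_ac)
  have "m (n + p) \<le> (C / c\<^sup>2) * (B * A / b) ^ n * m n * ((B * A / b) ^ p * m p)" for n p
  proof -
    have "m (n + p) \<le> C * B ^ (n + p) * (A ^ (n + p) * M n * M p)"
      using CB(3)[of "n + p"] A(2)[of n p] CB by (elim order_trans) (intro mult_left_mono; simp)
    also have "\<dots> \<le> C * B ^ (n + p) * (A ^ (n + p) * (m n / (c * b ^ n)) * (m p / (c * b ^ p)))"
      using CB A Mm pos cb by (intro mult_left_mono mult_mono) (auto simp: less_imp_le moment_pos)
    also have "\<dots> = (C / c\<^sup>2) * (B * A / b) ^ n * m n * ((B * A / b) ^ p * m p)"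
      by (simp add: power_add power_mult_distrib power_divide power2_eq_square mult_ac)
    finally show ?thesis .
  qed
  with CB cb A show thesis
    by (intro that[of "C / c\<^sup>2" "B * A / b"]) auto
qed

lemma K_ray_integral:
  assumes "0 < R" and w: "w = of_real R * cis \<alpha>"
  shows "ray_integral \<tau> (kernel_integrand e E n z w) = K n (\<tau> + \<alpha>) (z / w) / w ^ Suc n"
    and "set_integrable lborel {0<..} (kint n (\<tau> + \<alpha>) (z / w)) \<Longrightarrow>
      ray_integrable \<tau> (kernel_integrand e E n z w)"
proof -
  let ?k = "kint n (\<tau> + \<alpha>) (z / w)"
  have w0: "w \<noteq> 0"
    using assms by auto
  have eq: "kernel_integrand e E n z w (of_real s * cis \<tau>) * cis \<tau> =
      1 / (w ^ n * cis \<alpha>) * ?k (R * s)" for s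
  proof -
    have x: "of_real (R * s) * cis (\<tau> + \<alpha>) = w * (of_real s * cis \<tau>)"
      by (simp add: w mult_ac flip: cis_mult)
    have "z / w * (w * (of_real s * cis \<tau>)) = z * (of_real s * cis \<tau>)"
      using w0 by simp
    then show ?thesis
      unfolding kint_def kernel_integrand_def x using w0
      by (simp add: power_mult_distrib mult_ac flip: cis_mult)
  qed
  have "ray_integral \<tau> (kernel_integrand e E n z w) = 1 / (w ^ n * cis \<alpha>) * (K n (\<tau> + \<alpha>) (z / w) / of_real R)"
    unfolding ray_integral_def eq set_integral_mult_right set_integral_Ioi_scale(1)[OF \<open>0 < R\<close>] K_def ..
  also have "\<dots> = K n (\<tau> + \<alpha>) (z / w) / w ^ Suc n"
    by (simp add: w)
  finally show "ray_integral \<tau> (kernel_integrand e E n z w) = K n (\<tau> + \<alpha>) (z / w) / w ^ Suc n" .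
  show "ray_integrable \<tau> (kernel_integrand e E n z w)" if "set_integrable lborel {0<..} ?k"
    unfolding ray_integrable_def eq
    using that set_integral_Ioi_scale(2)[OF \<open>0 < R\<close>, of ?k] by (intro set_integrable_mult_right) simp
qed

text \<open>
  If \<open>u = - \<bar>u\<bar> cis x\<close> with \<open>\<bar>x\<bar> < \<pi>\<close>, the direction \<open>- x \<kappa> / 2\<close> lies in the sector of \<open>e\<close>, and
  multiplication by \<open>u\<close> takes the ray to the argument \<open>\<pi> + x (1 - \<kappa> / 2)\<close>, in the sector of \<open>E\<close>.
\<close>

lemma Arg_ray_direction:
  assumes "u \<noteq> 0"
  shows "Arg (- (u * cis (- Arg (- u) * \<kappa> / 2))) = Arg (- u) * (1 - \<kappa> / 2)"
proof (rule Arg_unique'[of "cmod u"])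
  have "- (u * cis (- Arg (- u) * \<kappa> / 2)) = rcis (cmod (- u)) (Arg (- u)) * cis (- Arg (- u) * \<kappa> / 2)"
    by (simp only: rcis_cmod_Arg mult_minus_left)
  also have "\<dots> = rcis (cmod u) (Arg (- u) * (1 - \<kappa> / 2))"
    by (simp add: rcis_def mult.assoc cis_mult algebra_simps)
  finally show "- (u * cis (- Arg (- u) * \<kappa> / 2)) = rcis (cmod u) (Arg (- u) * (1 - \<kappa> / 2))" .
  have "\<bar>Arg (- u) * (1 - \<kappa> / 2)\<bar> \<le> pi * (1 - \<kappa> / 2)"
    using omega_less_2 Arg_bounded[of "- u"] by (auto simp: abs_mult intro!: mult_right_mono)
  moreover have "pi * (1 - \<kappa> / 2) < pi"
    using opening_less_pi by (simp only: mult.commute)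
  ultimately have "\<bar>Arg (- u) * (1 - \<kappa> / 2)\<bar> < pi"
    by (rule le_less_trans)
  then show "Arg (- u) * (1 - \<kappa> / 2) \<in> {-pi<..pi}"
    by (simp only: abs_less_iff greaterThanAtMost_iff) linarith
qed (use assms in simp)

text \<open>All that is used later about the inner integral. \<open>T u\<close> is the direction of
  the ray for \<open>w = 1\<close>, the same for all \<open>n\<close>. For \<open>n = 0\<close> the
  coefficients are all 1, so \<open>G 0 (z / w) / w\<close> is the Cauchy kernel
  \<open>1 / (w - z)\<close> for \<open>z\<close> near 0. Outside a small disc, the estimate
  excludes only directions closer than \<open>\<eta>\<close> to that of the slit.\<close>

lemma moment_resolvent:
  obtains c :: real and G :: "nat \<Rightarrow> complex \<Rightarrow> complex" and T :: "complex \<Rightarrow> real"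
  where "0 < c"
    "\<And>n. G n holomorphic_on {u. \<not> (Im u = 0 \<and> c \<le> Re u)}"
    "\<And>n u. cmod u < c \<Longrightarrow> (\<lambda>p. of_real (m (n + p) / m p) * u ^ p) sums G n u"
    "\<And>\<eta>. 0 < \<eta> \<Longrightarrow> \<eta> < pi / 2 \<Longrightarrow> \<exists>C>0. \<exists>B>0. \<forall>n u.
      cmod u \<le> c / 2 \<or> Re u \<le> cmod u * cos \<eta> \<longrightarrow> cmod (G n u) \<le> C * B ^ n * m n"
    "\<And>u. \<not> (Im u = 0 \<and> c \<le> Re u) \<Longrightarrow> \<bar>T u\<bar> < \<kappa> * pi / 2"
    "\<And>n z w R \<alpha>. 0 < R \<Longrightarrow> w = of_real R * cis \<alpha> \<Longrightarrow> \<not> (Im (z / w) = 0 \<and> c \<le> Re (z / w)) \<Longrightarrow>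
      ray_integrable (T (z / w) - \<alpha>) (kernel_integrand e E n z w) \<and>
      ray_integral (T (z / w) - \<alpha>) (kernel_integrand e E n z w) = G n (z / w) / w ^ Suc n"
proof -
  have 0: "\<bar>0\<bar> < \<kappa> * pi / 2"
    using omega_pos by simp
  obtain c1 where c1: "0 < c1" "\<And>n u. cmod u < c1 \<Longrightarrow> set_integrable lborel {0<..} (kint n 0 u)"
    "\<And>n u. cmod u < c1 \<Longrightarrow> (\<lambda>p. of_real (m (n + p) / m p) * u ^ p) sums K n 0 u"
    by (rule K_series[OF 0]) blast
  obtain C1 B1 where CB1: "0 < C1" "0 < B1" "\<And>n p. m (n + p) \<le> C1 * B1 ^ n * m n * (B1 ^ p * m p)"
    by (rule moment_moderate_growth) blast
  \<comment> \<open>\<open>c1\<close> is the radius of the series in direction 0; the bound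
    \<open>1 / B1\<close> makes the terms decay like \<open>(1 / 2) ^ p\<close> on the disc of
    radius \<open>c / 2\<close>.\<close>
  define c where "c = min c1 (1 / B1)"
  have c: "0 < c" "c \<le> c1" "c \<le> 1 / B1"
    using c1 CB1 by (auto simp: c_def)
  define dir where "dir u = - Arg (- u) * \<kappa> / 2" for u
  \<comment> \<open>In the small disc direction 0 is used, because for \<open>u\<close> on the
    positive axis \<open>dir\<close> would fall on the edge of the sector of \<open>e\<close>;
    outside the disc this axis belongs to the slit.\<close>
  define T where "T u = (if cmod u < c then 0 else dir u)" for u
  define G where "G n u = K n (T u) u" for n u
  let ?\<Omega> = "{u. \<not> (Im u = 0 \<and> c \<le> Re u)}"
  have dir: "\<bar>dir u\<bar> < \<kappa> * pi / 2" "u \<in> ray_sector (dir u)" if "- u \<notin> \<real>\<^sub>\<le>\<^sub>0" for u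
  proof -
    have u: "u \<noteq> 0" "\<bar>Arg (- u)\<bar> < pi"
      using that Arg_bounded[of "- u"] by (auto simp: nonpos_Reals_iff_Arg abs_less_iff)
    then have "\<bar>Arg (- u)\<bar> * (\<kappa> / 2) < pi * (\<kappa> / 2)"
      using omega_pos by (intro mult_strict_right_mono) auto
    then show "\<bar>dir u\<bar> < \<kappa> * pi / 2"
      using omega_pos by (simp add: dir_def abs_mult mult.commute)
    have "\<bar>Arg (- u)\<bar> * (1 - \<kappa> / 2) < pi * (1 - \<kappa> / 2)"
      using u omega_less_2 by (intro mult_strict_right_mono) auto
    then show "u \<in> ray_sector (dir u)"
      using u omega_less_2 Arg_ray_direction[of u]
      by (simp add: ray_sector_def dir_def abs_mult mult.commute)
  qed
  have \<Omega>: "- u \<notin> \<real>\<^sub>\<le>\<^sub>0" if "u \<in> ?\<Omega>" "\<not> cmod u < c" for u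
  proof
    assume "- u \<in> \<real>\<^sub>\<le>\<^sub>0"
    then have "Im u = 0" "0 \<le> Re u"
      by (auto simp: complex_nonpos_Reals_iff)
    then show False
      using that cmod_eq_Re[of u] by auto
  qed
  have T: "\<bar>T u\<bar> < \<kappa> * pi / 2" if "u \<in> ?\<Omega>" for u
    using \<Omega>[OF that] dir[of u] 0 by (simp add: T_def)
  have int: "set_integrable lborel {0<..} (kint n (T u) u)" if "u \<in> ?\<Omega>" for n u
  proof (cases "cmod u < c")
    case True
    then show ?thesis
      using c1(2) c by (simp add: T_def)
  next
    case False
    note d = dir[OF \<Omega>[OF that False]]
    then have s: "\<bar>Arg (- (u * cis (dir u)))\<bar> < (1 - \<kappa> / 2) * pi" "u \<noteq> 0"
      by (auto simp: ray_sector_def)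
    show ?thesis
      using K_sector_bound[OF d(1) s(1)] s(2) False by (simp add: T_def) (metis order_refl)
  qed
  have G_disc: "(\<lambda>p. of_real (m (n + p) / m p) * u ^ p) sums G n u" if "cmod u < c" for n u
    using c1(3)[of u n] that c by (simp add: G_def T_def)
  \<comment> \<open>As \<open>T u\<close> varies with \<open>u\<close>, holomorphy cannot be read
    off from the definition of \<open>G\<close>; near a point off the nonnegative axis
    \<open>G n\<close> equals \<open>K n \<tau>\<close> for one fixed admissible
    \<open>\<tau>\<close>.\<close>
  have G_eq: "G n u = K n \<tau> u" if \<tau>: "\<bar>\<tau>\<bar> < \<kappa> * pi / 2" and u: "u \<in> ray_sector \<tau>" "- u \<notin> \<real>\<^sub>\<le>\<^sub>0" for n u \<tau>
  proof (cases "cmod u < c")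
    case True
    then show ?thesis
      using K_eq_disc[OF \<tau> c1(3) u(1)] c by (simp add: G_def T_def)
  next
    case False
    then show ?thesis
      using K_eq_on_ray_sectors[OF dir(1)[OF u(2)] \<tau> dir(2)[OF u(2)] u(1)] by (simp add: G_def T_def)
  qed
  have hol: "G n holomorphic_on ?\<Omega>" for n
  proof -
    have "G n holomorphic_on ball 0 c"
      by (rule power_series_holomorphic[of _ _ "\<lambda>p. of_real (m (n + p) / m p)"]) (use G_disc in auto)
    moreover have "G n holomorphic_on uminus -` (- \<real>\<^sub>\<le>\<^sub>0)"
      unfolding holomorphic_on_def
    proof
      fix u assume u: "u \<in> uminus -` (- \<real>\<^sub>\<le>\<^sub>0 :: complex set)"
      let ?W = "ray_sector (dir u) \<inter> uminus -` (- \<real>\<^sub>\<le>\<^sub>0)"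
      have W: "open ?W" "u \<in> ?W"
        using u dir by (auto intro!: open_Int open_ray_sector open_vimage continuous_intros)
      have "K n (dir u) holomorphic_on ?W"
        using K_holomorphic_ray_sector dir u by (auto intro: holomorphic_on_subset)
      then have "G n holomorphic_on ?W"
        using G_eq dir u by (subst holomorphic_cong[OF refl, of _ _ "K n (dir u)"]) auto
      then show "G n field_differentiable at u within uminus -` (- \<real>\<^sub>\<le>\<^sub>0)"
        using W by (meson field_differentiable_at_within holomorphic_on_imp_differentiable_at)
    qed
    moreover have "open (uminus -` (- \<real>\<^sub>\<le>\<^sub>0 :: complex set))"
      by (intro open_vimage continuous_intros) auto
    ultimately have "G n holomorphic_on ball 0 c \<union> uminus -` (- \<real>\<^sub>\<le>\<^sub>0)"
      by (intro holomorphic_on_Un) auto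
    then show ?thesis
      by (rule holomorphic_on_subset) (use \<Omega> in auto)
  qed
  have bound: "\<exists>C>0. \<exists>B>0. \<forall>n u. cmod u \<le> c / 2 \<or> Re u \<le> cmod u * cos \<eta> \<longrightarrow> cmod (G n u) \<le> C * B ^ n * m n"
    if \<eta>: "0 < \<eta>" "\<eta> < pi / 2" for \<eta>
  proof -
    \<comment> \<open>Bounds for the direction of the ray and for the argument of its image under
      \<open>u\<close> when \<open>- u\<close> has argument at most \<open>pi - \<eta>\<close> in
      modulus; both stay away from the edges of their sectors.\<close>
    have T0: "(pi - \<eta>) * \<kappa> / 2 < \<kappa> * pi / 2" and \<sigma>0: "(pi - \<eta>) * (1 - \<kappa> / 2) < (1 - \<kappa> / 2) * pi"
      using \<eta> omega_pos omega_less_2 by (auto simp: mult.commute)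
    obtain C2 B2 where CB2: "0 < C2" "0 < B2" "\<And>n \<tau> u. \<bar>\<tau>\<bar> \<le> (pi - \<eta>) * \<kappa> / 2 \<Longrightarrow> u \<noteq> 0 \<Longrightarrow>
        \<bar>Arg (- (u * cis \<tau>))\<bar> \<le> (pi - \<eta>) * (1 - \<kappa> / 2) \<Longrightarrow>
        set_integrable lborel {0<..} (kint n \<tau> u) \<and> cmod (K n \<tau> u) \<le> C2 * B2 ^ n * M n"
      by (rule K_sector_bound[OF T0 \<sigma>0]) blast
    obtain c0 b where cb: "0 < c0" "0 < b" "\<And>n. c0 * b ^ n * M n \<le> m n"
      by (rule moment_ge) blast
    define C where "C = max (2 * C1) (C2 / c0)"
    define B where "B = max B1 (B2 / b)"
    have CB: "0 < C" "0 < B" "2 * C1 \<le> C" "C2 / c0 \<le> C" "B1 \<le> B" "B2 / b \<le> B"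
      using CB1 by (auto simp: C_def B_def less_max_iff_disj)
    have "cmod (G n u) \<le> C * B ^ n * m n" if u: "cmod u \<le> c / 2 \<or> Re u \<le> cmod u * cos \<eta>" for n u
    proof (cases "cmod u \<le> c / 2")
      case True
      have "cmod u \<le> 1 / B1 / 2"
        using order_trans[OF True divide_right_mono[OF c(3)]] by simp
      then have u1: "cmod u \<le> 1 / (2 * B1)"
        by (simp add: mult.commute)
      have "cmod (of_real (m (n + p) / m p) * u ^ p) \<le> C1 * B1 ^ n * m n * (1 / 2) ^ p" for p
      proof -
        have "cmod (of_real (m (n + p) / m p) * u ^ p) = m (n + p) / m p * cmod u ^ p"
          using moment_pos[of p] moment_pos[of "n + p"] by (simp add: norm_mult norm_power norm_divide)
        also have "\<dots> \<le> (C1 * B1 ^ n * m n * (B1 ^ p * m p)) / m p * (1 / (2 * B1)) ^ p"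
          using CB1 u1 moment_pos by (intro mult_mono divide_right_mono power_mono) (auto simp: less_imp_le)
        also have "\<dots> = C1 * B1 ^ n * m n * (1 / 2) ^ p"
          using CB1 by (simp add: power_mult_distrib power_divide)
        finally show ?thesis .
      qed
      then have "cmod (\<Sum>p. of_real (m (n + p) / m p) * u ^ p) \<le> (\<Sum>p. C1 * B1 ^ n * m n * (1 / 2) ^ p)"
        by (intro norm_suminf_le summable_mult summable_geometric) auto
      also have "(\<Sum>p. C1 * B1 ^ n * m n * (1 / 2) ^ p) = C1 * B1 ^ n * m n * 2"
        using suminf_mult[OF summable_geometric[of "1 / 2 :: real"]] suminf_geometric[of "1 / 2 :: real"] by simp
      also have "(\<Sum>p. of_real (m (n + p) / m p) * u ^ p) = G n u"
        using G_disc[of u n] True c by (simp add: sums_iff)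
      also have "C1 * B1 ^ n * m n * 2 = (2 * C1) * B1 ^ n * m n"
        by simp
      also have "\<dots> \<le> C * B ^ n * m n"
        using CB CB1 moment_pos[of n] by (intro mult_mono power_mono) auto
      finally show ?thesis .
    next
      case False
      then have u': "Re u \<le> cmod u * cos \<eta>" "u \<noteq> 0"
        using u c by auto
      \<comment> \<open>\<open>Re u \<le> cmod u * cos \<eta>\<close> says that the argument of
        \<open>u\<close> is at least \<open>\<eta>\<close> in modulus; for \<open>- u\<close> this
        means at most \<open>pi - \<eta>\<close>.\<close>
      define x where "x = Arg (- u)"
      have x: "\<bar>x\<bar> \<le> pi - \<eta>"
      proof (rule ccontr)
        assume "\<not> ?thesis"
        then have "cos \<bar>x\<bar> < cos (pi - \<eta>)"
          using \<eta> Arg_bounded[of "- u"] by (intro cos_monotone_0_pi) (auto simp: x_def)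
        moreover have "Re (- u) = cmod u * cos x"
          using rcis_cmod_Arg[of "- u"] by (metis Re_rcis norm_minus_cancel x_def)
        ultimately have "cmod u * cos \<eta> < Re u"
          using u' by (simp add: mult_less_cancel_left_pos) (smt (verit) mult_minus_right mult_strict_left_mono zero_less_norm_iff)
        then show False
          using u' by simp
      qed
      then have nr: "- u \<notin> \<real>\<^sub>\<le>\<^sub>0"
        using u' \<eta> by (auto simp: nonpos_Reals_iff_Arg x_def)
      have 1: "\<bar>dir u\<bar> \<le> (pi - \<eta>) * \<kappa> / 2"
        using x omega_pos by (auto simp: dir_def abs_mult x_def intro!: divide_right_mono mult_right_mono)
      have 2: "\<bar>Arg (- (u * cis (dir u)))\<bar> \<le> (pi - \<eta>) * (1 - \<kappa> / 2)"
        unfolding dir_def Arg_ray_direction[OF u'(2)]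
        using x omega_less_2 by (auto simp: abs_mult x_def intro!: mult_right_mono)
      have "G n u = K n (dir u) u"
        by (rule G_eq[OF dir nr]) (use nr in auto)
      then have "cmod (G n u) \<le> C2 * B2 ^ n * M n"
        using CB2(3)[OF 1 u'(2) 2] by simp
      also have "\<dots> \<le> C2 * B2 ^ n * (m n / (c0 * b ^ n))"
        using cb CB2 by (intro mult_left_mono) (auto simp: pos_le_divide_eq mult_ac)
      also have "\<dots> = (C2 / c0) * (B2 / b) ^ n * m n"
        by (simp add: power_divide)
      also have "\<dots> \<le> C * B ^ n * m n"
        using CB CB2 cb moment_pos[of n] by (intro mult_mono power_mono) auto
      finally show ?thesis .
    qed
    then show ?thesis
      using CB by blast
  qed
  have ray: "ray_integrable (T (z / w) - \<alpha>) (kernel_integrand e E n z w) \<and>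
      ray_integral (T (z / w) - \<alpha>) (kernel_integrand e E n z w) = G n (z / w) / w ^ Suc n"
    if "0 < R" "w = of_real R * cis \<alpha>" "\<not> (Im (z / w) = 0 \<and> c \<le> Re (z / w))" for n z w R \<alpha>
    using K_ray_integral[OF that(1,2), where \<tau> = "T (z / w) - \<alpha>" and n = n and z = z] int[of "z / w" n] that(3)
    by (simp add: G_def)
  show thesis
    by (rule that[of c G T]) (use c hol G_disc bound T ray in auto)
qed

end

subsection \<open>Paths around the slit\<close>

lemma open_log_sector: "open (log_sector d \<theta>)"
  unfolding log_sector_def by (intro open_Collect_less continuous_intros)

lemma hat_open_hat_sector: "hat_open d \<theta> r (hat_sector d \<theta> r)"
proof -
  have "Disc -` hat_sector d \<theta> r = ball 0 r" "Sect -` hat_sector d \<theta> r = log_sector d \<theta>"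
    by (auto simp: hat_sector_def)
  then show ?thesis
    using open_log_sector by (auto simp: hat_open_def hat_sector_def)
qed

lemma hat_holomorphic_consistent:
  "hat_holomorphic d \<theta> r f \<Longrightarrow> \<zeta> \<in> log_sector d \<theta> \<Longrightarrow> cmod (exp \<zeta>) < r \<Longrightarrow> f (Sect \<zeta>) = f (Disc (exp \<zeta>))"
  unfolding hat_holomorphic_def by blast

text \<open>
  The names \<open>Disc\<close> and \<open>Sect\<close> of a point cannot be told apart by open sets, so a map into the
  hat space may switch between them arbitrarily as long as its logarithmic coordinate is
  continuous.
\<close>

lemma continuous_map_hat_topology:
  fixes \<zeta> :: "'a::topological_space \<Rightarrow> complex"
  assumes \<zeta>: "continuous_on X \<zeta>"
    and F: "\<And>x. x \<in> X \<Longrightarrow> F x = Disc (exp (\<zeta> x)) \<and> cmod (exp (\<zeta> x)) < r \<or>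
      F x = Sect (\<zeta> x) \<and> \<zeta> x \<in> log_sector d \<theta>"
  shows "continuous_map (top_of_set X) (subtopology (hat_topology d \<theta> r) (- {Disc 0})) F"
  unfolding continuous_map_in_subtopology
proof
  show "F \<in> topspace (top_of_set X) \<rightarrow> - {Disc 0}"
    using F by fastforce
  show "continuous_map (top_of_set X) (hat_topology d \<theta> r) F"
    unfolding continuous_map
  proof (intro conjI allI impI)
    have "hat_sector d \<theta> r \<subseteq> topspace (hat_topology d \<theta> r)"
      by (intro openin_subset) (simp add: openin_hat_topology hat_open_hat_sector)
    moreover have "F x \<in> hat_sector d \<theta> r" if "x \<in> X" for x
      using F[OF that] by (auto simp: hat_sector_def)
    ultimately show "F ` topspace (top_of_set X) \<subseteq> topspace (hat_topology d \<theta> r)"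
      by auto
  next
    fix U assume "openin (hat_topology d \<theta> r) U"
    then have U: "hat_open d \<theta> r U"
      by (simp add: openin_hat_topology)
    have "{x \<in> X. F x \<in> U} = (X \<inter> \<zeta> -` (Sect -` U)) \<union> (X \<inter> (\<lambda>x. exp (\<zeta> x)) -` (Disc -` U))"
    proof (intro equalityI subsetI)
      fix x assume x: "x \<in> (X \<inter> \<zeta> -` (Sect -` U)) \<union> (X \<inter> (\<lambda>x. exp (\<zeta> x)) -` (Disc -` U))"
      then have "Sect (\<zeta> x) \<in> hat_sector d \<theta> r \<or> Disc (exp (\<zeta> x)) \<in> hat_sector d \<theta> r"
        using U by (auto simp: hat_open_def)
      then have "\<zeta> x \<in> log_sector d \<theta> \<or> cmod (exp (\<zeta> x)) < r"
        by (auto simp: hat_sector_def)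
      moreover have "Sect (\<zeta> x) \<in> U \<longleftrightarrow> Disc (exp (\<zeta> x)) \<in> U"
        if "\<zeta> x \<in> log_sector d \<theta>" "cmod (exp (\<zeta> x)) < r"
        using U that by (simp add: hat_open_def)
      moreover have "\<zeta> x \<in> log_sector d \<theta>" if "Sect (\<zeta> x) \<in> U"
        using U that by (auto simp: hat_open_def hat_sector_def)
      moreover have "cmod (exp (\<zeta> x)) < r" if "Disc (exp (\<zeta> x)) \<in> U"
        using U that by (auto simp: hat_open_def hat_sector_def)
      ultimately show "x \<in> {x \<in> X. F x \<in> U}"
        using x F[of x] by auto
    next
      fix x assume "x \<in> {x \<in> X. F x \<in> U}"
      then show "x \<in> (X \<inter> \<zeta> -` (Sect -` U)) \<union> (X \<inter> (\<lambda>x. exp (\<zeta> x)) -` (Disc -` U))"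
        using F[of x] by auto
    qed
    moreover have "openin (top_of_set X) (X \<inter> \<zeta> -` (Sect -` U))"
      using U by (intro continuous_openin_preimage_gen \<zeta>) (auto simp: hat_open_def)
    moreover have "openin (top_of_set X) (X \<inter> (\<lambda>x. exp (\<zeta> x)) -` (Disc -` U))"
      using U by (intro continuous_openin_preimage_gen continuous_intros \<zeta>) (auto simp: hat_open_def)
    ultimately show "openin (top_of_set X) {x \<in> topspace (top_of_set X). F x \<in> U}"
      by (simp add: openin_Un)
  qed
qed

section \<open>Circles with a bulge and their lifts to the hat space\<close>

definition bump :: "real \<Rightarrow> real \<Rightarrow> real" where
  "bump \<delta> a = (max 0 (cos a - cos \<delta>))\<^sup>2"

definition keyhole_radius :: "real \<Rightarrow> real \<Rightarrow> real \<Rightarrow> real \<Rightarrow> real" where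
  "keyhole_radius \<rho> \<delta> K t = \<rho> + K * bump \<delta> (pi * (2 * t - 1))"

text \<open>
  The circle of radius \<open>\<rho>\<close>, bulging outwards in directions closer than \<open>\<delta>\<close> to \<open>y\<close>. The bulge keeps
  the path away from the segment joining \<open>0\<close> to a far away point with argument \<open>y\<close>. Squaring in
  \<^const>\<open>bump\<close> makes the path continuously differentiable.
\<close>

definition keyhole :: "real \<Rightarrow> real \<Rightarrow> real \<Rightarrow> real \<Rightarrow> real \<Rightarrow> complex" where
  "keyhole \<rho> \<delta> K y t = of_real (keyhole_radius \<rho> \<delta> K t) * cis (y + pi * (2 * t - 1))"

definition keyhole_log :: "real \<Rightarrow> real \<Rightarrow> real \<Rightarrow> real \<Rightarrow> real \<Rightarrow> complex" where
  "keyhole_log \<rho> \<delta> K y t = Complex (ln (keyhole_radius \<rho> \<delta> K t)) (y + pi * (2 * t - 1))"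

text \<open>Off the bulge the argument may leave the sector, but the point lies on the circle of
  radius \<open>\<rho>\<close> and is named as a point of the disc. The bulge may leave the disc,
  but its directions stay in the sector, and the logarithmic name is used.\<close>

definition keyhole_lift :: "real \<Rightarrow> real \<Rightarrow> real \<Rightarrow> real \<Rightarrow> real \<Rightarrow> hat_point" where
  "keyhole_lift \<rho> \<delta> K y t =
    (if K * bump \<delta> (pi * (2 * t - 1)) = 0 then Disc (keyhole \<rho> \<delta> K y t)
     else Sect (keyhole_log \<rho> \<delta> K y t))"

lemma bump_nonneg: "0 \<le> bump \<delta> a"
  by (simp add: bump_def)

lemma bump_le: "bump \<delta> a \<le> 4"
proof -
  have "cos a - cos \<delta> \<le> 2"
    using cos_le_one[of a] cos_ge_minus_one[of \<delta>] by linarith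
  then have "max 0 (cos a - cos \<delta>) \<le> 2"
    by simp
  then have "(max 0 (cos a - cos \<delta>))\<^sup>2 \<le> 2\<^sup>2"
    by (intro power_mono) auto
  then show ?thesis
    by (simp add: bump_def)
qed

text \<open>Directions are compared through their cosines throughout, which spares the reduction of
  angles modulo \<open>2 * pi\<close>.\<close>

lemma bump_mono: "cos a \<le> cos b \<Longrightarrow> bump \<delta> a \<le> bump \<delta> b"
  unfolding bump_def by (intro power_mono) auto

lemma bump_nonzero_imp:
  assumes "bump \<delta> a \<noteq> 0" "\<bar>a\<bar> \<le> pi" "0 \<le> \<delta>"
  shows "\<bar>a\<bar> < \<delta>"
proof (rule ccontr)
  assume "\<not> \<bar>a\<bar> < \<delta>"
  then have "cos \<bar>a\<bar> \<le> cos \<delta>"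
    using assms by (intro cos_monotone_0_pi_le) auto
  then show False
    using assms(1) by (simp add: bump_def)
qed

lemma keyhole_radius_ge: "0 \<le> K \<Longrightarrow> \<rho> \<le> keyhole_radius \<rho> \<delta> K t"
  by (simp add: keyhole_radius_def bump_nonneg)

lemma keyhole_radius_le: "0 \<le> K \<Longrightarrow> keyhole_radius \<rho> \<delta> K t \<le> \<rho> + 4 * K"
  using mult_left_mono[OF bump_le[of \<delta> "pi * (2 * t - 1)"], of K] by (simp add: keyhole_radius_def)

lemma norm_keyhole: "0 < \<rho> \<Longrightarrow> 0 \<le> K \<Longrightarrow> cmod (keyhole \<rho> \<delta> K y t) = keyhole_radius \<rho> \<delta> K t"
  using keyhole_radius_ge[of K \<rho> \<delta> t] by (simp add: keyhole_def norm_mult)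

lemma exp_keyhole_log: "0 < \<rho> \<Longrightarrow> 0 \<le> K \<Longrightarrow> exp (keyhole_log \<rho> \<delta> K y t) = keyhole \<rho> \<delta> K y t"
  using keyhole_radius_ge[of K \<rho> \<delta> t]
  by (simp add: keyhole_def keyhole_log_def exp_eq_polar exp_of_real)

lemma proj_keyhole_lift: "0 < \<rho> \<Longrightarrow> 0 \<le> K \<Longrightarrow> proj (keyhole_lift \<rho> \<delta> K y t) = keyhole \<rho> \<delta> K y t"
  by (simp add: keyhole_lift_def exp_keyhole_log)

lemma keyhole_0_eq_circlepath: "keyhole \<rho> \<delta> 0 pi = circlepath 0 \<rho>"
  by (auto simp: keyhole_def keyhole_radius_def circlepath cis_conv_exp algebra_simps)

lemma keyhole_closed: "0 \<le> \<delta> \<Longrightarrow> \<delta> \<le> pi \<Longrightarrow> keyhole \<rho> \<delta> K y 1 = keyhole \<rho> \<delta> K y 0"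
  and keyhole_lift_closed: "0 \<le> \<delta> \<Longrightarrow> \<delta> \<le> pi \<Longrightarrow> keyhole_lift \<rho> \<delta> K y 1 = keyhole_lift \<rho> \<delta> K y 0"
proof -
  assume \<delta>: "0 \<le> \<delta>" "\<delta> \<le> pi"
  have b: "bump \<delta> pi = 0" "bump \<delta> (- pi) = 0"
    using \<delta> cos_ge_minus_one[of \<delta>] by (auto simp: bump_def)
  have "cis (y + pi) = cis (y - pi)"
    by (simp add: complex_eq_iff)
  then show "keyhole \<rho> \<delta> K y 1 = keyhole \<rho> \<delta> K y 0"
    using b by (simp add: keyhole_def keyhole_radius_def)
  then show "keyhole_lift \<rho> \<delta> K y 1 = keyhole_lift \<rho> \<delta> K y 0"
    using b by (simp add: keyhole_lift_def)
qed

lemma has_real_derivative_max_0_power2: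
  "((\<lambda>x :: real. (max 0 x)\<^sup>2) has_real_derivative 2 * max 0 x) (at x)"
proof -
  consider "x < 0" | "x = 0" | "0 < x"
    by linarith
  then show ?thesis
  proof cases
    case 1
    have "((\<lambda>x. 0) has_real_derivative 2 * max 0 x) (at x)"
      using 1 by simp
    then show ?thesis
      by (rule has_field_derivative_transform_within_open[of _ _ _ "{..<0}"]) (use 1 in auto)
  next
    case 2
    have "((\<lambda>h :: real. (max 0 h)\<^sup>2 / h) \<longlongrightarrow> 0) (at 0)"
    proof (rule Lim_null_comparison)
      show "\<forall>\<^sub>F h in at 0. norm ((max 0 h)\<^sup>2 / h) \<le> \<bar>h :: real\<bar>"
        by (intro always_eventually allI) (auto simp: max_def power2_eq_square)
      show "(abs \<longlongrightarrow> (0 :: real)) (at 0)"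
        by (rule tendsto_rabs_zero) (rule tendsto_ident_at)
    qed
    then show ?thesis
      using 2 by (simp add: has_field_derivative_iff)
  next
    case 3
    have "((\<lambda>x. x\<^sup>2) has_real_derivative 2 * max 0 x) (at x)"
      using 3 by (auto intro!: derivative_eq_intros)
    then show ?thesis
      by (rule has_field_derivative_transform_within_open[of _ _ _ "{0<..}"]) (use 3 in auto)
  qed
qed

definition keyhole_deriv :: "real \<Rightarrow> real \<Rightarrow> real \<Rightarrow> real \<Rightarrow> real \<Rightarrow> complex" where
  "keyhole_deriv \<rho> \<delta> K y t =
    of_real (K * (2 * max 0 (cos (pi * (2 * t - 1)) - cos \<delta>) * (- sin (pi * (2 * t - 1)) * (2 * pi)))) *
      cis (y + pi * (2 * t - 1)) +
    of_real (keyhole_radius \<rho> \<delta> K t) * (of_real (2 * pi) * \<i> * cis (y + pi * (2 * t - 1)))"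

lemma has_vector_derivative_keyhole:
  "(keyhole \<rho> \<delta> K y has_vector_derivative keyhole_deriv \<rho> \<delta> K y t) (at t)"
proof -
  have a: "((\<lambda>t. pi * (2 * t - 1)) has_real_derivative 2 * pi) (at t)"
    by (auto intro!: derivative_eq_intros)
  have c: "((\<lambda>t. cos (pi * (2 * t - 1)) - cos \<delta>) has_real_derivative - sin (pi * (2 * t - 1)) * (2 * pi)) (at t)"
    by (auto intro!: derivative_eq_intros)
  have "((\<lambda>t. keyhole_radius \<rho> \<delta> K t) has_real_derivative
      K * (2 * max 0 (cos (pi * (2 * t - 1)) - cos \<delta>) * (- sin (pi * (2 * t - 1)) * (2 * pi)))) (at t)"
    unfolding keyhole_radius_def bump_def
    using DERIV_add[OF DERIV_const[of \<rho>] DERIV_cmult[OF DERIV_chain2[OF has_real_derivative_max_0_power2 c], of K]]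
    by simp
  then have r: "((\<lambda>t. complex_of_real (keyhole_radius \<rho> \<delta> K t)) has_vector_derivative
      of_real (K * (2 * max 0 (cos (pi * (2 * t - 1)) - cos \<delta>) * (- sin (pi * (2 * t - 1)) * (2 * pi))))) (at t)"
    by (intro has_vector_derivative_of_real) (simp add: has_real_derivative_iff_has_vector_derivative)
  have "((\<lambda>z. exp (\<i> * (of_real y + of_real pi * (2 * z - 1)))) has_field_derivative
      exp (\<i> * (of_real y + of_real pi * (2 * of_real t - 1))) * (\<i> * (of_real pi * 2))) (at (of_real t))"
    by (auto intro!: derivative_eq_intros)
  from has_vector_derivative_real_field[OF this]
  have "((\<lambda>t. cis (y + pi * (2 * t - 1))) has_vector_derivative
      of_real (2 * pi) * \<i> * cis (y + pi * (2 * t - 1))) (at t)"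
    by (simp add: cis_conv_exp mult_ac)
  from has_vector_derivative_mult[OF r this] show ?thesis
    by (simp add: keyhole_def[abs_def] keyhole_deriv_def add.commute)
qed

lemma C1_path_keyhole: "C1_path (keyhole \<rho> \<delta> K y)"
  unfolding C1_path_def
proof (intro exI[of _ "keyhole_deriv \<rho> \<delta> K y"] conjI allI has_vector_derivative_keyhole)
  show "continuous_on UNIV (keyhole_deriv \<rho> \<delta> K y)"
    unfolding keyhole_deriv_def keyhole_radius_def bump_def by (intro continuous_intros)
qed

text \<open>The change of the radius contributes at most \<open>8 * pi * K\<close>, the rotation at
  most \<open>2 * pi * (\<rho> + 4 * K)\<close>. What matters is that the bound is linear in
  \<open>K\<close>, which will be proportional to \<open>cmod z\<close>.\<close>

lemma norm_keyhole_deriv: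
  assumes "0 < \<rho>" "0 \<le> K"
  shows "cmod (keyhole_deriv \<rho> \<delta> K y t) \<le> 2 * pi * \<rho> + 16 * pi * K"
proof -
  let ?a = "pi * (2 * t - 1)"
  have "\<bar>K * (2 * max 0 (cos ?a - cos \<delta>) * (- sin ?a * (2 * pi)))\<bar> =
      K * (2 * max 0 (cos ?a - cos \<delta>)) * (\<bar>sin ?a\<bar> * (2 * pi))"
    using assms by (simp add: abs_mult)
  also have "\<dots> \<le> K * (2 * 2) * (1 * (2 * pi))"
  proof -
    have "cos ?a - cos \<delta> \<le> 2"
      using cos_le_one[of ?a] cos_ge_minus_one[of \<delta>] by linarith
    then show ?thesis
      using assms by (intro mult_mono) auto
  qed
  finally have 1: "\<bar>K * (2 * max 0 (cos ?a - cos \<delta>) * (- sin ?a * (2 * pi)))\<bar> \<le> 8 * pi * K"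
    by (simp add: mult_ac)
  have 2: "\<bar>keyhole_radius \<rho> \<delta> K t\<bar> * (2 * pi) \<le> (\<rho> + 4 * K) * (2 * pi)"
    using assms keyhole_radius_ge[of K \<rho> \<delta> t] keyhole_radius_le[of K \<rho> \<delta> t]
    by (intro mult_right_mono) auto
  have "cmod (keyhole_deriv \<rho> \<delta> K y t) \<le>
      \<bar>K * (2 * max 0 (cos ?a - cos \<delta>) * (- sin ?a * (2 * pi)))\<bar> + \<bar>keyhole_radius \<rho> \<delta> K t\<bar> * (2 * pi)"
    unfolding keyhole_deriv_def
    by (rule order_trans[OF norm_triangle_ineq])
      (simp only: norm_mult norm_of_real norm_cis norm_ii mult_1_right abs_mult abs_of_pos[OF pi_gt_zero] order_refl abs_numeral)
  with 1 2 show ?thesis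
    by (simp add: algebra_simps)
qed

text \<open>The homotopy interpolates the parameters \<open>K\<close> and \<open>y\<close>, not the
  points, so every intermediate loop is again a keyhole and can be kept off the slit by the same
  criterion.\<close>

lemma keyhole_homotopic_loops:
  assumes \<delta>: "0 \<le> \<delta>" "\<delta> \<le> pi"
    and S: "\<And>s t. s \<in> {0..1} \<Longrightarrow> t \<in> {0..1} \<Longrightarrow>
      keyhole \<rho> \<delta> ((1 - s) * K + s * K') ((1 - s) * y + s * y') t \<in> S"
  shows "homotopic_loops S (keyhole \<rho> \<delta> K y) (keyhole \<rho> \<delta> K' y')"
  unfolding homotopic_loops
proof (intro exI conjI)
  let ?h = "\<lambda>(s, t). keyhole \<rho> \<delta> ((1 - s) * K + s * K') ((1 - s) * y + s * y') t"
  show "continuous_on ({0..1} \<times> {0..1}) ?h"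
    unfolding split_beta keyhole_def keyhole_radius_def bump_def by (intro continuous_intros)
  show "\<forall>t\<in>{0..1}. pathfinish (?h \<circ> Pair t) = pathstart (?h \<circ> Pair t)"
    using keyhole_closed[OF \<delta>] by (simp add: pathfinish_def pathstart_def)
qed (use S in auto)

text \<open>Two homotopies are joined: inside the disc, radius and starting angle of the circle move
  from \<open>\<rho>'\<close> and 0 to \<open>\<rho>\<close> and \<open>y - pi\<close>; after that
  the bulge grows from 0 to \<open>K\<close>. Both are continuous in the logarithmic coordinate, as
  \<open>continuous_map_hat_topology\<close> requires.\<close>

lemma keyhole_lift_deformation:
  assumes \<rho>: "0 < \<rho>" "\<rho> < r" and \<rho>': "0 < \<rho>'" "\<rho>' < r" and K: "0 \<le> K" and \<delta>: "0 \<le> \<delta>" "\<delta> \<le> pi"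
    and y: "K = 0 \<or> \<bar>y - d\<bar> + \<delta> \<le> \<theta> / 2"
  shows "deformation_of_circle d \<theta> r \<rho>' (keyhole_lift \<rho> \<delta> K y)"
  unfolding deformation_of_circle_def
proof (rule homotopic_with_trans)
  let ?X = "{0..1 :: real} \<times> {0..1 :: real}"
  let ?Y = "subtopology (hat_topology d \<theta> r) (- {Disc 0})"
  show "homotopic_with (\<lambda>p. p 1 = p 0) (top_of_set {0..1}) ?Y
      (\<lambda>t. Disc (complex_of_real \<rho>' * cis (2 * pi * t))) (keyhole_lift \<rho> \<delta> 0 y)"
    unfolding homotopic_with_def
  proof (intro exI conjI allI ballI)
    let ?R = "\<lambda>s. (1 - s) * \<rho>' + s * \<rho>"
    let ?A = "\<lambda>s t. 2 * pi * t + s * (y - pi)"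
    let ?h = "\<lambda>(s, t). Disc (complex_of_real (?R s) * cis (?A s t))"
    have R: "0 < ?R s" "?R s < r" if "s \<in> {0..1}" for s
    proof -
      show "0 < ?R s"
        using that \<rho> \<rho>' by (cases "s = 0") (auto intro: add_nonneg_pos)
      have "?R s \<le> max \<rho> \<rho>'"
        using that convex_bound_le[of \<rho>' "max \<rho> \<rho>'" \<rho> "1 - s" s] by auto
      then show "?R s < r"
        using \<rho> \<rho>' by auto
    qed
    have e: "exp (Complex (ln (?R s)) (?A s t)) = complex_of_real (?R s) * cis (?A s t)"
      if "s \<in> {0..1}" for s t
      using R(1)[OF that] by (simp add: exp_eq_polar exp_of_real)
    have "continuous_map (top_of_set ?X) ?Y ?h"
    proof (rule continuous_map_hat_topology[where \<zeta> = "\<lambda>(s, t). Complex (ln (?R s)) (?A s t)"])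
      show "continuous_on ?X (\<lambda>(s, t). Complex (ln (?R s)) (?A s t))"
        unfolding split_beta Complex_eq
      proof (intro continuous_intros ballI)
        show "?R (fst p) \<noteq> 0" if "p \<in> ?X" for p
          using R(1)[of "fst p"] that by (auto simp: mem_Times_iff)
      qed
      fix p assume "p \<in> ?X"
      then obtain s t where p: "p = (s, t)" "s \<in> {0..1}"
        by auto
      show "?h p = Disc (exp ((\<lambda>(s, t). Complex (ln (?R s)) (?A s t)) p)) \<and>
          cmod (exp ((\<lambda>(s, t). Complex (ln (?R s)) (?A s t)) p)) < r \<or>
          ?h p = Sect ((\<lambda>(s, t). Complex (ln (?R s)) (?A s t)) p) \<and>
          (\<lambda>(s, t). Complex (ln (?R s)) (?A s t)) p \<in> log_sector d \<theta>"
        using R[OF p(2)] unfolding p(1) prod.case e[OF p(2)] norm_mult norm_of_real norm_cis by simp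
    qed
    then show "continuous_map (prod_topology (top_of_set {0..1}) (top_of_set {0..1})) ?Y ?h"
      by simp
    fix t s :: real
    show "?h (0, t) = Disc (complex_of_real \<rho>' * cis (2 * pi * t))"
      by simp
    show "?h (1, t) = keyhole_lift \<rho> \<delta> 0 y t"
      by (simp add: keyhole_lift_def keyhole_def keyhole_radius_def algebra_simps)
    have "cis (2 * pi * 1 + s * (y - pi)) = cis (2 * pi * 0 + s * (y - pi))"
      by (subst add.commute) (simp flip: cis_mult)
    then show "?h (s, 1) = ?h (s, 0)"
      by (simp only: prod.case)
  qed
  show "homotopic_with (\<lambda>p. p 1 = p 0) (top_of_set {0..1}) ?Y (keyhole_lift \<rho> \<delta> 0 y) (keyhole_lift \<rho> \<delta> K y)"
    unfolding homotopic_with_def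
  proof (intro exI conjI allI ballI)
    let ?h = "\<lambda>(s, t). keyhole_lift \<rho> \<delta> (s * K) y t"
    have "continuous_map (top_of_set ?X) ?Y ?h"
    proof (rule continuous_map_hat_topology[where \<zeta> = "\<lambda>(s, t). keyhole_log \<rho> \<delta> (s * K) y t"])
      show "continuous_on ?X (\<lambda>(s, t). keyhole_log \<rho> \<delta> (s * K) y t)"
        unfolding split_beta Complex_eq keyhole_log_def
      proof (intro continuous_intros ballI)
        show "continuous_on ?X (\<lambda>p. keyhole_radius \<rho> \<delta> (fst p * K) (snd p))"
          unfolding keyhole_radius_def bump_def by (intro continuous_intros)
        show "keyhole_radius \<rho> \<delta> (fst p * K) (snd p) \<noteq> 0" if "p \<in> ?X" for p
          using keyhole_radius_ge[of "fst p * K" \<rho> \<delta> "snd p"] \<rho> K that by (auto simp: mem_Times_iff)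
      qed
      fix p assume "p \<in> ?X"
      then obtain s t where p: "p = (s, t)" "0 \<le> s" "s \<le> 1" "0 \<le> t" "t \<le> 1"
        by auto
      have sK: "0 \<le> s * K"
        using p K by simp
      show "?h p = Disc (exp ((\<lambda>(s, t). keyhole_log \<rho> \<delta> (s * K) y t) p)) \<and>
          cmod (exp ((\<lambda>(s, t). keyhole_log \<rho> \<delta> (s * K) y t) p)) < r \<or>
          ?h p = Sect ((\<lambda>(s, t). keyhole_log \<rho> \<delta> (s * K) y t) p) \<and>
          (\<lambda>(s, t). keyhole_log \<rho> \<delta> (s * K) y t) p \<in> log_sector d \<theta>"
        unfolding p(1) prod.case exp_keyhole_log[OF \<rho>(1) sK]
      proof (cases "s * K * bump \<delta> (pi * (2 * t - 1)) = 0")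
        case True
        then have "cmod (keyhole \<rho> \<delta> (s * K) y t) = \<rho>"
          using \<rho> sK by (simp only: norm_keyhole) (simp add: keyhole_radius_def)
        then show "keyhole_lift \<rho> \<delta> (s * K) y t = Disc (keyhole \<rho> \<delta> (s * K) y t) \<and>
            cmod (keyhole \<rho> \<delta> (s * K) y t) < r \<or>
            keyhole_lift \<rho> \<delta> (s * K) y t = Sect (keyhole_log \<rho> \<delta> (s * K) y t) \<and>
            keyhole_log \<rho> \<delta> (s * K) y t \<in> log_sector d \<theta>"
          using True \<rho> by (simp add: keyhole_lift_def)
      next
        case False
        have "\<bar>pi * (2 * t - 1)\<bar> \<le> pi * 1"
          unfolding abs_mult using p by (intro mult_mono) auto
        then have "\<bar>pi * (2 * t - 1)\<bar> < \<delta>"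
          using False \<delta> by (intro bump_nonzero_imp) auto
        moreover have "\<bar>y - d\<bar> + \<delta> \<le> \<theta> / 2"
          using y False by auto
        ultimately have "\<bar>y + pi * (2 * t - 1) - d\<bar> < \<theta> / 2"
          by linarith
        then show "keyhole_lift \<rho> \<delta> (s * K) y t = Disc (keyhole \<rho> \<delta> (s * K) y t) \<and>
            cmod (keyhole \<rho> \<delta> (s * K) y t) < r \<or>
            keyhole_lift \<rho> \<delta> (s * K) y t = Sect (keyhole_log \<rho> \<delta> (s * K) y t) \<and>
            keyhole_log \<rho> \<delta> (s * K) y t \<in> log_sector d \<theta>"
          unfolding keyhole_log_def log_sector_def mem_Collect_eq complex.sel
          using False by (simp only: keyhole_lift_def keyhole_log_def if_False simp_thms)
      qed
    qed
    then show "continuous_map (prod_topology (top_of_set {0..1}) (top_of_set {0..1})) ?Y ?h"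
      by simp
    fix t s :: real
    show "?h (0, t) = keyhole_lift \<rho> \<delta> 0 y t" "?h (1, t) = keyhole_lift \<rho> \<delta> K y t"
      by simp_all
    show "?h (s, 1) = ?h (s, 0)"
      using keyhole_lift_closed[OF \<delta>] by simp
  qed
qed

text \<open>For \<open>\<eta>\<close> between 0 and \<open>pi\<close>, the nonzero points whose
  argument is closer than \<open>\<eta>\<close> to \<open>y\<close> modulo \<open>2 * pi\<close>.
  Written without \<open>Arg\<close>, so that no branch cut interferes and openness is
  immediate.\<close>

definition direction_cone :: "real \<Rightarrow> real \<Rightarrow> complex set" where
  "direction_cone y \<eta> = {w. cmod w * cos \<eta> < Re (w * cis (- y))}"

text \<open>
  A function on the hat space, read off in the plane on the union of the disc and of a sector of
  opening less than \<open>pi\<close> around the direction \<open>y\<close>.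
\<close>

definition planar :: "real \<Rightarrow> real \<Rightarrow> (hat_point \<Rightarrow> 'a) \<Rightarrow> complex \<Rightarrow> 'a" where
  "planar r y \<phi> w = (if cmod w < r then \<phi> (Disc w) else \<phi> (Sect (Ln (w * cis (- y)) + \<i> * of_real y)))"

lemma open_direction_cone: "open (direction_cone y \<eta>)"
  unfolding direction_cone_def by (intro open_Collect_less continuous_intros)

lemma direction_cone_rcis:
  assumes "\<bar>a\<bar> < \<eta>" "\<eta> \<le> pi" "0 < R"
  shows "of_real R * cis (y + a) \<in> direction_cone y \<eta>"
proof -
  have "cos \<eta> < cos \<bar>a\<bar>"
    using assms by (intro cos_monotone_0_pi) auto
  moreover have "of_real R * cis (y + a) * cis (- y) = of_real R * cis a"
    by (simp add: mult.assoc cis_mult)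
  then have "Re (of_real R * cis (y + a) * cis (- y)) = R * cos a"
    by (simp only:) simp
  ultimately show ?thesis
    unfolding direction_cone_def mem_Collect_eq norm_mult using assms(3) by (simp only:) simp
qed

lemma mem_direction_cone_imp:
  assumes "w \<in> direction_cone y \<eta>" "0 \<le> \<eta>" "\<eta> \<le> pi / 2"
  shows "w * cis (- y) \<notin> \<real>\<^sub>\<le>\<^sub>0" "\<bar>Im (Ln (w * cis (- y)))\<bar> < \<eta>"
    and "exp (Ln (w * cis (- y)) + \<i> * of_real y) = w"
proof -
  let ?v = "w * cis (- y)"
  have v: "cmod ?v * cos \<eta> < Re ?v"
    using assms(1) by (simp add: direction_cone_def norm_mult)
  moreover have "0 \<le> cmod ?v * cos \<eta>"
    using assms by (intro mult_nonneg_nonneg cos_ge_zero) auto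
  ultimately have "0 < Re ?v"
    by linarith
  then show nr: "?v \<notin> \<real>\<^sub>\<le>\<^sub>0"
    by (auto simp: complex_nonpos_Reals_iff)
  then have v0: "?v \<noteq> 0"
    by auto
  have "Re ?v = cmod ?v * cos (Arg ?v)"
    using rcis_cmod_Arg[of ?v] by (metis Re_rcis)
  then have "cos \<eta> < cos \<bar>Arg ?v\<bar>"
    using v v0 by (simp add: mult_less_cancel_left_pos)
  moreover have "\<bar>Arg ?v\<bar> \<le> pi"
    using Arg_bounded[of ?v] by (auto simp: abs_le_iff)
  ultimately have "\<bar>Arg ?v\<bar> < \<eta>"
    using assms(2) cos_monotone_0_pi_le[of \<eta> "\<bar>Arg ?v\<bar>"] by linarith
  then show "\<bar>Im (Ln ?v)\<bar> < \<eta>"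
    using v0 by (simp add: Arg_eq_Im_Ln)
  have "exp (Ln ?v + \<i> * of_real y) = ?v * cis y"
    using v0 by (simp add: exp_add cis_conv_exp)
  then show "exp (Ln ?v + \<i> * of_real y) = w"
    by (simp add: mult.assoc cis_mult)
qed

lemma planar_holomorphic_disc:
  "hat_holomorphic d \<theta> r \<phi> \<Longrightarrow> vec_holomorphic_on (planar r y \<phi>) (ball 0 r)"
  by (rule vec_holomorphic_on_transform[of "\<lambda>w. \<phi> (Disc w)"]) (auto simp: hat_holomorphic_def planar_def)

text \<open>On the overlap of disc and cone the two names of a point have the same value, so on the
  whole cone \<open>planar\<close> is \<open>\<phi>\<close> composed with a branch of the
  logarithm.\<close>

lemma planar_holomorphic:
  assumes \<phi>: "hat_holomorphic d \<theta> r \<phi>" and \<eta>: "0 \<le> \<eta>" "\<eta> \<le> pi / 2" and y: "\<bar>y - d\<bar> + \<eta> \<le> \<theta> / 2"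
  shows "vec_holomorphic_on (planar r y \<phi>) (ball 0 r \<union> direction_cone y \<eta>)"
proof (rule vec_holomorphic_on_Un[OF _ _ open_ball open_direction_cone])
  show "vec_holomorphic_on (planar r y \<phi>) (ball 0 r)"
    by (rule planar_holomorphic_disc[OF \<phi>])
  let ?l = "\<lambda>w. Ln (w * cis (- y)) + \<i> * of_real y"
  have sub: "?l ` direction_cone y \<eta> \<subseteq> log_sector d \<theta>"
  proof safe
    fix w assume "w \<in> direction_cone y \<eta>"
    then have "\<bar>Im (Ln (w * cis (- y)))\<bar> < \<eta>"
      by (rule mem_direction_cone_imp(2)[OF _ \<eta>])
    moreover have "Im (?l w) = Im (Ln (w * cis (- y))) + y"
      by simp
    ultimately have "\<bar>Im (?l w) - d\<bar> < \<theta> / 2"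
      using y by linarith
    then show "?l w \<in> log_sector d \<theta>"
      by (simp only: log_sector_def mem_Collect_eq)
  qed
  show "vec_holomorphic_on (planar r y \<phi>) (direction_cone y \<eta>)"
  proof (rule vec_holomorphic_on_transform[of "\<lambda>w. \<phi> (Sect (?l w))"])
    have "?l holomorphic_on direction_cone y \<eta>"
      using mem_direction_cone_imp(1)[OF _ \<eta>] by (intro holomorphic_intros) auto
    then show "vec_holomorphic_on (\<lambda>w. \<phi> (Sect (?l w))) (direction_cone y \<eta>)"
      by (rule vec_holomorphic_on_compose[where g = "\<lambda>\<zeta>. \<phi> (Sect \<zeta>)", OF _ _ sub])
        (use \<phi> in \<open>simp add: hat_holomorphic_def\<close>)
    show "\<phi> (Sect (?l w)) = planar r y \<phi> w" if w: "w \<in> direction_cone y \<eta>" for w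
    proof (cases "cmod w < r")
      case True
      have "?l w \<in> log_sector d \<theta>"
        using sub w by auto
      then have "\<phi> (Sect (?l w)) = \<phi> (Disc w)"
        using hat_holomorphic_consistent[OF \<phi>, of "?l w"] True mem_direction_cone_imp(3)[OF w \<eta>] by (simp only:)
      then show ?thesis
        using True by (simp add: planar_def)
    qed (simp add: planar_def)
  qed
qed

text \<open>The keyhole bulges in direction \<open>y'\<close> while the planar reading is taken
  around \<open>y\<close>: to compare the paths of neighbouring points, one planar function must
  serve both. Hence the cone is opened wider than the bulge.\<close>

lemma keyhole_mem_planar_domain:
  assumes \<rho>: "0 < \<rho>" "\<rho> < r" and K: "0 \<le> K" and \<delta>: "0 \<le> \<delta>" and t: "t \<in> {0..1}"
    and y: "K = 0 \<or> \<bar>y' - y\<bar> + \<delta> \<le> \<eta>" and \<eta>: "\<eta> \<le> pi / 2"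
  shows "keyhole \<rho> \<delta> K y' t \<in> ball 0 r \<union> direction_cone y \<eta>"
    and "hat_holomorphic d \<theta> r \<phi> \<Longrightarrow> K = 0 \<or> \<bar>y - d\<bar> + \<eta> \<le> \<theta> / 2 \<Longrightarrow>
      \<phi> (keyhole_lift \<rho> \<delta> K y' t) = planar r y \<phi> (keyhole \<rho> \<delta> K y' t)"
proof -
  let ?a = "pi * (2 * t - 1)"
  have "(keyhole \<rho> \<delta> K y' t \<in> ball 0 r \<union> direction_cone y \<eta>) \<and>
    (hat_holomorphic d \<theta> r \<phi> \<and> (K = 0 \<or> \<bar>y - d\<bar> + \<eta> \<le> \<theta> / 2) \<longrightarrow>
      \<phi> (keyhole_lift \<rho> \<delta> K y' t) = planar r y \<phi> (keyhole \<rho> \<delta> K y' t))"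
  proof (cases "K * bump \<delta> ?a = 0")
    case True
    then have "cmod (keyhole \<rho> \<delta> K y' t) = \<rho>"
      using \<rho> K by (simp only: norm_keyhole) (simp add: keyhole_radius_def)
    then show ?thesis
      using True \<rho> by (simp add: keyhole_lift_def planar_def)
  next
    case False
    have "\<bar>?a\<bar> \<le> pi * 1"
      unfolding abs_mult using t by (intro mult_mono) auto
    then have a: "\<bar>?a\<bar> < \<delta>"
      using False \<delta> by (intro bump_nonzero_imp) auto
    define b where "b = y' - y + ?a"
    have b: "\<bar>b\<bar> < \<eta>" "y' + ?a = y + b"
      using a y False by (auto simp: b_def)
    define R where "R = keyhole_radius \<rho> \<delta> K t"
    have R: "0 < R"
      using keyhole_radius_ge[OF K, of \<rho> \<delta> t] \<rho> by (simp add: R_def)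
    have w: "keyhole \<rho> \<delta> K y' t = of_real R * cis (y + b)"
      by (simp add: keyhole_def R_def b(2))
    have "\<bar>b\<bar> < pi"
      using b(1) \<eta> pi_gt_zero by linarith
    have "Ln (of_real R * cis (y + b) * cis (- y)) = Ln (exp (Complex (ln R) b))"
      using R by (simp add: mult.assoc cis_mult exp_eq_polar exp_of_real)
    also have "\<dots> = Complex (ln R) b"
      using \<open>\<bar>b\<bar> < pi\<close> by (intro Ln_exp) auto
    finally have l: "Ln (of_real R * cis (y + b) * cis (- y)) + \<i> * of_real y = keyhole_log \<rho> \<delta> K y' t"
      by (simp add: keyhole_log_def R_def complex_eq_iff b(2))
    have *: "\<phi> (keyhole_lift \<rho> \<delta> K y' t) = planar r y \<phi> (keyhole \<rho> \<delta> K y' t)"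
      if \<phi>: "hat_holomorphic d \<theta> r \<phi>" and yd: "K = 0 \<or> \<bar>y - d\<bar> + \<eta> \<le> \<theta> / 2"
    proof (cases "cmod (keyhole \<rho> \<delta> K y' t) < r")
      case True
      have "keyhole_log \<rho> \<delta> K y' t \<in> log_sector d \<theta>"
      proof -
        have "\<bar>y - d\<bar> + \<eta> \<le> \<theta> / 2"
          using yd False by auto
        then have "\<bar>y' + ?a - d\<bar> < \<theta> / 2"
          using b by linarith
        then show ?thesis
          by (simp only: keyhole_log_def log_sector_def mem_Collect_eq complex.sel)
      qed
      moreover have "cmod (exp (keyhole_log \<rho> \<delta> K y' t)) < r"
        using True by (simp only: exp_keyhole_log[OF \<rho>(1) K])
      ultimately have "\<phi> (Sect (keyhole_log \<rho> \<delta> K y' t)) = \<phi> (Disc (exp (keyhole_log \<rho> \<delta> K y' t)))"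
        by (rule hat_holomorphic_consistent[OF \<phi>])
      then show ?thesis
        using True False exp_keyhole_log[OF \<rho>(1) K, of \<delta> y' t] by (simp add: planar_def keyhole_lift_def)
    next
      case 2: False
      then show ?thesis
        using False l w by (simp add: planar_def keyhole_lift_def)
    qed
    show ?thesis
      using * direction_cone_rcis[OF b(1) _ R, of y] \<eta> w pi_gt_zero by simp
  qed
  then show "keyhole \<rho> \<delta> K y' t \<in> ball 0 r \<union> direction_cone y \<eta>"
    and "hat_holomorphic d \<theta> r \<phi> \<Longrightarrow> K = 0 \<or> \<bar>y - d\<bar> + \<eta> \<le> \<theta> / 2 \<Longrightarrow>
      \<phi> (keyhole_lift \<rho> \<delta> K y' t) = planar r y \<phi> (keyhole \<rho> \<delta> K y' t)"
    by blast+
qed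

text \<open>
  A point \<open>w\<close> of the path with \<open>z / w \<in> [c, \<infinity>)\<close> would have the direction of \<open>z\<close> and modulus at most
  \<open>cmod z / c\<close>, but in this direction the bulge reaches further.
\<close>

lemma keyhole_avoids_slit:
  assumes \<rho>: "0 < \<rho>" and K: "0 \<le> K" and c: "0 < c" and \<delta>: "0 \<le> \<delta>" "\<delta> \<le> pi / 2"
    and z: "cmod z < c * \<rho> \<or> z = of_real (cmod z) * cis \<beta> \<and> \<bar>y - \<beta>\<bar> \<le> \<delta> / 2 \<and> cmod z \<le> c * (K * bump \<delta> (\<delta> / 2))"
  shows "\<not> (Im (z / keyhole \<rho> \<delta> K y t) = 0 \<and> c \<le> Re (z / keyhole \<rho> \<delta> K y t))"
proof
  let ?w = "keyhole \<rho> \<delta> K y t"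
  let ?R = "keyhole_radius \<rho> \<delta> K t"
  let ?a = "pi * (2 * t - 1)"
  assume u: "Im (z / ?w) = 0 \<and> c \<le> Re (z / ?w)"
  have R: "\<rho> \<le> ?R" "0 < ?R"
    using keyhole_radius_ge[OF K, of \<rho> \<delta> t] \<rho> by auto
  have "c \<le> cmod (z / ?w)"
    using u complex_Re_le_cmod[of "z / ?w"] by linarith
  then have zR: "c * ?R \<le> cmod z"
    using R norm_keyhole[OF \<rho> K] by (simp add: norm_divide pos_le_divide_eq)
  have "c * \<rho> \<le> c * ?R"
    using R c by simp
  with zR z have z': "z = of_real (cmod z) * cis \<beta>" "\<bar>y - \<beta>\<bar> \<le> \<delta> / 2" "cmod z \<le> c * (K * bump \<delta> (\<delta> / 2))"
    by auto
  have q: "z / ?w = of_real (cmod z / ?R) * cis (\<beta> - (y + ?a))"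
    by (subst z'(1)) (simp only: keyhole_def rcis_divide[unfolded rcis_def])
  have "0 < cmod z"
    using zR c R by (metis less_le_trans mult_pos_pos)
  then have zR0: "0 < cmod z / ?R"
    using R by simp
  have "Im (z / ?w) = cmod z / ?R * sin (\<beta> - (y + ?a))" "Re (z / ?w) = cmod z / ?R * cos (\<beta> - (y + ?a))"
    unfolding q by simp_all
  then have s: "sin (\<beta> - (y + ?a)) = 0" and "0 < cmod z / ?R * cos (\<beta> - (y + ?a))"
    using u zR0 c by auto
  then have co: "0 < cos (\<beta> - (y + ?a))"
    using zR0 by (metis zero_less_mult_pos)
  have "cos (\<beta> - (y + ?a)) = 1"
    using s co sin_zero_abs_cos_one by fastforce
  then have "cos ?a = cos (\<beta> - y)"
    using s cos_diff[of "\<beta> - y" "\<beta> - (y + ?a)"] by simp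
  also have "\<dots> = cos \<bar>y - \<beta>\<bar>"
    by (metis cos_abs_real abs_minus_commute)
  finally have "cos (\<delta> / 2) \<le> cos ?a"
    using z'(2) \<delta> by (simp only:) (intro cos_monotone_0_pi_le; simp)
  then have "K * bump \<delta> (\<delta> / 2) \<le> K * bump \<delta> ?a"
    using K by (intro mult_left_mono bump_mono)
  then have "K * bump \<delta> (\<delta> / 2) < ?R"
    using \<rho> by (simp add: keyhole_radius_def)
  then have "c * (K * bump \<delta> (\<delta> / 2)) < c * ?R"
    using c by simp
  then show False
    using zR z'(3) by linarith
qed

text \<open>Where the path is within \<open>\<delta> / 2\<close> of the direction of
  \<open>z\<close>, the bulge reaches far enough to make \<open>z / w\<close> small; elsewhere
  \<open>z / w\<close> is at least \<open>\<delta> / 2\<close> away from the positive axis in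
  argument. These are the two cases in which \<open>G n\<close> is estimated.\<close>

lemma keyhole_ratio:
  assumes \<rho>: "0 < \<rho>" and K: "0 \<le> K" and c: "0 < c" and \<delta>: "0 < \<delta>" "\<delta> \<le> pi / 2"
    and z: "z = of_real (cmod z) * cis y" "cmod z \<le> c / 2 * (K * bump \<delta> (\<delta> / 2))"
  shows "cmod (z / keyhole \<rho> \<delta> K y t) \<le> c / 2 \<or>
    Re (z / keyhole \<rho> \<delta> K y t) \<le> cmod (z / keyhole \<rho> \<delta> K y t) * cos (\<delta> / 2)"
proof -
  let ?w = "keyhole \<rho> \<delta> K y t"
  let ?R = "keyhole_radius \<rho> \<delta> K t"
  let ?a = "pi * (2 * t - 1)"
  have R: "\<rho> \<le> ?R" "0 < ?R"
    using keyhole_radius_ge[OF K, of \<rho> \<delta> t] \<rho> by auto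
  have q: "z / ?w = of_real (cmod z / ?R) * cis (y - (y + ?a))"
    by (subst z(1)) (simp only: keyhole_def rcis_divide[unfolded rcis_def])
  have nq: "cmod (z / ?w) = cmod z / ?R"
    using norm_keyhole[OF \<rho> K] by (simp add: norm_divide)
  show ?thesis
  proof (cases "cos ?a \<le> cos (\<delta> / 2)")
    case True
    have "Re (z / ?w) = cmod z / ?R * cos ?a"
      unfolding q by simp
    also have "\<dots> \<le> cmod z / ?R * cos (\<delta> / 2)"
      using True R by (intro mult_left_mono) auto
    finally show ?thesis
      using nq by simp
  next
    case False
    then have "K * bump \<delta> (\<delta> / 2) \<le> K * bump \<delta> ?a"
      using K by (intro mult_left_mono bump_mono) auto
    then have "K * bump \<delta> (\<delta> / 2) \<le> ?R"
      using \<rho> by (simp add: keyhole_radius_def)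
    then have "cmod z \<le> c / 2 * ?R"
      using z(2) c by (elim order_trans) (intro mult_left_mono; simp)
    then show ?thesis
      unfolding nq using R by (simp add: divide_le_eq)
  qed
qed

lemma bump_half_pos:
  assumes "0 < \<delta>" "\<delta> \<le> pi"
  shows "0 < bump \<delta> (\<delta> / 2)"
proof -
  have "cos \<delta> < cos (\<delta> / 2)"
    using assms by (intro cos_monotone_0_pi) auto
  then show ?thesis
    by (simp add: bump_def)
qed

subsection \<open>The moment derivatives as contour integrals\<close>

definition slit_plane :: "real \<Rightarrow> complex set" where
  "slit_plane c = {u. \<not> (Im u = 0 \<and> c \<le> Re u)}"

lemma open_slit_plane: "open (slit_plane c)"
proof -
  have "slit_plane c = - ({u. Im u = 0} \<inter> {u. c \<le> Re u})"
    by (auto simp: slit_plane_def)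
  then show ?thesis
    by (simp only: open_Compl closed_Int closed_Collect_eq closed_Collect_le continuous_on_id continuous_on_const continuous_on_Re continuous_on_Im)
qed

text \<open>Since \<open>2 * \<delta>\<close> is at most \<open>pi / 2\<close>, a cone of this
  half-opening has a planar reading. The margin \<open>2 * \<delta>\<close> between the sectors
  leaves \<open>\<delta>\<close> for the bulge and \<open>\<delta>\<close> for turning the path. The
  bound \<open>c * \<rho> / 2\<close> on \<open>rt\<close> gives
  \<open>cmod (z / w) \<le> c / 2\<close> for \<open>z\<close> in the small disc and
  \<open>w\<close> on the circle.\<close>

locale hat_transform =
  fixes d \<theta> r \<rho> c \<delta> :: real and \<phi> :: "hat_point \<Rightarrow> 'e::complex_banach"
    and G :: "nat \<Rightarrow> complex \<Rightarrow> complex" and \<theta>1 rt :: real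
  assumes \<phi>: "hat_holomorphic d \<theta> r \<phi>" and \<rho>: "0 < \<rho>" "\<rho> < r" and c: "0 < c"
    and \<delta>: "0 < \<delta>" "\<delta> \<le> pi / 4" and G: "\<And>n. G n holomorphic_on slit_plane c"
    and \<theta>1: "\<theta>1 / 2 + 2 * \<delta> \<le> \<theta> / 2" and rt: "rt \<le> \<rho>" "rt \<le> c * \<rho> / 2"
begin

definition transform :: "nat \<Rightarrow> complex \<Rightarrow> real \<Rightarrow> real \<Rightarrow> 'e" where
  "transform n z K y = vec_contour_integral (keyhole \<rho> \<delta> K y)
    (\<lambda>w. (G n (z / w) / w ^ Suc n) *\<^sub>C planar r y \<phi> w)"

text \<open>The factor makes \<open>c / 2 * (K * bump \<delta> (\<delta> / 2))\<close> equal to the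
  modulus of the point. Staying off the slit corresponds to \<open>c\<close> in place of
  \<open>c / 2\<close>; the reserve of a factor 2 yields the estimate of \<open>G n\<close> and
  allows the same path up to twice the modulus.\<close>

definition bulge :: "hat_point \<Rightarrow> real" where
  "bulge p = (case p of Disc z \<Rightarrow> 0 | Sect \<zeta> \<Rightarrow> 2 / (c * bump \<delta> (\<delta> / 2)) * exp (Re \<zeta>))"

text \<open>With the value \<open>pi\<close> on the disc, the keyhole without bulge starts at
  argument 0 and is literally \<open>circlepath 0 \<rho>\<close>.\<close>

definition direction :: "hat_point \<Rightarrow> real" where
  "direction p = (case p of Disc z \<Rightarrow> pi | Sect \<zeta> \<Rightarrow> Im \<zeta>)"

definition psi :: "nat \<Rightarrow> hat_point \<Rightarrow> 'e" where
  "psi n p = (1 / (2 * complex_of_real pi * \<i>)) *\<^sub>C transform n (proj p) (bulge p) (direction p)"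

lemma \<delta>': "0 \<le> \<delta>" "\<delta> \<le> pi" "\<delta> \<le> pi / 2" "2 * \<delta> \<le> pi / 2" "0 \<le> 2 * \<delta>"
  using \<delta> pi_gt_zero by auto

lemma bump_pos: "0 < bump \<delta> (\<delta> / 2)"
  using \<delta> \<delta>' by (intro bump_half_pos)

lemma bulge_nonneg: "0 \<le> bulge p"
  using c bump_pos by (cases p) (auto simp: bulge_def)

lemma keyhole_nonzero: "0 \<le> K \<Longrightarrow> keyhole \<rho> \<delta> K y t \<noteq> 0"
  using norm_keyhole[OF \<rho>(1), of K \<delta> y t] keyhole_radius_ge[of K \<rho> \<delta> t] \<rho> by auto

lemma slit_plane_keyhole:
  assumes "0 \<le> K" "cmod z < c * \<rho> \<or>
    z = of_real (cmod z) * cis \<beta> \<and> \<bar>y - \<beta>\<bar> \<le> \<delta> / 2 \<and> cmod z \<le> c * (K * bump \<delta> (\<delta> / 2))"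
  shows "z / keyhole \<rho> \<delta> K y t \<in> slit_plane c"
  using keyhole_avoids_slit[OF \<rho>(1) assms(1) c \<delta>'(1,3) assms(2)] by (simp add: slit_plane_def)

lemma planar_continuous:
  assumes "0 \<le> K" "K = 0 \<or> \<bar>y' - y\<bar> + \<delta> \<le> 2 * \<delta> \<and> \<bar>y - d\<bar> + 2 * \<delta> \<le> \<theta> / 2"
  shows "continuous_on (keyhole \<rho> \<delta> K y' ` {0..1}) (planar r y \<phi>)"
proof (cases "K = 0")
  case True
  have "keyhole \<rho> \<delta> K y' ` {0..1} \<subseteq> ball 0 r"
    using norm_keyhole[OF \<rho>(1) assms(1)] \<rho> True by (auto simp: keyhole_radius_def)
  then show ?thesis
    by (rule continuous_on_subset[OF vec_holomorphic_on_imp_continuous_on[OF planar_holomorphic_disc[OF \<phi>]]])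
next
  case False
  then have y: "\<bar>y' - y\<bar> + \<delta> \<le> 2 * \<delta>" "\<bar>y - d\<bar> + 2 * \<delta> \<le> \<theta> / 2"
    using assms by auto
  have "keyhole \<rho> \<delta> K y' ` {0..1} \<subseteq> ball 0 r \<union> direction_cone y (2 * \<delta>)"
    using keyhole_mem_planar_domain(1)[OF \<rho> assms(1) \<delta>'(1) _ disjI2[OF y(1)] \<delta>'(4)] by blast
  then show ?thesis
    by (rule continuous_on_subset[OF vec_holomorphic_on_imp_continuous_on[OF
          planar_holomorphic[OF \<phi> \<delta>'(5,4) y(2)]]])
qed

lemma transform_integrand_continuous:
  assumes K: "0 \<le> K" and z: "cmod z < c * \<rho> \<or>
      z = of_real (cmod z) * cis \<beta> \<and> \<bar>y' - \<beta>\<bar> \<le> \<delta> / 2 \<and> cmod z \<le> c * (K * bump \<delta> (\<delta> / 2))"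
    and y: "K = 0 \<or> \<bar>y' - y\<bar> + \<delta> \<le> 2 * \<delta> \<and> \<bar>y - d\<bar> + 2 * \<delta> \<le> \<theta> / 2"
  shows "continuous_on (keyhole \<rho> \<delta> K y' ` {0..1}) (\<lambda>w. (G n (z / w) / w ^ Suc n) *\<^sub>C planar r y \<phi> w)"
proof (intro scaleC.continuous_on planar_continuous[OF K y] continuous_on_divide continuous_on_power continuous_on_id)
  show "continuous_on (keyhole \<rho> \<delta> K y' ` {0..1}) (\<lambda>w. G n (z / w))"
    using keyhole_nonzero[OF K] slit_plane_keyhole[OF K z]
    by (intro continuous_on_compose2[OF holomorphic_on_imp_continuous_on[OF G]] continuous_intros) auto
qed (use keyhole_nonzero[OF K] in auto)

text \<open>The conditions keeping a keyhole off the slit and inside the planar domain persist when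
  \<open>K\<close> and \<open>y\<close> are interpolated linearly, so Cauchy's theorem for homotopic
  loops applies.\<close>

lemma vec_contour_integral_keyhole_eq:
  assumes y0: "\<bar>y0 - d\<bar> + 2 * \<delta> \<le> \<theta> / 2" and K: "0 \<le> K1" "0 \<le> K2"
    and y: "K1 = 0 \<and> K2 = 0 \<or> \<bar>y1 - y0\<bar> \<le> \<delta> \<and> \<bar>y2 - y0\<bar> \<le> \<delta>"
    and z: "cmod z < c * \<rho> \<or> z = of_real (cmod z) * cis \<beta> \<and> \<bar>y1 - \<beta>\<bar> \<le> \<delta> / 2 \<and> \<bar>y2 - \<beta>\<bar> \<le> \<delta> / 2 \<and>
      cmod z \<le> c * (K1 * bump \<delta> (\<delta> / 2)) \<and> cmod z \<le> c * (K2 * bump \<delta> (\<delta> / 2))"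
  shows "vec_contour_integral (keyhole \<rho> \<delta> K1 y1) (\<lambda>w. (G n (z / w) / w ^ Suc n) *\<^sub>C planar r y0 \<phi> w) =
    vec_contour_integral (keyhole \<rho> \<delta> K2 y2) (\<lambda>w. (G n (z / w) / w ^ Suc n) *\<^sub>C planar r y0 \<phi> w)"
proof -
  define S where "S = (ball 0 r \<union> direction_cone y0 (2 * \<delta>)) \<inter> ((- {0}) \<inter> (\<lambda>w. z / w) -` slit_plane c)"
  have open0: "open ((- {0 :: complex}) \<inter> (\<lambda>w. z / w) -` slit_plane c)"
    by (intro continuous_open_preimage open_slit_plane continuous_intros) auto
  then have S: "open S"
    unfolding S_def by (rule open_Int[OF open_Un[OF open_ball open_direction_cone]])
  have conv: "\<bar>(1 - s) * a + s * b - x\<bar> \<le> e" if "\<bar>a - x\<bar> \<le> e" "\<bar>b - x\<bar> \<le> e" "s \<in> {0..1}" for a b x e s :: real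
  proof -
    have "(1 - s) * a + s * b - x = (1 - s) * (a - x) + s * (b - x)"
      by (simp add: algebra_simps)
    also have "\<bar>\<dots>\<bar> \<le> (1 - s) * \<bar>a - x\<bar> + s * \<bar>b - x\<bar>"
      using that(3) by (intro order_trans[OF abs_triangle_ineq]) (simp add: abs_mult)
    also have "\<dots> \<le> e"
      using that by (intro convex_bound_le) auto
    finally show ?thesis .
  qed
  show ?thesis
  proof (rule vec_contour_integral_homotopic_loops[OF S _ C1_path_keyhole C1_path_keyhole])
    show "homotopic_loops S (keyhole \<rho> \<delta> K1 y1) (keyhole \<rho> \<delta> K2 y2)"
    proof (rule keyhole_homotopic_loops[OF \<delta>'(1,2)])
      fix s t :: real assume s: "s \<in> {0..1}" and t: "t \<in> {0..1}"
      let ?K = "(1 - s) * K1 + s * K2" and ?y = "(1 - s) * y1 + s * y2"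
      have K': "0 \<le> ?K"
        using K s by simp
      have "?K = 0 \<or> \<bar>?y - y0\<bar> + \<delta> \<le> 2 * \<delta>"
        using y conv[of y1 y0 \<delta> y2 s] s by auto
      then have 1: "keyhole \<rho> \<delta> ?K ?y t \<in> ball 0 r \<union> direction_cone y0 (2 * \<delta>)"
        by (rule keyhole_mem_planar_domain(1)[OF \<rho> K' \<delta>'(1) t _ \<delta>'(4)])
      have "cmod z < c * \<rho> \<or>
        z = of_real (cmod z) * cis \<beta> \<and> \<bar>?y - \<beta>\<bar> \<le> \<delta> / 2 \<and> cmod z \<le> c * (?K * bump \<delta> (\<delta> / 2))"
        using z
      proof (elim disjE conjE)
        assume a: "z = of_real (cmod z) * cis \<beta>" "\<bar>y1 - \<beta>\<bar> \<le> \<delta> / 2" "\<bar>y2 - \<beta>\<bar> \<le> \<delta> / 2"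
          "cmod z \<le> c * (K1 * bump \<delta> (\<delta> / 2))" "cmod z \<le> c * (K2 * bump \<delta> (\<delta> / 2))"
        have "cmod z = (1 - s) * cmod z + s * cmod z"
          by (simp add: algebra_simps)
        also have "\<dots> \<le> (1 - s) * (c * (K1 * bump \<delta> (\<delta> / 2))) + s * (c * (K2 * bump \<delta> (\<delta> / 2)))"
          using s a by (intro add_mono mult_left_mono) auto
        also have "\<dots> = c * (?K * bump \<delta> (\<delta> / 2))"
          by (simp add: algebra_simps)
        finally show ?thesis
          using a conv[OF a(2,3) s] by simp
      qed simp
      from slit_plane_keyhole[OF K' this]
      show "keyhole \<rho> \<delta> ?K ?y t \<in> S"
        using 1 keyhole_nonzero[OF K'] by (auto simp: S_def)
    qed
    show "vec_holomorphic_on (\<lambda>w. (G n (z / w) / w ^ Suc n) *\<^sub>C planar r y0 \<phi> w) S"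
    proof (rule vec_holomorphic_on_scaleC)
      have "G n \<circ> (\<lambda>w. z / w) holomorphic_on S"
        by (intro holomorphic_on_compose_gen[OF _ G] holomorphic_intros) (auto simp: S_def)
      then show "(\<lambda>w. G n (z / w) / w ^ Suc n) holomorphic_on S"
        unfolding o_def by (intro holomorphic_intros) (auto simp: S_def)
      show "vec_holomorphic_on (planar r y0 \<phi>) S"
        by (rule vec_holomorphic_on_subset[OF planar_holomorphic[OF \<phi> \<delta>'(5,4) y0]]) (auto simp: S_def)
    qed
  qed
qed

lemma direction_bound:
  assumes "p \<in> hat_sector d \<theta>1 rt"
  shows "bulge p = 0 \<or> \<bar>direction p - d\<bar> + 2 * \<delta> \<le> \<theta> / 2"
  using assms \<theta>1 by (auto simp: hat_sector_def log_sector_def bulge_def direction_def)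

lemma Sect_polar: "exp \<zeta> = of_real (cmod (exp \<zeta>)) * cis (Im \<zeta>)"
  by (subst norm_exp_eq_Re) (rule exp_eq_polar)

lemma bulge_Sect: "cmod (exp \<zeta>) = c / 2 * (bulge (Sect \<zeta>) * bump \<delta> (\<delta> / 2))"
  using c bump_pos by (simp add: bulge_def)

lemma admissible:
  assumes "p \<in> hat_sector d \<theta>1 rt"
  shows "cmod (proj p) < c * \<rho> \<or> proj p = of_real (cmod (proj p)) * cis (direction p) \<and>
    \<bar>direction p - direction p\<bar> \<le> \<delta> / 2 \<and> cmod (proj p) \<le> c * (bulge p * bump \<delta> (\<delta> / 2))"
proof (cases p)
  case (Disc z)
  then have "cmod z < rt"
    using assms by (auto simp: hat_sector_def)
  moreover have "rt \<le> c * \<rho>"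
    using rt c \<rho> by (auto intro: order_trans[OF rt(2)])
  ultimately show ?thesis
    using Disc by simp
next
  case (Sect \<zeta>)
  have "0 \<le> c * (bulge p * bump \<delta> (\<delta> / 2))"
    using c bulge_nonneg[of p] bump_pos by simp
  then have "cmod (exp \<zeta>) \<le> c * (bulge p * bump \<delta> (\<delta> / 2))"
    using bulge_Sect[of \<zeta>] Sect by simp
  then show ?thesis
    using Sect_polar[of \<zeta>] \<delta> Sect by (simp only: proj.simps direction_def hat_point.case) simp
qed

lemma proj_div_keyhole:
  "p \<in> hat_sector d \<theta>1 rt \<Longrightarrow> proj p / keyhole \<rho> \<delta> (bulge p) (direction p) t \<in> slit_plane c"
  by (rule slit_plane_keyhole[OF bulge_nonneg admissible])

lemma ratio_cases:
  assumes "p \<in> hat_sector d \<theta>1 rt"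
  shows "cmod (proj p / keyhole \<rho> \<delta> (bulge p) (direction p) t) \<le> c / 2 \<or>
    Re (proj p / keyhole \<rho> \<delta> (bulge p) (direction p) t) \<le>
      cmod (proj p / keyhole \<rho> \<delta> (bulge p) (direction p) t) * cos (\<delta> / 2)"
proof (cases p)
  case (Disc z)
  then have "cmod z \<le> c * \<rho> / 2"
    using assms rt by (auto simp: hat_sector_def)
  moreover have "cmod (keyhole \<rho> \<delta> (bulge p) (direction p) t) = \<rho>"
    using norm_keyhole[OF \<rho>(1) bulge_nonneg, of \<delta> p] Disc by (simp add: keyhole_radius_def bulge_def)
  ultimately show ?thesis
    using \<rho> Disc by (simp add: norm_divide divide_le_eq mult_ac)
next
  case (Sect \<zeta>)
  show ?thesis
    by (rule keyhole_ratio[OF \<rho>(1) bulge_nonneg c \<delta>(1) \<delta>'(3)])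
      (use Sect Sect_polar[of \<zeta>] bulge_Sect[of \<zeta>] in \<open>simp_all only: proj.simps direction_def hat_point.case order_refl\<close>)
qed

lemma psi_contour_continuous:
  "p \<in> hat_sector d \<theta>1 rt \<Longrightarrow> continuous_on (keyhole \<rho> \<delta> (bulge p) (direction p) ` {0..1})
    (\<lambda>w. (G n (proj p / w) / w ^ Suc n) *\<^sub>C planar r (direction p) \<phi> w)"
  using direction_bound[of p] \<delta> by (intro transform_integrand_continuous[OF bulge_nonneg admissible]) auto

lemma phi_keyhole_lift:
  assumes "p \<in> hat_sector d \<theta>1 rt" "t \<in> {0..1}"
  shows "\<phi> (keyhole_lift \<rho> \<delta> (bulge p) (direction p) t) =
    planar r (direction p) \<phi> (keyhole \<rho> \<delta> (bulge p) (direction p) t)"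
  using direction_bound[OF assms(1)] \<delta>
  by (intro keyhole_mem_planar_domain(2)[OF \<rho> bulge_nonneg \<delta>'(1) assms(2) _ \<delta>'(4) \<phi>]) auto

lemma psi_deformation:
  assumes "p \<in> hat_sector d \<theta>1 rt" "0 < r1" "r1 < r"
  shows "deformation_of_circle d \<theta> r r1 (keyhole_lift \<rho> \<delta> (bulge p) (direction p))"
  using direction_bound[OF assms(1)] \<delta>'(1) by (intro keyhole_lift_deformation[OF \<rho> assms(2,3) bulge_nonneg \<delta>'(1,2)]) auto

text \<open>On the sector the path moves with the point, so \<open>psi\<close> is not an integral
  with a holomorphic parameter as it stands. Near \<open>\<zeta>0\<close> the path is replaced by
  the one belonging to \<open>\<zeta>0\<close>, and the integral over this frozen path is
  holomorphic.\<close>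

lemma psi_holomorphic: "hat_holomorphic d \<theta>1 rt (psi n)"
  unfolding hat_holomorphic_def
proof (intro conjI ballI impI)
  have scale: "vec_holomorphic_on (\<lambda>x. (1 / (2 * complex_of_real pi * \<i>)) *\<^sub>C F x) N"
    if "vec_holomorphic_on F N" for F :: "complex \<Rightarrow> 'e" and N
    using that by (intro vec_holomorphic_on_scaleC holomorphic_on_const)
  show "vec_holomorphic_on (\<lambda>z. psi n (Disc z)) (ball 0 rt)"
    unfolding psi_def transform_def bulge_def direction_def hat_point.case proj.simps
  proof (rule scale, rule vec_contour_integral_quotient_holomorphic[where zf = "\<lambda>z. z", OF open_slit_plane G open_ball _ C1_path_keyhole])
    show "z / keyhole \<rho> \<delta> 0 pi t \<in> slit_plane c" if "z \<in> ball 0 rt" for z t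
    proof (rule slit_plane_keyhole)
      have "rt \<le> c * \<rho>"
        using rt c \<rho> by (auto intro: order_trans[OF rt(2)])
      then show "cmod z < c * \<rho> \<or>
        z = of_real (cmod z) * cis 0 \<and> \<bar>pi - 0\<bar> \<le> \<delta> / 2 \<and> cmod z \<le> c * (0 * bump \<delta> (\<delta> / 2))"
        using that by simp
    qed simp
  qed (auto intro!: planar_continuous holomorphic_intros simp: keyhole_nonzero)
  show "vec_holomorphic_on (\<lambda>\<zeta>. psi n (Sect \<zeta>)) (log_sector d \<theta>1)"
  proof (rule vec_holomorphic_on_local)
    fix \<zeta>0 assume \<zeta>0: "\<zeta>0 \<in> log_sector d \<theta>1"
    define K0 where "K0 = bulge (Sect \<zeta>0)"
    define y0 where "y0 = Im \<zeta>0"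
    \<comment> \<open>The bulge at \<open>\<zeta>0\<close> still shields the slit for points of up
      to twice the modulus and for directions within \<open>\<delta> / 2\<close>.\<close>
    define N where "N = log_sector d \<theta>1 \<inter> {\<zeta>. \<bar>Im \<zeta> - y0\<bar> < \<delta> / 2} \<inter> {\<zeta>. exp (Re \<zeta>) < 2 * exp (Re \<zeta>0)}"
    have N: "open N" "\<zeta>0 \<in> N"
    proof -
      show "open N"
        unfolding N_def by (intro open_Int open_log_sector open_Collect_less continuous_intros)
      show "\<zeta>0 \<in> N"
        using \<zeta>0 \<delta> by (simp add: N_def y0_def)
    qed
    have K0: "0 \<le> K0"
      by (simp add: K0_def bulge_nonneg)
    have y0: "\<bar>y0 - d\<bar> + 2 * \<delta> \<le> \<theta> / 2"
      using \<zeta>0 \<theta>1 by (auto simp: log_sector_def y0_def)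
    have adm: "exp \<zeta> = of_real (cmod (exp \<zeta>)) * cis (Im \<zeta>) \<and> \<bar>y0 - Im \<zeta>\<bar> \<le> \<delta> / 2 \<and> cmod (exp \<zeta>) \<le> c * (K0 * bump \<delta> (\<delta> / 2))"
      if "\<zeta> \<in> N" for \<zeta>
    proof -
      have "cmod (exp \<zeta>) \<le> 2 * cmod (exp \<zeta>0)"
        using that by (simp add: N_def)
      also have "\<dots> = c * (K0 * bump \<delta> (\<delta> / 2))"
        unfolding bulge_Sect K0_def by simp
      finally show ?thesis
        using that Sect_polar[of \<zeta>] by (simp only: N_def Int_iff mem_Collect_eq abs_minus_commute[of y0]) simp
    qed
    have "vec_holomorphic_on (\<lambda>\<zeta>. (1 / (2 * complex_of_real pi * \<i>)) *\<^sub>C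
        vec_contour_integral (keyhole \<rho> \<delta> K0 y0) (\<lambda>w. (G n (exp \<zeta> / w) / w ^ Suc n) *\<^sub>C planar r y0 \<phi> w)) N"
    proof (rule scale, rule vec_contour_integral_quotient_holomorphic[OF open_slit_plane G N(1) _ C1_path_keyhole])
      show "continuous_on (keyhole \<rho> \<delta> K0 y0 ` {0..1}) (planar r y0 \<phi>)"
        using y0 \<delta> by (intro planar_continuous K0) auto
      show "exp \<zeta> / keyhole \<rho> \<delta> K0 y0 t \<in> slit_plane c" if "\<zeta> \<in> N" for \<zeta> t
        by (rule slit_plane_keyhole[OF K0 disjI2[OF adm[OF that]]])
    qed (auto intro!: holomorphic_intros simp: keyhole_nonzero K0)
    moreover have "(1 / (2 * complex_of_real pi * \<i>)) *\<^sub>C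
        vec_contour_integral (keyhole \<rho> \<delta> K0 y0) (\<lambda>w. (G n (exp \<zeta> / w) / w ^ Suc n) *\<^sub>C planar r y0 \<phi> w) =
        psi n (Sect \<zeta>)" if \<zeta>: "\<zeta> \<in> N" for \<zeta>
    proof -
      let ?K = "bulge (Sect \<zeta>)" and ?y = "Im \<zeta>"
      have y: "\<bar>?y - d\<bar> + 2 * \<delta> \<le> \<theta> / 2" "\<bar>?y - y0\<bar> \<le> \<delta> / 2"
        using \<zeta> \<theta>1 by (auto simp: N_def log_sector_def)
      have yy: "\<bar>?y - y0\<bar> + \<delta> \<le> 2 * \<delta>"
        using y(2) \<delta> by auto
      have "vec_contour_integral (keyhole \<rho> \<delta> ?K ?y) (\<lambda>w. (G n (exp \<zeta> / w) / w ^ Suc n) *\<^sub>C planar r ?y \<phi> w) =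
        vec_contour_integral (keyhole \<rho> \<delta> ?K ?y) (\<lambda>w. (G n (exp \<zeta> / w) / w ^ Suc n) *\<^sub>C planar r y0 \<phi> w)"
      proof (rule vec_contour_integral_cong)
        fix t :: real assume t: "t \<in> {0..1}"
        have "planar r ?y \<phi> (keyhole \<rho> \<delta> ?K ?y t) = \<phi> (keyhole_lift \<rho> \<delta> ?K ?y t)"
          using y \<delta>' by (intro keyhole_mem_planar_domain(2)[OF \<rho> bulge_nonneg \<delta>'(1) t _ \<delta>'(4) \<phi>, symmetric]) auto
        also have "\<dots> = planar r y0 \<phi> (keyhole \<rho> \<delta> ?K ?y t)"
          using yy y0 by (intro keyhole_mem_planar_domain(2)[OF \<rho> bulge_nonneg \<delta>'(1) t _ \<delta>'(4) \<phi>]) auto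
        finally show "(G n (exp \<zeta> / keyhole \<rho> \<delta> ?K ?y t) / keyhole \<rho> \<delta> ?K ?y t ^ Suc n) *\<^sub>C planar r ?y \<phi> (keyhole \<rho> \<delta> ?K ?y t) =
          (G n (exp \<zeta> / keyhole \<rho> \<delta> ?K ?y t) / keyhole \<rho> \<delta> ?K ?y t ^ Suc n) *\<^sub>C planar r y0 \<phi> (keyhole \<rho> \<delta> ?K ?y t)"
          by (simp only:)
      qed
      also have "\<dots> = vec_contour_integral (keyhole \<rho> \<delta> K0 y0) (\<lambda>w. (G n (exp \<zeta> / w) / w ^ Suc n) *\<^sub>C planar r y0 \<phi> w)"
      proof (rule vec_contour_integral_keyhole_eq[OF y0 bulge_nonneg K0])
        show "?K = 0 \<and> K0 = 0 \<or> \<bar>?y - y0\<bar> \<le> \<delta> \<and> \<bar>y0 - y0\<bar> \<le> \<delta>"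
          using y(2) \<delta> by auto
        have "cmod (exp \<zeta>) \<le> c * (?K * bump \<delta> (\<delta> / 2))"
        proof -
          have "0 \<le> c * (?K * bump \<delta> (\<delta> / 2))"
            using c bulge_nonneg[of "Sect \<zeta>"] bump_pos by simp
          then show ?thesis
            using bulge_Sect[of \<zeta>] by simp
        qed
        then show "cmod (exp \<zeta>) < c * \<rho> \<or> exp \<zeta> = of_real (cmod (exp \<zeta>)) * cis ?y \<and> \<bar>?y - ?y\<bar> \<le> \<delta> / 2 \<and>
          \<bar>y0 - ?y\<bar> \<le> \<delta> / 2 \<and> cmod (exp \<zeta>) \<le> c * (?K * bump \<delta> (\<delta> / 2)) \<and> cmod (exp \<zeta>) \<le> c * (K0 * bump \<delta> (\<delta> / 2))"
          using adm[OF \<zeta>] \<delta> by (simp only:) simp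
      qed
      finally show ?thesis
        by (simp only: psi_def transform_def direction_def hat_point.case proj.simps)
    qed
    ultimately have "vec_holomorphic_on (\<lambda>\<zeta>. psi n (Sect \<zeta>)) N"
      by (rule vec_holomorphic_on_transform)
    with N show "\<exists>T. open T \<and> \<zeta>0 \<in> T \<and> vec_holomorphic_on (\<lambda>\<zeta>. psi n (Sect \<zeta>)) T"
      by blast
  qed
  fix \<zeta> assume \<zeta>: "\<zeta> \<in> log_sector d \<theta>1" and small: "cmod (exp \<zeta>) < rt"
  let ?K = "bulge (Sect \<zeta>)" and ?y = "Im \<zeta>"
  have "rt \<le> c * \<rho>"
    using rt c \<rho> by (auto intro: order_trans[OF rt(2)])
  then have z: "cmod (exp \<zeta>) < c * \<rho>"
    using small by linarith
  have y: "\<bar>?y - d\<bar> + 2 * \<delta> \<le> \<theta> / 2"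
    using \<zeta> \<theta>1 by (auto simp: log_sector_def)
  \<comment> \<open>For \<open>cmod z < c * \<rho>\<close> the forbidden segment of \<open>w\<close>
    lies inside the circle, so the bulge may be flattened and the bare circle turned until it starts
    at argument 0.\<close>
  have "transform n (exp \<zeta>) ?K ?y =
      vec_contour_integral (keyhole \<rho> \<delta> 0 ?y) (\<lambda>w. (G n (exp \<zeta> / w) / w ^ Suc n) *\<^sub>C planar r ?y \<phi> w)"
    unfolding transform_def using z \<delta>
    by (intro vec_contour_integral_keyhole_eq[OF y bulge_nonneg order_refl]) auto
  also have "\<dots> = vec_contour_integral (keyhole \<rho> \<delta> 0 pi) (\<lambda>w. (G n (exp \<zeta> / w) / w ^ Suc n) *\<^sub>C planar r ?y \<phi> w)"
    using z by (intro vec_contour_integral_keyhole_eq[OF y]) auto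
  also have "\<dots> = transform n (exp \<zeta>) 0 pi"
    unfolding transform_def
  proof (rule vec_contour_integral_cong)
    fix t :: real
    have "cmod (keyhole \<rho> \<delta> 0 pi t) < r"
      using norm_keyhole[OF \<rho>(1), of 0 \<delta> pi t] \<rho> by (simp add: keyhole_radius_def)
    then show "(G n (exp \<zeta> / keyhole \<rho> \<delta> 0 pi t) / keyhole \<rho> \<delta> 0 pi t ^ Suc n) *\<^sub>C planar r ?y \<phi> (keyhole \<rho> \<delta> 0 pi t) =
        (G n (exp \<zeta> / keyhole \<rho> \<delta> 0 pi t) / keyhole \<rho> \<delta> 0 pi t ^ Suc n) *\<^sub>C planar r pi \<phi> (keyhole \<rho> \<delta> 0 pi t)"
      by (simp add: planar_def)
  qed
  finally show "psi n (Sect \<zeta>) = psi n (Disc (exp \<zeta>))"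
    by (simp add: psi_def bulge_def direction_def)
qed

lemma keyhole_vector_derivative:
  "t \<in> {0..1} \<Longrightarrow> vector_derivative (keyhole \<rho> \<delta> K y) (at t within {0..1}) = keyhole_deriv \<rho> \<delta> K y t"
  by (rule vector_derivative_within_closed_interval[OF zero_less_one])
    (auto intro: has_vector_derivative_at_within has_vector_derivative_keyhole)

text \<open>The factor \<open>\<rho> + 8 * bulge p\<close> is the bound of
  \<open>norm_keyhole_deriv\<close> divided by \<open>2 * pi\<close>; \<open>cmod w\<close> is at
  least \<open>\<rho>\<close> on the path, whence the power of \<open>\<rho>\<close> in the
  denominator.\<close>

lemma psi_bound:
  assumes p: "p \<in> hat_sector d \<theta>1 rt" and X: "0 \<le> X"
    and GX: "\<And>u. cmod u \<le> c / 2 \<or> Re u \<le> cmod u * cos (\<delta> / 2) \<Longrightarrow> cmod (G n u) \<le> X"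
    and Y: "\<And>t. t \<in> {0..1} \<Longrightarrow> norm (\<phi> (keyhole_lift \<rho> \<delta> (bulge p) (direction p) t)) \<le> Y"
  shows "norm (psi n p) \<le> (\<rho> + 8 * bulge p) * (X / \<rho> ^ Suc n * Y)"
proof -
  let ?g = "keyhole \<rho> \<delta> (bulge p) (direction p)"
  have "norm (transform n (proj p) (bulge p) (direction p)) \<le>
      (2 * pi * \<rho> + 16 * pi * bulge p) * (X / \<rho> ^ Suc n * Y)"
    unfolding transform_def
  proof (rule norm_vec_contour_integral_le[OF C1_path_keyhole psi_contour_continuous[OF p]])
    show "0 \<le> 2 * pi * \<rho> + 16 * pi * bulge p"
      using \<rho> bulge_nonneg[of p] by simp
    show "cmod (vector_derivative ?g (at t within {0..1})) \<le> 2 * pi * \<rho> + 16 * pi * bulge p" if "t \<in> {0..1}" for t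
      unfolding keyhole_vector_derivative[OF that] by (rule norm_keyhole_deriv[OF \<rho>(1) bulge_nonneg])
    show "norm ((G n (proj p / ?g t) / ?g t ^ Suc n) *\<^sub>C planar r (direction p) \<phi> (?g t)) \<le> X / \<rho> ^ Suc n * Y"
      if t: "t \<in> {0..1}" for t
    proof -
      have "\<rho> \<le> cmod (?g t)"
        unfolding norm_keyhole[OF \<rho>(1) bulge_nonneg] by (rule keyhole_radius_ge[OF bulge_nonneg])
      then have "cmod (G n (proj p / ?g t)) / cmod (?g t) ^ Suc n \<le> X / \<rho> ^ Suc n"
        using X \<rho> by (intro frac_le GX ratio_cases[OF p] power_mono) auto
      moreover have "norm (planar r (direction p) \<phi> (?g t)) \<le> Y"
        using Y[OF t] phi_keyhole_lift[OF p t] by simp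
      ultimately show ?thesis
        unfolding norm_scaleC norm_divide norm_power using X \<rho>
        by (intro mult_mono) auto
    qed
  qed
  then have "norm (transform n (proj p) (bulge p) (direction p)) / (2 * pi) \<le>
      (2 * pi * \<rho> + 16 * pi * bulge p) * (X / \<rho> ^ Suc n * Y) / (2 * pi)"
    by (rule divide_right_mono) simp
  moreover have "norm (psi n p) = norm (transform n (proj p) (bulge p) (direction p)) / (2 * pi)"
    by (simp add: psi_def norm_scaleC norm_divide norm_mult)
  ultimately have "norm (psi n p) \<le> (2 * pi * \<rho> + 16 * pi * bulge p) * (X / \<rho> ^ Suc n * Y) / (2 * pi)"
    by (simp only:)
  also have "(2 * pi * \<rho> + 16 * pi * bulge p) * (X / \<rho> ^ Suc n * Y) / (2 * pi) = (\<rho> + 8 * bulge p) * (X / \<rho> ^ Suc n * Y)"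
  proof -
    have "2 * pi * \<rho> + 16 * pi * bulge p = (\<rho> + 8 * bulge p) * (2 * pi)"
      by (simp add: algebra_simps)
    then show ?thesis
      by simp
  qed
  finally show ?thesis .
qed

text \<open>By Cauchy's formula the Taylor coefficients of \<open>\<phi>\<close> are integrals over
  powers of \<open>w\<close>. Applying \<open>moment_diff\<close> \<open>n\<close> times shifts them
  by \<open>n\<close> and multiplies by a telescoping product equal to
  \<open>m (n + p) / m p\<close>, the coefficient of \<open>G n\<close>.\<close>

lemma psi_moment_derivative:
  assumes G_sums: "\<And>n u. cmod u < c \<Longrightarrow> (\<lambda>p. of_real (m (n + p) / m p) * u ^ p) sums G n u"
    and m: "\<And>p. m p \<noteq> 0" and "0 < rt"
  shows "is_moment_derivative m n \<phi> (psi n)"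
proof -
  define F where "F q = (1 / (2 * complex_of_real pi * \<i>)) *\<^sub>C
    vec_contour_integral (circlepath 0 \<rho>) (\<lambda>w. (1 / w ^ Suc q) *\<^sub>C \<phi> (Disc w))" for q
  have hol: "vec_holomorphic_on (\<lambda>w. \<phi> (Disc w)) (ball 0 r)"
    using \<phi> by (simp add: hat_holomorphic_def)
  then have cont: "continuous_on (sphere 0 \<rho>) (\<lambda>w. \<phi> (Disc w))"
    using \<rho> by (intro continuous_on_subset[OF vec_holomorphic_on_imp_continuous_on]) auto
  have norm_circle: "cmod (circlepath 0 \<rho> t) = \<rho>" for t
    using \<rho> by (simp add: circlepath norm_mult)
  have series: "(\<lambda>p. z ^ p *\<^sub>C a p *\<^sub>C F (k + p)) sums ((1 / (2 * complex_of_real pi * \<i>)) *\<^sub>C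
      vec_contour_integral (circlepath 0 \<rho>) (\<lambda>w. (g (z / w) / w ^ Suc k) *\<^sub>C \<phi> (Disc w)))"
    if "\<And>u. cmod u < b \<Longrightarrow> (\<lambda>p. a p * u ^ p) sums g u" "cmod z < b * \<rho>" for a g b k z
    using bounded_linear.sums[OF scaleC.bounded_linear_right
        vec_contour_integral_power_series[OF cont \<rho>(1) that], of "1 / (2 * complex_of_real pi * \<i>)" k]
    by (simp add: F_def scaleC_scaleC mult_ac)
  have taylor: "has_taylor_at_0 (\<lambda>z. \<phi> (Disc z)) (Abs_fps F)"
    unfolding has_taylor_at_0_def
  proof (intro exI[of _ \<rho>] conjI ballI \<rho>(1))
    fix z :: complex assume "z \<in> ball 0 \<rho>"
    then have z: "cmod z < \<rho>"
      by simp
    have "(\<lambda>p. z ^ p *\<^sub>C 1 *\<^sub>C F (0 + p)) sums ((1 / (2 * complex_of_real pi * \<i>)) *\<^sub>C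
      vec_contour_integral (circlepath 0 \<rho>) (\<lambda>w. (1 / (1 - z / w) / w ^ Suc 0) *\<^sub>C \<phi> (Disc w)))"
      using z by (intro series[of 1]) (auto intro: geometric_sums)
    also have "vec_contour_integral (circlepath 0 \<rho>) (\<lambda>w. (1 / (1 - z / w) / w ^ Suc 0) *\<^sub>C \<phi> (Disc w)) =
        vec_contour_integral (circlepath 0 \<rho>) (\<lambda>w. (1 / (w - z)) *\<^sub>C \<phi> (Disc w))"
    proof (rule vec_contour_integral_cong)
      fix t :: real
      have "circlepath 0 \<rho> t \<noteq> 0"
        using norm_circle[of t] \<rho> by auto
      then have "(1 - z / circlepath 0 \<rho> t) * circlepath 0 \<rho> t = circlepath 0 \<rho> t - z"
        by (simp add: left_diff_distrib)
      then have "1 / (1 - z / circlepath 0 \<rho> t) / circlepath 0 \<rho> t ^ Suc 0 = 1 / (circlepath 0 \<rho> t - z)"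
        by (simp only: divide_divide_eq_left power_Suc0_right)
      then show "(1 / (1 - z / circlepath 0 \<rho> t) / circlepath 0 \<rho> t ^ Suc 0) *\<^sub>C \<phi> (Disc (circlepath 0 \<rho> t)) =
          (1 / (circlepath 0 \<rho> t - z)) *\<^sub>C \<phi> (Disc (circlepath 0 \<rho> t))"
        by (simp only:)
    qed
    also have "(1 / (2 * complex_of_real pi * \<i>)) *\<^sub>C \<dots> = \<phi> (Disc z)"
      by (rule vec_Cauchy_integral_circlepath[OF hol \<rho> z, symmetric])
    finally show "(\<lambda>p. z ^ p *\<^sub>C fps_nth (Abs_fps F) p) sums \<phi> (Disc z)"
      by (simp add: scaleC_one)
  qed
  have coeff: "fps_nth ((moment_diff m ^^ n) (Abs_fps F)) p = of_real (m (n + p) / m p) *\<^sub>C F (n + p)" for p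
  proof (induction n arbitrary: p)
    case 0
    then show ?case
      using m by (simp add: scaleC_one)
  next
    case (Suc n)
    then show ?case
      using m by (simp add: moment_diff_def scaleR_scaleC scaleC_scaleC field_simps)
  qed
  have "has_taylor_at_0 (\<lambda>z. psi n (Disc z)) ((moment_diff m ^^ n) (Abs_fps F))"
    unfolding has_taylor_at_0_def
  proof (intro exI[of _ rt] conjI ballI \<open>0 < rt\<close>)
    fix z :: complex assume "z \<in> ball 0 rt"
    moreover have "rt \<le> c * \<rho>"
      using rt c \<rho> by (auto intro: order_trans[OF rt(2)])
    ultimately have z: "cmod z < c * \<rho>"
      by simp
    have "transform n z 0 pi = vec_contour_integral (circlepath 0 \<rho>) (\<lambda>w. (G n (z / w) / w ^ Suc n) *\<^sub>C \<phi> (Disc w))"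
      unfolding transform_def keyhole_0_eq_circlepath
      by (rule vec_contour_integral_cong) (use norm_circle \<rho> in \<open>simp add: planar_def\<close>)
    then show "(\<lambda>p. z ^ p *\<^sub>C fps_nth ((moment_diff m ^^ n) (Abs_fps F)) p) sums psi n (Disc z)"
      using series[OF G_sums z, of n] by (simp add: coeff psi_def bulge_def direction_def)
  qed
  with taylor show ?thesis
    unfolding is_moment_derivative_def by blast
qed

end

section \<open>Choice of the radius and absorption of the path into the growth estimate\<close>

theorem theorem3:
  fixes m :: "nat \<Rightarrow> real"
    and e E :: "complex \<Rightarrow> complex"
    and Mt :: "nat \<Rightarrow> real"
    and \<phi> :: "hat_point \<Rightarrow> 'e::complex_banach"
    and d \<theta> r :: real
  assumes "moment_sequence m e E"
    and "strongly_regular Mt"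
    and "0 < \<theta>" and "0 < r"
    and "\<phi> \<in> growth_space Mt d \<theta> r"
  shows "\<exists>rt. 0 < rt \<and> rt < r \<and>
    (\<forall>\<theta>1. 0 < \<theta>1 \<and> \<theta>1 < \<theta> \<longrightarrow>
      (\<exists>\<psi> :: nat \<Rightarrow> hat_point \<Rightarrow> 'e.
        (\<forall>n. hat_holomorphic d \<theta>1 rt (\<psi> n) \<and> is_moment_derivative m n \<phi> (\<psi> n)) \<and>
        (\<forall>z\<in>hat_sector d \<theta>1 rt. \<exists>\<gamma> \<tau>.
          (\<forall>r1. 0 < r1 \<and> r1 < r \<longrightarrow> deformation_of_circle d \<theta> r r1 \<gamma>) \<and>
          valid_path (proj \<circ> \<gamma>) \<and>
          (\<forall>w\<in>\<gamma> ` {0..1}.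
            \<exists>\<alpha>\<in>args w. \<tau> w \<in> {- \<alpha> - omega m * pi / 2 <..< - \<alpha> + omega m * pi / 2}) \<and>
          (\<forall>n.
            (\<forall>w\<in>\<gamma> ` {0..1}. ray_integrable (\<tau> w) (kernel_integrand e E n (proj z) (proj w))) \<and>
            (\<exists>I. has_hat_contour_integral
                  (\<lambda>w. ray_integral (\<tau> w) (kernel_integrand e E n (proj z) (proj w)) *\<^sub>C \<phi> w) I \<gamma> \<and>
                 \<psi> n z = (1 / (2 * complex_of_real pi * \<i>)) *\<^sub>C I))) \<and>
        (\<exists>C1>0. \<exists>C2>0. \<exists>C3>0. \<forall>n. \<forall>z\<in>hat_sector d \<theta>1 rt.
          norm (\<psi> n z) \<le> C1 * C2 ^ n * m n * exp (assoc_fun Mt (C3 * cmod (proj z))))))"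
proof -
  obtain M where M: "strongly_regular M" "omega M < 2" "kernel_functions M e E"
    and m: "\<And>p. complex_of_real (m p) = moment_fun e (of_nat p)" "\<And>p. 0 < m p"
    using assms(1) by (auto simp: moment_sequence_def)
  interpret K: moment_kernel M e E m
    by unfold_locales (use M m in auto)
  interpret Mt: strongly_regular_sequence Mt
    by unfold_locales (rule assms(2))
  obtain c and G :: "nat \<Rightarrow> complex \<Rightarrow> complex" and T :: "complex \<Rightarrow> real"
    where c: "0 < c"
      and G: "\<And>n. G n holomorphic_on {u. \<not> (Im u = 0 \<and> c \<le> Re u)}"
      and G_sums: "\<And>n u. cmod u < c \<Longrightarrow> (\<lambda>p. of_real (m (n + p) / m p) * u ^ p) sums G n u"
      and G_bound: "\<And>\<eta>. 0 < \<eta> \<Longrightarrow> \<eta> < pi / 2 \<Longrightarrow> \<exists>C>0. \<exists>B>0. \<forall>n u.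
        cmod u \<le> c / 2 \<or> Re u \<le> cmod u * cos \<eta> \<longrightarrow> cmod (G n u) \<le> C * B ^ n * m n"
      and T: "\<And>u. \<not> (Im u = 0 \<and> c \<le> Re u) \<Longrightarrow> \<bar>T u\<bar> < omega M * pi / 2"
      and ray: "\<And>n z w R \<alpha>. 0 < R \<Longrightarrow> w = of_real R * cis \<alpha> \<Longrightarrow> \<not> (Im (z / w) = 0 \<and> c \<le> Re (z / w)) \<Longrightarrow>
        ray_integrable (T (z / w) - \<alpha>) (kernel_integrand e E n z w) \<and>
        ray_integral (T (z / w) - \<alpha>) (kernel_integrand e E n z w) = G n (z / w) / w ^ Suc n"
    by (rule K.moment_resolvent) blast
  have \<phi>: "hat_holomorphic d \<theta> r \<phi>"
    using assms(5) by (simp add: growth_space_def)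
  define \<rho> where "\<rho> = r / 2"
  have \<rho>: "0 < \<rho>" "\<rho> < r"
    using assms(4) by (auto simp: \<rho>_def)
  \<comment> \<open>Fixed before \<open>\<theta>1\<close>, from \<open>c\<close> and
    \<open>\<rho>\<close> only; \<open>\<theta>1\<close> will enter through
    \<open>\<delta>\<close>.\<close>
  define rt where "rt = min \<rho> (c * \<rho> / 2)"
  have rt: "0 < rt" "rt < r" "rt \<le> \<rho>" "rt \<le> c * \<rho> / 2"
    using \<rho> c by (auto simp: rt_def)
  define al where "al w = (case w of Disc z \<Rightarrow> Arg z | Sect \<zeta> \<Rightarrow> Im \<zeta>)" for w
  have al: "al w \<in> args w" "proj w = of_real (cmod (proj w)) * cis (al w)" for w
  proof -
    have "z = of_real (cmod z) * cis (Arg z)" for z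
      using rcis_cmod_Arg[of z] by (simp add: rcis_def)
    moreover have "exp \<zeta> = of_real (cmod (exp \<zeta>)) * cis (Im \<zeta>)" for \<zeta>
      by (subst norm_exp_eq_Re) (rule exp_eq_polar)
    ultimately show "al w \<in> args w" "proj w = of_real (cmod (proj w)) * cis (al w)"
      by (cases w; simp only: al_def hat_point.case args.simps proj.simps mem_Collect_eq singleton_iff)+
  qed
  show ?thesis
  proof (intro exI[of _ rt] conjI allI impI rt(1,2))
    fix \<theta>1 assume \<theta>1: "0 < \<theta>1 \<and> \<theta>1 < \<theta>"
    \<comment> \<open>\<open>8 * \<delta> \<le> \<theta> - \<theta>1\<close> provides the margin of
      \<open>hat_transform\<close> and keeps the lifted paths in a proper subsector, where the
      growth condition on \<open>\<phi>\<close> is uniform.\<close>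
    define \<delta> where "\<delta> = min (pi / 4) ((\<theta> - \<theta>1) / 8)"
    have \<delta>: "0 < \<delta>" "\<delta> \<le> pi / 4" "8 * \<delta> \<le> \<theta> - \<theta>1"
      using \<theta>1 by (auto simp: \<delta>_def min_def)
    interpret H: hat_transform d \<theta> r \<rho> c \<delta> \<phi> G \<theta>1 rt
      by unfold_locales (use \<phi> \<rho> c \<delta> G \<theta>1 rt in \<open>auto simp: slit_plane_def\<close>)
    define \<gamma> where "\<gamma> p = keyhole_lift \<rho> \<delta> (H.bulge p) (H.direction p)" for p
    have proj_\<gamma>: "proj (\<gamma> p t) = keyhole \<rho> \<delta> (H.bulge p) (H.direction p) t" for p t
      unfolding \<gamma>_def by (rule proj_keyhole_lift[OF \<rho>(1) H.bulge_nonneg])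
    then have proj_\<gamma>': "proj \<circ> \<gamma> p = keyhole \<rho> \<delta> (H.bulge p) (H.direction p)" for p
      by auto
    \<comment> \<open>\<open>T\<close> is the direction of the product of \<open>w\<close> with the
      integration variable; subtracting the argument of \<open>w\<close> gives the direction of the
      variable itself, the same for all \<open>n\<close>.\<close>
    define \<tau> where "\<tau> p w = T (proj p / proj w) - al w" for p w
    have path: "(\<forall>r1. 0 < r1 \<and> r1 < r \<longrightarrow> deformation_of_circle d \<theta> r r1 (\<gamma> p)) \<and>
      valid_path (proj \<circ> \<gamma> p) \<and>
      (\<forall>w\<in>\<gamma> p ` {0..1}. \<exists>\<alpha>\<in>args w. \<tau> p w \<in> {- \<alpha> - omega m * pi / 2 <..< - \<alpha> + omega m * pi / 2}) \<and>
      (\<forall>n. (\<forall>w\<in>\<gamma> p ` {0..1}. ray_integrable (\<tau> p w) (kernel_integrand e E n (proj p) (proj w))) \<and>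
        (\<exists>I. has_hat_contour_integral
          (\<lambda>w. ray_integral (\<tau> p w) (kernel_integrand e E n (proj p) (proj w)) *\<^sub>C \<phi> w) I (\<gamma> p) \<and>
          H.psi n p = (1 / (2 * complex_of_real pi * \<i>)) *\<^sub>C I))" if p: "p \<in> hat_sector d \<theta>1 rt" for p
    proof (intro conjI allI impI ballI)
      show "deformation_of_circle d \<theta> r r1 (\<gamma> p)" if "0 < r1 \<and> r1 < r" for r1
        unfolding \<gamma>_def using that by (intro H.psi_deformation p) auto
      show "valid_path (proj \<circ> \<gamma> p)"
        unfolding proj_\<gamma>' by (rule C1_path_valid_path[OF C1_path_keyhole])
      have slit: "\<not> (Im (proj p / proj w) = 0 \<and> c \<le> Re (proj p / proj w))" "0 < cmod (proj w)"
        if "w \<in> \<gamma> p ` {0..1}" for w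
        using that H.proj_div_keyhole[OF p] H.keyhole_nonzero[OF H.bulge_nonneg]
        by (auto simp: proj_\<gamma> slit_plane_def)
      show "\<exists>\<alpha>\<in>args w. \<tau> p w \<in> {- \<alpha> - omega m * pi / 2 <..< - \<alpha> + omega m * pi / 2}"
        if w: "w \<in> \<gamma> p ` {0..1}" for w
        using T[OF slit(1)[OF w]] al(1)[of w] by (intro bexI[of _ "al w"]) (auto simp: \<tau>_def K.omega_moment abs_less_iff)
      fix n
      show "ray_integrable (\<tau> p w) (kernel_integrand e E n (proj p) (proj w))" if w: "w \<in> \<gamma> p ` {0..1}" for w
        unfolding \<tau>_def using ray[OF slit(2)[OF w] al(2) slit(1)[OF w]] by blast
      let ?g = "keyhole \<rho> \<delta> (H.bulge p) (H.direction p)"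
      let ?F = "\<lambda>w. (G n (proj p / w) / w ^ Suc n) *\<^sub>C planar r (H.direction p) \<phi> w"
      have "((\<lambda>t. vector_derivative ?g (at t within {0..1}) *\<^sub>C ?F (?g t)) has_integral
          vec_contour_integral ?g ?F) {0..1}"
        by (rule has_vec_contour_integral[OF C1_path_keyhole H.psi_contour_continuous[OF p]])
      then have "has_hat_contour_integral
          (\<lambda>w. ray_integral (\<tau> p w) (kernel_integrand e E n (proj p) (proj w)) *\<^sub>C \<phi> w)
          (vec_contour_integral ?g ?F) (\<gamma> p)"
        unfolding has_hat_contour_integral_def proj_\<gamma>'
      proof (rule has_integral_eq[rotated])
        fix t :: real assume t: "t \<in> {0..1}"
        then have w: "\<gamma> p t \<in> \<gamma> p ` {0..1}"
          by blast
        have "ray_integral (\<tau> p (\<gamma> p t)) (kernel_integrand e E n (proj p) (proj (\<gamma> p t))) =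
            G n (proj p / ?g t) / ?g t ^ Suc n"
          unfolding \<tau>_def using ray[OF slit(2)[OF w] al(2) slit(1)[OF w], of n] proj_\<gamma>[of p t] by simp
        moreover have "\<phi> (\<gamma> p t) = planar r (H.direction p) \<phi> (?g t)"
          unfolding \<gamma>_def by (rule H.phi_keyhole_lift[OF p t])
        ultimately show "vector_derivative ?g (at t within {0..1}) *\<^sub>C ?F (?g t) =
            vector_derivative ?g (at t within {0..1}) *\<^sub>C
            ray_integral (\<tau> p (\<gamma> p t)) (kernel_integrand e E n (proj p) (proj (\<gamma> p t))) *\<^sub>C \<phi> (\<gamma> p t)"
          by (simp only:)
      qed
      then show "\<exists>I. has_hat_contour_integral
          (\<lambda>w. ray_integral (\<tau> p w) (kernel_integrand e E n (proj p) (proj w)) *\<^sub>C \<phi> w) I (\<gamma> p) \<and>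
          H.psi n p = (1 / (2 * complex_of_real pi * \<i>)) *\<^sub>C I"
        by (auto simp only: H.psi_def H.transform_def)
    qed
    have bound: "\<exists>C1>0. \<exists>C2>0. \<exists>C3>0. \<forall>n. \<forall>p\<in>hat_sector d \<theta>1 rt.
        norm (H.psi n p) \<le> C1 * C2 ^ n * m n * exp (assoc_fun Mt (C3 * cmod (proj p)))"
    proof -
      \<comment> \<open>The growth condition gives constants only on smaller sectors and discs;
        these two are large enough for the paths of all points at once.\<close>
      define \<theta>' where "\<theta>' = (\<theta> + \<theta>1) / 2"
      define r' where "r' = 3 * r / 4"
      have "0 < \<theta>'" "\<theta>' < \<theta>" "0 < r'" "r' < r" "\<rho> < r'"
        using \<theta>1 assms(4) by (auto simp: \<theta>'_def r'_def \<rho>_def)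
      then obtain a k where ak: "0 < a" "0 < k" "\<And>w. w \<in> hat_sector d \<theta>' r' \<Longrightarrow>
          norm (\<phi> w) \<le> a * exp (assoc_fun Mt (cmod (proj w) / k))"
        using assms(5) unfolding growth_space_def by blast
      have "0 < \<delta> / 2" "\<delta> / 2 < pi / 2"
        using \<delta> pi_gt_zero by auto
      then obtain C B where CB: "0 < C" "0 < B" "\<And>n u. cmod u \<le> c / 2 \<or> Re u \<le> cmod u * cos (\<delta> / 2) \<Longrightarrow>
          cmod (G n u) \<le> C * B ^ n * m n"
        using G_bound[of "\<delta> / 2"] by blast
      define b where "b = 2 / (c * bump \<delta> (\<delta> / 2))"
      have b: "0 < b"
        using c H.bump_pos by (simp add: b_def)
      have bulge_le: "H.bulge p \<le> b * cmod (proj p)" for p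
        using b by (cases p) (auto simp: H.bulge_def b_def)
      obtain A where A: "2 \<le> A" "\<And>t. 0 \<le> t \<Longrightarrow> (exp (assoc_fun Mt t))\<^sup>2 \<le> exp (assoc_fun Mt (A * t))"
        by (rule Mt.exp_assoc_square) blast
      let ?e = "\<lambda>t. exp (assoc_fun Mt t)"
      \<comment> \<open>On the path \<open>cmod w\<close> is at most
        \<open>\<rho> + 4 * b * cmod z\<close>, hence at most \<open>2 * \<rho>\<close> or at most
        \<open>8 * b * cmod z\<close>. \<open>L\<close> serves the former case and the dilation
        \<open>s\<close> the latter; both growth factors are at least 1, so their product serves
        either.\<close>
      define L where "L = ?e (2 * \<rho> / k)"
      define s where "s = max (8 * b / k) 1"
      have s: "1 \<le> s" "8 * b / k \<le> s"
        by (auto simp: s_def)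
      have \<phi>_bound: "norm (\<phi> (\<gamma> p t)) \<le> a * (L * ?e (s * cmod (proj p)))"
        if p: "p \<in> hat_sector d \<theta>1 rt" and t: "t \<in> {0..1}" for p t
      proof -
        have "\<gamma> p t \<in> hat_sector d \<theta>' r'"
        proof (cases "H.bulge p * bump \<delta> (pi * (2 * t - 1)) = 0")
          case True
          then have "cmod (keyhole \<rho> \<delta> (H.bulge p) (H.direction p) t) = \<rho>"
            using norm_keyhole[OF \<rho>(1) H.bulge_nonneg, of \<delta> p "H.direction p" t] by (simp add: keyhole_radius_def)
          then show ?thesis
            using True \<open>\<rho> < r'\<close> by (simp add: \<gamma>_def keyhole_lift_def hat_sector_def)
        next
          case False
          have "\<bar>pi * (2 * t - 1)\<bar> \<le> pi * 1"
            unfolding abs_mult using t by (intro mult_mono) auto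
          then have 1: "\<bar>pi * (2 * t - 1)\<bar> < \<delta>"
            using False \<delta> by (intro bump_nonzero_imp) auto
          have "\<bar>H.direction p - d\<bar> < \<theta>1 / 2"
            using p False by (auto simp: hat_sector_def H.bulge_def H.direction_def log_sector_def)
          then have "\<bar>H.direction p + pi * (2 * t - 1) - d\<bar> < \<theta>' / 2"
            using 1 \<delta> unfolding \<theta>'_def by argo
          then show ?thesis
            using False by (simp add: \<gamma>_def keyhole_lift_def hat_sector_def keyhole_log_def log_sector_def)
        qed
        then have "norm (\<phi> (\<gamma> p t)) \<le> a * ?e (cmod (proj (\<gamma> p t)) / k)"
          by (rule ak(3))
        also have "?e (cmod (proj (\<gamma> p t)) / k) \<le> L * ?e (s * cmod (proj p))"
        proof -
          let ?z = "cmod (proj p)"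
          have "cmod (proj (\<gamma> p t)) \<le> \<rho> + 4 * H.bulge p"
            unfolding proj_\<gamma> norm_keyhole[OF \<rho>(1) H.bulge_nonneg] by (rule keyhole_radius_le[OF H.bulge_nonneg])
          also have "\<dots> \<le> \<rho> + 4 * b * ?z"
            using bulge_le[of p] by simp
          finally have w: "cmod (proj (\<gamma> p t)) \<le> \<rho> + 4 * b * ?z" .
          have L1: "1 \<le> L" and e1: "1 \<le> ?e (s * ?z)"
            unfolding L_def using \<rho> ak s by (intro Mt.exp_assoc_ge_1; simp)+
          show ?thesis
          proof (cases "4 * b * ?z \<le> \<rho>")
            case True
            then have "cmod (proj (\<gamma> p t)) / k \<le> 2 * \<rho> / k"
              using w ak by (intro divide_right_mono) auto
            then have "?e (cmod (proj (\<gamma> p t)) / k) \<le> L"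
              unfolding L_def exp_le_cancel_iff using ak by (intro Mt.assoc_fun_mono) auto
            also have "\<dots> \<le> L * ?e (s * ?z)"
              using L1 e1 by (simp add: mult_le_cancel_left1)
            finally show ?thesis .
          next
            case False
            then have "cmod (proj (\<gamma> p t)) / k \<le> (8 * b * ?z) / k"
              using w ak by (intro divide_right_mono) auto
            also have "\<dots> = 8 * b / k * ?z"
              by simp
            also have "\<dots> \<le> s * ?z"
              using s by (intro mult_right_mono) auto
            finally have "?e (cmod (proj (\<gamma> p t)) / k) \<le> ?e (s * ?z)"
              unfolding exp_le_cancel_iff using ak by (intro Mt.assoc_fun_mono) auto
            also have "\<dots> \<le> L * ?e (s * ?z)"
              using L1 e1 by (simp add: mult_le_cancel_right1)
            finally show ?thesis .
          qed
        qed
        finally show ?thesis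
          using ak by (simp add: mult_left_mono)
      qed
      \<comment> \<open>The length factor \<open>\<rho> + 8 * bulge p\<close> is at most linear in
        \<open>cmod z\<close>; the term \<open>t / Mt 1\<close> of index 1 in the supremum bounds it
        by \<open>D\<close> times a second growth factor, and \<open>exp_assoc_square\<close> merges
        the two.\<close>
      define D where "D = \<rho> + 8 * b * Mt 1"
      have D: "0 < D"
        using \<rho> b Mt.pos[of 1] by (simp add: D_def add_pos_pos)
      have "norm (H.psi n p) \<le> (D * (C / \<rho>) * a * L) * (B / \<rho>) ^ n * m n * ?e (A * s * cmod (proj p))"
        if p: "p \<in> hat_sector d \<theta>1 rt" for n p
      proof -
        let ?z = "cmod (proj p)"
        have "norm (H.psi n p) \<le> (\<rho> + 8 * H.bulge p) * (C * B ^ n * m n / \<rho> ^ Suc n * (a * (L * ?e (s * ?z))))"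
          using CB m(2)[of n] \<phi>_bound[OF p] unfolding \<gamma>_def by (intro H.psi_bound p) (auto simp: less_imp_le)
        also have "\<dots> \<le> (D * ?e (s * ?z)) * (C * B ^ n * m n / \<rho> ^ Suc n * (a * (L * ?e (s * ?z))))"
        proof (rule mult_right_mono)
          have "?z \<le> s * ?z"
            using s by (simp add: mult_le_cancel_right1)
          also have "s * ?z / Mt 1 \<le> ?e (s * ?z)"
            using Mt.power_le_exp_assoc[of "s * ?z" 1] s by simp
          then have "s * ?z \<le> Mt 1 * ?e (s * ?z)"
            using Mt.pos[of 1] by (simp add: pos_divide_le_eq mult.commute)
          finally have "8 * b * ?z \<le> 8 * b * (Mt 1 * ?e (s * ?z))"
            using b by (intro mult_left_mono) auto
          moreover have "\<rho> * 1 \<le> \<rho> * ?e (s * ?z)"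
            using \<rho> s by (intro mult_left_mono Mt.exp_assoc_ge_1) auto
          moreover have "8 * H.bulge p \<le> 8 * b * ?z"
            using bulge_le[of p] by simp
          ultimately show "\<rho> + 8 * H.bulge p \<le> D * ?e (s * ?z)"
            by (simp add: D_def algebra_simps)
          show "0 \<le> C * B ^ n * m n / \<rho> ^ Suc n * (a * (L * ?e (s * ?z)))"
            using CB m(2)[of n] \<rho> ak by (simp add: L_def)
        qed
        also have "\<dots> = (D * (C / \<rho>) * a * L) * (B / \<rho>) ^ n * m n * (?e (s * ?z))\<^sup>2"
          by (simp add: power2_eq_square power_divide)
        also have "\<dots> \<le> (D * (C / \<rho>) * a * L) * (B / \<rho>) ^ n * m n * ?e (A * (s * ?z))"
          using D CB \<rho> ak m(2)[of n] s by (intro mult_left_mono A(2)) (auto simp: L_def)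
        finally show ?thesis
          by (simp only: mult.assoc)
      qed
      moreover have "0 < D * (C / \<rho>) * a * L" "0 < B / \<rho>" "0 < A * s"
        using D CB \<rho> ak A s by (auto simp: L_def)
      ultimately show ?thesis
        by blast
    qed
    have md: "is_moment_derivative m n \<phi> (H.psi n)" for n
      by (rule H.psi_moment_derivative[OF G_sums _ rt(1)]) auto
    show "\<exists>\<psi> :: nat \<Rightarrow> hat_point \<Rightarrow> 'e.
        (\<forall>n. hat_holomorphic d \<theta>1 rt (\<psi> n) \<and> is_moment_derivative m n \<phi> (\<psi> n)) \<and>
        (\<forall>z\<in>hat_sector d \<theta>1 rt. \<exists>\<gamma> \<tau>.
          (\<forall>r1. 0 < r1 \<and> r1 < r \<longrightarrow> deformation_of_circle d \<theta> r r1 \<gamma>) \<and>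
          valid_path (proj \<circ> \<gamma>) \<and>
          (\<forall>w\<in>\<gamma> ` {0..1}.
            \<exists>\<alpha>\<in>args w. \<tau> w \<in> {- \<alpha> - omega m * pi / 2 <..< - \<alpha> + omega m * pi / 2}) \<and>
          (\<forall>n.
            (\<forall>w\<in>\<gamma> ` {0..1}. ray_integrable (\<tau> w) (kernel_integrand e E n (proj z) (proj w))) \<and>
            (\<exists>I. has_hat_contour_integral
                  (\<lambda>w. ray_integral (\<tau> w) (kernel_integrand e E n (proj z) (proj w)) *\<^sub>C \<phi> w) I \<gamma> \<and>
                 \<psi> n z = (1 / (2 * complex_of_real pi * \<i>)) *\<^sub>C I))) \<and>
        (\<exists>C1>0. \<exists>C2>0. \<exists>C3>0. \<forall>n. \<forall>z\<in>hat_sector d \<theta>1 rt.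
          norm (\<psi> n z) \<le> C1 * C2 ^ n * m n * exp (assoc_fun Mt (C3 * cmod (proj z))))"
    proof (intro exI[of _ H.psi] conjI allI ballI H.psi_holomorphic md bound)
      fix p assume "p \<in> hat_sector d \<theta>1 rt"
      from path[OF this] show "\<exists>\<gamma> \<tau>.
          (\<forall>r1. 0 < r1 \<and> r1 < r \<longrightarrow> deformation_of_circle d \<theta> r r1 \<gamma>) \<and>
          valid_path (proj \<circ> \<gamma>) \<and>
          (\<forall>w\<in>\<gamma> ` {0..1}.
            \<exists>\<alpha>\<in>args w. \<tau> w \<in> {- \<alpha> - omega m * pi / 2 <..< - \<alpha> + omega m * pi / 2}) \<and>
          (\<forall>n.
            (\<forall>w\<in>\<gamma> ` {0..1}. ray_integrable (\<tau> w) (kernel_integrand e E n (proj p) (proj w))) \<and>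
            (\<exists>I. has_hat_contour_integral
                  (\<lambda>w. ray_integral (\<tau> w) (kernel_integrand e E n (proj p) (proj w)) *\<^sub>C \<phi> w) I \<gamma> \<and>
                 H.psi n p = (1 / (2 * complex_of_real pi * \<i>)) *\<^sub>C I))"
        by (intro exI)
    qed
  qed
qed

end
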